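(* Let $d\ge1$, $\alpha>0$, and let $\{z(x)\}_{x\in\mathbb{Z}^d}$ be non-negative i.i.d. random variables under $\mathbb{P}$ with $\mathbb{P}(z(x)>r)=r^{-\alpha+o(1)}$ as $r\to\infty$. Let $((X_t)_{t\ge0},P^\omega_x)$ be the random walk in layered random conductance on $\mathbb{Z}^{1+d}$ built from $z$, i.e. the continuous time Markov chain which jumps from $x=(x_1,x_2)\in\mathbb{Z}\times\mathbb{Z}^d$ to $x\pm\mathbf{e}_1$ at rate $z(x_2)$ each and to $x\pm\mathbf{e}_i$, $2\le i\le d+1$, at rate $1$ each. Let $\gamma\le\frac12$ and let $\mathbf{e}$ be a unit vector orthogonal to $\mathbf{e}_1$. Suppose $d=1$ and $\delta<\frac12\vee\frac{\alpha+1}{4\alpha}$, or $d\ge2$ and $\delta<\frac12\vee\frac{d}{4\alpha}$. Then, $\mathbb{P}$-almost surely, $P^\omega_0(X_t=t^\delta\mathbf{e}_1+t^\gamma\mathbf{e})$ is bounded from below by a negative power of $t$ (that is, there is $m>0$ such that it is at least $t^{-m}$ for all sufficiently large $t$).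
   Context: Points of $\mathbb{Z}^{1+d}$ are written $x=(x_1,x_2)$ with $x_1\in\mathbb{Z}$, $x_2\in\mathbb{Z}^d$; $\mathbf{e}_1,\dots,\mathbf{e}_{d+1}$ are the standard unit vectors. The environment is $\omega(x,x\pm\mathbf{e}_1)=z(x_2)$ and $\omega(x,x\pm\mathbf{e}_i)=1$ for $i\ge2$; it is random through $z$, and $P_x^\omega$ is the law of the chain with jump rates $\omega$ started at $x$, for fixed (quenched) $\omega$. Any point of $\mathbb{R}^{k}\setminus\mathbb{Z}^{k}$ (such as $t^\delta\mathbf{e}_1+t^\gamma\mathbf{e}$) is to be understood as a closest lattice point. $a\vee b=\max(a,b)$. $\mathbb{P}(z(x)>r)=r^{-\alpha+o(1)}$ means $\log\mathbb{P}(z(x)>r)/\log r\to-\alpha$. *)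

theory Defs
  imports "HOL-Probability.Probability"
begin

text \<open>Points of the lattice \<open>\<int>\<^sup>1\<^sup>+\<^sup>d\<close> are pairs \<open>(x\<^sub>1, x\<^sub>2)\<close>, with \<open>d = CARD('d)\<close>.\<close>

type_synonym 'd site = "int \<times> (int ^ 'd)"

definition layered_rate :: "(int ^ 'd \<Rightarrow> real) \<Rightarrow> 'd site \<Rightarrow> 'd site \<Rightarrow> real" where
  "layered_rate z x y =
     (if y = x + (1, 0) \<or> y = x - (1, 0) then z (snd x)
      else if \<exists>i. y = x + (0, axis i 1) \<or> y = x - (0, axis i 1) then 1
      else 0)"

definition exit_rate :: "('s \<Rightarrow> 's \<Rightarrow> real) \<Rightarrow> 's \<Rightarrow> real" where
  "exit_rate c x = (\<Sum>\<^sub>\<infinity>y. c x y)"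

text \<open>
  The process \<open>X\<close>, under the probability measure \<open>N\<close>, is a continuous time Markov chain with
  jump rates \<open>c\<close> started at \<open>x\<^sub>0\<close>, described by its jump chain \<open>Y\<close> and its holding times \<open>S\<close>:
  \<open>Y\<close> is a discrete time Markov chain with transition matrix \<open>c x y / exit_rate c x\<close>, and given
  \<open>Y\<close> the \<open>S i\<close> are independent and exponential with parameters \<open>exit_rate c (Y i)\<close>. Both
  statements are contained in the formula for the joint law.

  The definition is meant for rates that vanish on the diagonal and have finite positive exit
  rates (no absorbing states). It leaves \<open>X\<close> unspecified after a possible explosion; the layered
  walk does not explode.
\<close>

definition markov_chain_with_rates ::
    "'b measure \<Rightarrow> (real \<Rightarrow> 'b \<Rightarrow> 's) \<Rightarrow> ('s \<Rightarrow> 's \<Rightarrow> real) \<Rightarrow> 's \<Rightarrow> bool" where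
  "markov_chain_with_rates N X c x\<^sub>0 \<longleftrightarrow>
     prob_space N \<and>
     (\<forall>t\<ge>0. X t \<in> measurable N (count_space UNIV)) \<and>
     (\<exists>Y S. (\<forall>n::nat. Y n \<in> measurable N (count_space UNIV)) \<and>
        (\<forall>n::nat. S n \<in> borel_measurable N) \<and>
        (\<forall>n y s. (\<forall>i\<le>n. 0 \<le> s i) \<longrightarrow>
           measure N {w \<in> space N. \<forall>i\<le>n. Y i w = y i \<and> s i < S i w} =
             (if y 0 = x\<^sub>0 then 1 else 0) *
             (\<Prod>i<n. c (y i) (y (Suc i)) / exit_rate c (y i)) *
             (\<Prod>i\<le>n. exp (- exit_rate c (y i) * s i))) \<and>
        (AE w in N. \<forall>n t. (\<Sum>i<n. S i w) \<le> t \<and> t < (\<Sum>i\<le>n. S i w) \<longrightarrow> X t w = Y n w))"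

definition real_site :: "'d site \<Rightarrow> real \<times> (real ^ 'd)" where
  "real_site x = (of_int (fst x), \<chi> i. of_int (snd x $ i))"

text \<open>A closest lattice point need not be unique.\<close>

definition closest_site :: "real \<times> (real ^ 'd) \<Rightarrow> 'd site \<Rightarrow> bool" where
  "closest_site p x \<longleftrightarrow> (\<forall>x'. dist (real_site x) p \<le> dist (real_site x') p)"

text \<open>
  The definition is not vacuous: for every non-negative environment the layered walk exists, with
  one process \<open>X\<close> for all environments and all starting points. In the construction, the jumps out
  of each site are taken from independent stacks of instructions, and the holding times are
  rescaled standard exponential variables.
\<close>

lemma markov_chain_with_rates_exists:
  fixes c :: "'r \<Rightarrow> 's :: countable \<Rightarrow> 's \<Rightarrow> real"
  assumes nonneg: "\<And>r x y. 0 \<le> c r x y"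
    and fin: "\<And>r x. finite {y. c r x y \<noteq> 0}"
    and pos: "\<And>r x. 0 < exit_rate (c r) x"
  shows "\<exists>(P :: 'r \<Rightarrow> 's \<Rightarrow> ((nat \<Rightarrow> 's) \<times> (nat \<Rightarrow> real)) measure) X.
           \<forall>r x. markov_chain_with_rates (P r x) X (c r) x"
proof -
  define X :: "real \<Rightarrow> (nat \<Rightarrow> 's) \<times> (nat \<Rightarrow> real) \<Rightarrow> 's"
    where "X t w = fst w (LEAST n. t < (\<Sum>i\<le>n. snd w i))" for t w
  have "\<exists>N. markov_chain_with_rates N X (c r) x\<^sub>0" for r x\<^sub>0
  proof -
    define q where "q = exit_rate (c r)"
    have q: "0 < q x" for x using pos by (simp add: q_def)
    have qsum: "q x = (\<Sum>y\<in>{y. c r x y \<noteq> 0}. c r x y)" for x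
      unfolding q_def exit_rate_def
      by (subst infsum_finite[OF fin, symmetric]) (rule infsum_cong_neutral, auto)
    define J where "J x = embed_pmf (\<lambda>y. c r x y / q x)" for x
    have J: "pmf (J x) y = c r x y / q x" for x y
      unfolding J_def
    proof (rule pmf_embed_pmf)
      show "0 \<le> c r x y / q x" for y using nonneg q[of x] by simp
      have "(\<integral>\<^sup>+ y. ennreal (c r x y / q x) \<partial>count_space UNIV)
          = (\<Sum>y | c r x y \<noteq> 0. ennreal (c r x y / q x))"
        using fin[of r x] by (subst nn_integral_count_space'[where A = "{y. c r x y \<noteq> 0}"]) auto
      also have "\<dots> = ennreal (\<Sum>y | c r x y \<noteq> 0. c r x y / q x)"
        using nonneg q[of x] by (subst sum_ennreal) auto
      also have "(\<Sum>y | c r x y \<noteq> 0. c r x y / q x) = 1"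
        using q[of x] by (simp add: sum_divide_distrib[symmetric] qsum[symmetric])
      finally show "(\<integral>\<^sup>+ y. ennreal (c r x y / q x) \<partial>count_space UNIV) = 1" by simp
    qed
    define E where "E = density lborel (exponential_density 1)"
    have E_prob: "prob_space E" unfolding E_def by (rule prob_space_exponential_density) simp
    have E_sets[measurable_cong]: "sets E = sets borel" and E_space[simp]: "space E = UNIV"
      by (simp_all add: E_def)
    interpret E: prob_space E by fact
    have "distributed E lborel (\<lambda>x. x) (exponential_density 1)"
      unfolding distributed_def E_def
      by (simp add: distr_id2)
    from E.exponential_distributedD_gt[OF this]
    have E_tail: "measure E {a<..} = exp (- a)" if "0 \<le> a" for a
      using that by (simp add: greaterThan_def)
    let ?Z = "\<lambda>j::nat \<times> 's. measure_pmf (J (snd j))"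
    let ?A = "PiM UNIV ?Z" and ?B = "PiM (UNIV::nat set) (\<lambda>_. E)"
    interpret A: product_prob_space ?Z UNIV by unfold_locales
    interpret B: product_prob_space "\<lambda>_. E" "UNIV :: nat set" by unfold_locales
    interpret AB: pair_prob_space ?A ?B by unfold_locales
    define Y where "Y a = rec_nat x\<^sub>0 (\<lambda>n y. a (n, y))" for a :: "nat \<times> 's \<Rightarrow> 's"
    have Y0: "Y a 0 = x\<^sub>0" and YS: "Y a (Suc n) = a (n, Y a n)" for a n by (simp_all add: Y_def)
    have Ymeas[measurable]: "(\<lambda>a. Y a n) \<in> measurable ?A (count_space UNIV)" for n
    proof (induction n)
      case (Suc n)
      have "(\<lambda>a. a (n, y)) \<in> measurable ?A (count_space UNIV)" for y
        using measurable_component_singleton[of "(n, y)" UNIV ?Z] by simp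
      from measurable_compose_countable[of "\<lambda>y a. a (n, y)", OF this Suc] show ?case
        by (simp add: YS)
    qed (simp add: Y0)
    have Bmeas[measurable]: "(\<lambda>b. b n) \<in> measurable ?B borel" for n
      using measurable_component_singleton[of n UNIV "\<lambda>_. E"] by (simp cong: measurable_cong_sets add: E_sets)
    let ?T = "PiM (UNIV::nat set) (\<lambda>_. count_space (UNIV::'s set)) \<Otimes>\<^sub>M PiM (UNIV::nat set) (\<lambda>_. borel :: real measure)"
    define F where "F = (\<lambda>(a, b). (Y a, \<lambda>n. b n / q (Y a n)))"
    have qm[measurable]: "q \<in> measurable (count_space UNIV) borel" by simp
    have F[measurable]: "F \<in> measurable (?A \<Otimes>\<^sub>M ?B) ?T"
      unfolding F_def case_prod_beta
      by (intro measurable_Pair measurable_PiM_single') (auto simp: space_PiM)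
    define N where "N = distr (?A \<Otimes>\<^sub>M ?B) ?T F"
    have N_prob: "prob_space N" unfolding N_def by (rule AB.prob_space_distr) fact
    have N_sets[measurable_cong]: "sets N = sets ?T" and N_space[simp]: "space N = UNIV"
      by (simp_all add: N_def space_pair_measure space_PiM)
    have ym[measurable]: "(\<lambda>w. fst w n) \<in> measurable N (count_space UNIV)" for n
      by (rule measurable_compose[of fst _ "PiM UNIV (\<lambda>_. count_space UNIV)"]) measurable
    have sm[measurable]: "(\<lambda>w. snd w n) \<in> borel_measurable N" for n
      by (rule measurable_compose[of snd _ "PiM UNIV (\<lambda>_. borel)"]) measurable
    have Xm: "X t \<in> measurable N (count_space UNIV)" for t
      unfolding X_def
      by (rule measurable_compose_countable) measurable
    have law: "measure N {w \<in> space N. \<forall>i\<le>n. fst w i = y i \<and> s i < snd w i} =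
             (if y 0 = x\<^sub>0 then 1 else 0) *
             (\<Prod>i<n. c r (y i) (y (Suc i)) / q (y i)) *
             (\<Prod>i\<le>n. exp (- q (y i) * s i))" (is "measure N ?V = _")
      if s: "\<forall>i\<le>n. 0 \<le> s i" for n y s
    proof -
      have V: "?V \<in> sets N" by measurable
      have "measure N ?V = measure (?A \<Otimes>\<^sub>M ?B) (F -` ?V \<inter> space (?A \<Otimes>\<^sub>M ?B))"
        unfolding N_def using V by (subst measure_distr) (auto simp: N_sets space_pair_measure space_PiM N_def)
      also have "\<dots> = (if y 0 = x\<^sub>0 then 1 else 0) *
             (\<Prod>i<n. c r (y i) (y (Suc i)) / q (y i)) *
             (\<Prod>i\<le>n. exp (- q (y i) * s i))"
      proof (cases "y 0 = x\<^sub>0")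
        case False
        have "F -` ?V \<inter> space (?A \<Otimes>\<^sub>M ?B) = {}"
          using False by (auto simp: F_def Y0)
        with False show ?thesis by simp
      next
        case True
        let ?I = "(\<lambda>i. (i, y i)) ` {..<n}"
        let ?VA = "{a \<in> space ?A. \<forall>j\<in>?I. a j \<in> {y (Suc (fst j))}}"
        let ?VB = "{b \<in> space ?B. \<forall>i\<in>{..n}. b i \<in> {q (y i) * s i<..}}"
        have Yeq: "(\<forall>i\<le>n. Y a i = y i) \<longleftrightarrow> (\<forall>i<n. a (i, y i) = y (Suc i))" for a
        proof
          assume *: "\<forall>i\<le>n. Y a i = y i"
          show "\<forall>i<n. a (i, y i) = y (Suc i)"
            using * YS[of a] by (metis Suc_leI less_imp_le_nat)
        next
          assume *: "\<forall>i<n. a (i, y i) = y (Suc i)"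
          have "i \<le> n \<Longrightarrow> Y a i = y i" for i
            by (induction i) (use * True in \<open>auto simp: Y0 YS\<close>)
          then show "\<forall>i\<le>n. Y a i = y i" by blast
        qed
        have lt: "s i < b / q (y i) \<longleftrightarrow> q (y i) * s i < b" for i b
          using q[of "y i"] by (simp add: field_simps)
        have "F (a, b) \<in> ?V \<longleftrightarrow> (\<forall>i<n. a (i, y i) = y (Suc i)) \<and> (\<forall>i\<le>n. q (y i) * s i < b i)" for a b
          unfolding Yeq[symmetric] using lt by (auto simp: F_def)
        note mem = this
        have "w \<in> F -` ?V \<inter> space (?A \<Otimes>\<^sub>M ?B) \<longleftrightarrow> w \<in> ?VA \<times> ?VB" for w
          unfolding Int_iff vimage_eq mem[of "fst w" "snd w", unfolded prod.collapse]
          by (auto simp: space_pair_measure space_PiM mem_Times_iff)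
        then have "F -` ?V \<inter> space (?A \<Otimes>\<^sub>M ?B) = ?VA \<times> ?VB"
          by (rule set_eqI)
        moreover have "?VA \<in> sets ?A"
          by (intro sets.sets_Collect_finite_All sets_Collect_single') auto
        moreover have "?VB \<in> sets ?B"
          by (intro sets.sets_Collect_finite_All sets_Collect_single') (auto simp: E_sets)
        moreover have "measure ?A ?VA = (\<Prod>i<n. c r (y i) (y (Suc i)) / q (y i))"
        proof -
          have "emeasure ?A ?VA = (\<Prod>j\<in>?I. emeasure (?Z j) {y (Suc (fst j))})"
            by (rule A.emeasure_PiM_Collect) auto
          also have "\<dots> = (\<Prod>i<n. ennreal (c r (y i) (y (Suc i)) / q (y i)))"
            by (subst prod.reindex) (auto simp: inj_on_def emeasure_pmf_single J)
          also have "\<dots> = ennreal (\<Prod>i<n. c r (y i) (y (Suc i)) / q (y i))"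
            using nonneg q by (intro prod_ennreal) (simp add: less_imp_le)
          finally show ?thesis
            using nonneg q by (simp add: measure_def less_imp_le prod_nonneg)
        qed
        moreover have "measure ?B ?VB = (\<Prod>i\<le>n. exp (- q (y i) * s i))"
        proof -
          have "emeasure ?B ?VB = (\<Prod>i\<le>n. emeasure E {q (y i) * s i<..})"
            by (rule B.emeasure_PiM_Collect) (auto simp: E_sets)
          also have "\<dots> = (\<Prod>i\<le>n. ennreal (exp (- q (y i) * s i)))"
            using s q by (intro prod.cong) (auto simp: E.emeasure_eq_measure E_tail less_imp_le)
          also have "\<dots> = ennreal (\<Prod>i\<le>n. exp (- q (y i) * s i))"
            by (intro prod_ennreal) simp
          finally show ?thesis by (simp add: measure_def prod_nonneg)
        qed
        ultimately show ?thesis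
          using True by (simp add: measure_def B.P.emeasure_pair_measure_Times enn2real_mult)
      qed
      finally show ?thesis .
    qed
    have "AE b in ?B. 0 < b n" for n
    proof -
      have "AE x in E. 0 < x"
        using E_tail[of 0] E.prob_eq_1[of "{0<..}"] by (simp add: E_sets)
      then have "AE x in distr ?B E (\<lambda>b. b n). 0 < x"
        by (subst B.PiM_component[OF UNIV_I])
      then show ?thesis
        by (subst (asm) AE_distr_iff) (auto simp: E_sets)
    qed
    then have "AE b in ?B. \<forall>n. 0 < b n" by (simp add: AE_all_countable)
    then have "AE w in ?A \<Otimes>\<^sub>M ?B. \<forall>n. 0 < snd w n"
      by (intro AB.AE_pair_measure) (auto simp: )
    then have "AE w in ?A \<Otimes>\<^sub>M ?B. \<forall>n. 0 < snd (F w) n"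
      by eventually_elim (auto simp: F_def q split: prod.split)
    then have "AE w in N. \<forall>n. 0 < snd w n"
      unfolding N_def by (subst AE_distr_iff) (auto simp: )
    then have paths: "AE w in N. \<forall>n t. (\<Sum>i<n. snd w i) \<le> t \<and> t < (\<Sum>i\<le>n. snd w i) \<longrightarrow> X t w = fst w n"
    proof eventually_elim
      case (elim w)
      show ?case
      proof (intro allI impI)
        fix n t assume t: "(\<Sum>i<n. snd w i) \<le> t \<and> t < (\<Sum>i\<le>n. snd w i)"
        have "(LEAST n. t < (\<Sum>i\<le>n. snd w i)) = n"
        proof (rule Least_equality)
          fix k assume k: "t < (\<Sum>i\<le>k. snd w i)"
          show "n \<le> k"
          proof (rule ccontr)
            assume "\<not> n \<le> k"
            then have "(\<Sum>i\<le>k. snd w i) \<le> (\<Sum>i<n. snd w i)"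
              using elim by (intro sum_mono2) (auto simp: less_imp_le)
            with t k show False by linarith
          qed
        qed (use t in blast)
        then show "X t w = fst w n" by (simp add: X_def)
      qed
    qed
    have "markov_chain_with_rates N X (c r) x\<^sub>0"
      unfolding markov_chain_with_rates_def q_def[symmetric]
      by (intro conjI exI[of _ "\<lambda>n w. fst w n"] exI[of _ "\<lambda>n w. snd w n"])
        (use N_prob Xm ym sm law paths in blast)+
    then show ?thesis by blast
  qed
  then show ?thesis by metis
qed

lemma layered_rate_properties:
  fixes z :: "int ^ 'd \<Rightarrow> real" and x :: "'d site"
  assumes "\<And>y. 0 \<le> z y"
  shows "0 \<le> layered_rate z x y" "finite {y. layered_rate z x y \<noteq> 0}"
    "exit_rate (layered_rate z) x = 2 * z (snd x) + 2 * CARD('d)"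
proof -
  show "0 \<le> layered_rate z x y" using assms by (simp add: layered_rate_def)
  let ?D1 = "{x + (1, 0), x - (1, 0)}"
  let ?D2 = "range (\<lambda>i. x + (0, axis i 1))" and ?D3 = "range (\<lambda>i. x - (0, axis i 1))"
  have sub: "{y. layered_rate z x y \<noteq> 0} \<subseteq> ?D1 \<union> (?D2 \<union> ?D3)"
    by (auto simp: layered_rate_def split: if_splits)
  then show "finite {y. layered_rate z x y \<noteq> 0}" by (rule finite_subset) simp
  have d1: "?D1 \<inter> (?D2 \<union> ?D3) = {}" by (cases x) auto
  have ax: "axis i (1::int) \<noteq> - axis j 1" for i j :: 'd
    by (auto simp: vec_eq_iff axis_def dest!: spec[of _ i])
  have d2: "?D2 \<inter> ?D3 = {}"
  proof -
    have "x + (0, axis i 1) \<noteq> x - (0, axis j 1)" for i j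
      using ax[of i j] by (cases x) (simp add: diff_conv_add_uminus del: add_uminus_conv_diff)
    then show ?thesis by blast
  qed
  have inj: "axis i (1::int) = axis j 1 \<longleftrightarrow> i = j" for i j :: 'd by (simp add: axis_eq_axis)
  have "exit_rate (layered_rate z) x = (\<Sum>y\<in>?D1 \<union> (?D2 \<union> ?D3). layered_rate z x y)"
    unfolding exit_rate_def
    by (subst infsum_finite[symmetric], simp, rule infsum_cong_neutral) (use sub in auto)
  also have "\<dots> = sum (layered_rate z x) ?D1 + (sum (layered_rate z x) ?D2 + sum (layered_rate z x) ?D3)"
    using d1 d2 by (subst sum.union_disjoint; simp?)+
  also have "sum (layered_rate z x) ?D1 = 2 * z (snd x)"
    by (cases x) (auto simp: layered_rate_def)
  also have "sum (layered_rate z x) ?D2 = (\<Sum>y\<in>?D2. 1)"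
    using d1 by (intro sum.cong) (auto simp: layered_rate_def)
  also have "\<dots> = CARD('d)"
    by (simp add: card_image inj_on_def inj)
  also have "sum (layered_rate z x) ?D3 = (\<Sum>y\<in>?D3. 1)"
    using d1 by (intro sum.cong) (auto simp: layered_rate_def)
  also have "\<dots> = CARD('d)"
    by (simp add: card_image inj_on_def inj)
  finally show "exit_rate (layered_rate z) x = 2 * z (snd x) + 2 * CARD('d)" by simp
qed

corollary layered_walk_exists:
  fixes z :: "int ^ 'd \<Rightarrow> 'a \<Rightarrow> real"
  assumes "\<And>x \<omega>. \<omega> \<in> \<Omega> \<Longrightarrow> 0 \<le> z x \<omega>"
  shows "\<exists>(P :: 'a \<Rightarrow> 'd site \<Rightarrow> ((nat \<Rightarrow> 'd site) \<times> (nat \<Rightarrow> real)) measure) X.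
           \<forall>\<omega>\<in>\<Omega>. \<forall>x. markov_chain_with_rates (P \<omega> x) X (layered_rate (\<lambda>y. z y \<omega>)) x"
proof -
  define z' where "z' y \<omega> = \<bar>z y \<omega>\<bar>" for y \<omega>
  have nonneg: "0 \<le> z' y \<omega>" for y \<omega> by (simp add: z'_def)
  have "0 < exit_rate (layered_rate (\<lambda>y. z' y \<omega>)) x" for \<omega> x
    using nonneg by (subst layered_rate_properties(3)) (auto intro!: add_nonneg_pos)
  from markov_chain_with_rates_exists[of "\<lambda>\<omega>. layered_rate (\<lambda>y. z' y \<omega>)",
      OF layered_rate_properties(1)[OF nonneg] layered_rate_properties(2)[OF nonneg] this]
  obtain P :: "'a \<Rightarrow> 'd site \<Rightarrow> ((nat \<Rightarrow> 'd site) \<times> (nat \<Rightarrow> real)) measure" and X where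
    PX: "\<forall>\<omega> x. markov_chain_with_rates (P \<omega> x) X (layered_rate (\<lambda>y. z' y \<omega>)) x"
    by (elim exE)
  have "(\<lambda>y. z' y \<omega>) = (\<lambda>y. z y \<omega>)" if "\<omega> \<in> \<Omega>" for \<omega>
    using assms that by (simp add: z'_def)
  then have "markov_chain_with_rates (P \<omega> x) X (layered_rate (\<lambda>y. z y \<omega>)) x" if "\<omega> \<in> \<Omega>" for \<omega> x
    using PX[rule_format, of \<omega> x] that by simp
  then show ?thesis by (intro exI[of _ P] exI[of _ X]) blast
qed

end

theory Submission
  imports Defs "HOL-Real_Asymp.Real_Asymp"
begin

text \<open>
  The second coordinate of the walk is a simple random walk on \<open>\<int>\<^sup>d\<close>, and the first one is symmetric
  and unimodal given the second one. By unimodality a pointwise lower bound for the kernel, up to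
  polynomial factors, follows as soon as the second moment of the first coordinate within time
  about \<open>t\<close> exceeds \<open>t\<^bsup>2\<delta>\<^esup>\<close>. This second moment is the expectation of the integral of \<open>2 z\<close> along the
  second coordinate. If that coordinate moves freely in a box of side \<open>\<surd>t\<close>, then its Green function
  is of order \<open>t\<^bsup>1 - d/2\<^esup>\<close> there, and the sites with \<open>z > t\<^bsup>\<beta>/2\<^esup>\<close>, of which there are about
  \<open>t\<^bsup>(d - \<alpha>\<beta>)/2\<^esup>\<close>, contribute \<open>t\<^bsup>1 + (\<beta> - \<alpha>\<beta>)/2\<^esup>\<close>; small \<open>\<beta>\<close> gives the exponent \<open>1/2\<close> for \<open>\<delta>\<close> and
  \<open>\<beta>\<close> close to \<open>1/\<alpha>\<close> gives \<open>(\<alpha> + 1)/(4\<alpha>)\<close> in dimension one. Walking to a single such site and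
  staying there for a unit of time gives \<open>d/(4\<alpha>)\<close> instead. All intermediate displacements of order
  \<open>\<surd>t\<close> of the second coordinate cost only polynomial factors.

  Everything is done for the discrete time chain obtained by uniformization at a rate \<open>L = N/t\<close>
  that is polynomial in \<open>t\<close>, killed outside a box. The Poisson number of its steps until time \<open>t\<close>
  equals \<open>N\<close> with probability at least \<open>1/(e N)\<close>, so that it is enough to look at exactly \<open>N\<close> steps.
\<close>

section \<open>Uniformization of a jump chain\<close>

text \<open>The rates are unbounded over the lattice, so no single clock rate serves the whole walk.
  Killing the second coordinate outside a box cures this: almost surely \<open>z\<close> is at most
  a power of the side there. All bounds are from below, so killing, fixing intermediate points and
  truncating series are harmless.

  The chain is given by its jump chain and holding times, without a semigroup. The link with the
  iterated step therefore runs through sums over finite jump paths and inequalities obtained by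
  splitting at the first jump.

  A nearest neighbour step destroys unimodality by parity unless it is lazy enough; this is the
  origin of the factor 3 in \<open>admissible\<close>. Unimodality then takes the place of local
  limit theorems: a second moment or an occupation time is bounded by a comparison function, and
  unimodality turns the average into a pointwise bound, losing only the number of sites.

  The second moment of the first coordinate does not tell where the second one ends, so the last
  part of the path must be bounded uniformly over its starting point.\<close>

abbreviation Exp1 :: "real measure" where "Exp1 \<equiv> density lborel (exponential_density 1)"

text \<open>Positivity of all \<open>T i\<close> is the case \<open>a = 0\<close> of the law. It
  extends the product formula to negative thresholds, and zero thresholds outside \<open>J\<close>
  give subfamilies. Half-lines are an intersection-stable generator of the Borel sets, so the
  product formula already yields independence.\<close>

lemma (in prob_space) exponential_family_distr_PiM:
  fixes T :: "nat \<Rightarrow> 'a \<Rightarrow> real"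
  assumes [measurable]: "\<And>i. T i \<in> borel_measurable M"
    and law: "\<And>a. (\<And>i. i \<le> n \<Longrightarrow> 0 \<le> a i) \<Longrightarrow>
      prob {w\<in>space M. \<forall>i\<le>n. a i < T i w} = (\<Prod>i\<le>n. exp (- a i))"
  shows "distr M (PiM {..n} (\<lambda>_. borel)) (\<lambda>w. \<lambda>i\<in>{..n}. T i w) = PiM {..n} (\<lambda>_. Exp1)"
proof -
  have pos: "AE w in M. \<forall>i\<le>n. 0 < T i w"
    using law[of "\<lambda>_. 0"] by (intro AE_I_eq_1) (auto simp: emeasure_eq_measure)
  have tail: "prob {w\<in>space M. \<forall>i\<in>J. a i < T i w} = (\<Prod>i\<in>J. exp (- max 0 (a i)))"
    if J: "J \<subseteq> {..n}" for J a
  proof -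
    let ?a = "\<lambda>i. if i \<in> J then max 0 (a i) else 0"
    have "prob {w\<in>space M. \<forall>i\<in>J. a i < T i w} = prob {w\<in>space M. \<forall>i\<le>n. ?a i < T i w}"
    proof (rule finite_measure_eq_AE)
      show "AE w in M. (w \<in> {w\<in>space M. \<forall>i\<in>J. a i < T i w}) = (w \<in> {w\<in>space M. \<forall>i\<le>n. ?a i < T i w})"
        using pos by eventually_elim (use J in auto)
      have "finite J" using J finite_subset by blast
      then show "{w\<in>space M. \<forall>i\<in>J. a i < T i w} \<in> events" by measurable
    qed measurable
    also have "\<dots> = (\<Prod>i\<le>n. exp (- ?a i))" by (rule law) auto
    also have "\<dots> = (\<Prod>i\<in>J. exp (- max 0 (a i)))"
      using J by (intro prod.mono_neutral_cong_right) auto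
    finally show ?thesis .
  qed
  define F where "F i = {{w\<in>space M. a < T i w} | a. True}" for i
  have Fi: "sigma_sets (space M) (F i) = {T i -` A \<inter> space M | A. A \<in> sets borel}" for i
  proof -
    have "{T i -` A \<inter> space M | A. A \<in> sigma_sets UNIV (range greaterThan)}
        = sigma_sets (space M) {T i -` A \<inter> space M | A. A \<in> range greaterThan}"
      by (rule sigma_sets_vimage_commute) auto
    moreover have "{T i -` A \<inter> space M | A. A \<in> range greaterThan} = F i"
      by (force simp: F_def)
    moreover have "sets borel = sigma_sets UNIV (range (greaterThan::real \<Rightarrow> _))"
      by (subst borel_Ioi) (auto simp: greaterThan_def)
    ultimately show ?thesis by simp
  qed
  have "indep_sets F {..n}"
  proof (rule indep_setsI)
    show "F i \<subseteq> events" for i by (auto simp: F_def)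
    fix A J assume J: "J \<noteq> {}" "J \<subseteq> {..n}" "finite J" and A: "\<forall>j\<in>J. A j \<in> F j"
    then obtain a where a: "\<And>j. j \<in> J \<Longrightarrow> A j = {w\<in>space M. a j < T j w}"
      unfolding F_def by (simp add: Bex_def) metis
    have "prob (\<Inter>j\<in>J. A j) = prob {w\<in>space M. \<forall>i\<in>J. a i < T i w}"
      using J(1) a by (intro arg_cong[where f=prob]) auto
    also have "\<dots> = (\<Prod>j\<in>J. exp (- max 0 (a j)))" by (rule tail[OF J(2)])
    also have "\<dots> = (\<Prod>j\<in>J. prob (A j))"
      using tail[of "{j}" a for j] J(2) a by (intro prod.cong) auto
    finally show "prob (\<Inter>j\<in>J. A j) = (\<Prod>j\<in>J. prob (A j))" .
  qed
  then have "indep_sets (\<lambda>i. sigma_sets (space M) (F i)) {..n}"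
  proof (rule indep_sets_sigma)
    show "Int_stable (F i)" for i
    proof (rule Int_stableI)
      fix A B assume "A \<in> F i" "B \<in> F i"
      then obtain a b where "A = {w\<in>space M. a < T i w}" "B = {w\<in>space M. b < T i w}"
        unfolding F_def by auto
      then have "A \<inter> B = {w\<in>space M. max a b < T i w}" by auto
      then show "A \<inter> B \<in> F i" unfolding F_def by blast
    qed
  qed
  then have "indep_vars (\<lambda>_. borel) T {..n}"
    unfolding indep_vars_def2 by (auto simp: Fi)
  then have "distr M (PiM {..n} (\<lambda>_. borel)) (\<lambda>w. \<lambda>i\<in>{..n}. T i w)
      = PiM {..n} (\<lambda>i. distr M borel (T i))"
    by (subst (asm) indep_vars_iff_distr_eq_PiM') auto
  also have "\<dots> = PiM {..n} (\<lambda>_. Exp1)"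
  proof (rule PiM_cong)
    fix i assume i: "i \<in> {..n}"
    have "\<P>(x in M. T i x \<le> a) = 1 - exp (- a * 1)" if "0 \<le> a" for a
    proof -
      have "prob {w\<in>space M. a < T i w} = exp (- a)"
        using tail[of "{i}" "\<lambda>_. a"] i that by simp
      moreover have "{w\<in>space M. T i w \<le> a} = space M - {w\<in>space M. a < T i w}" by auto
      ultimately show ?thesis by (simp add: prob_compl)
    qed
    then have "distributed M lborel (T i) (exponential_density 1)"
      by (subst exponential_distributed_iff) auto
    then show "distr M borel (T i) = Exp1"
      unfolding distributed_def by (metis distr_cong sets_lborel)
  qed simp
  finally show ?thesis .
qed

text \<open>The probability of exactly \<open>n\<close> jumps before time \<open>t\<close> if the successive jump rates are \<open>q 0, q 1, \<dots>\<close>\<close>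

definition jump_count_prob :: "nat \<Rightarrow> (nat \<Rightarrow> real) \<Rightarrow> real \<Rightarrow> ennreal" where
  "jump_count_prob n q t = emeasure (PiM UNIV (\<lambda>_::nat. Exp1))
     {x. (\<Sum>i<n. x i / q i) \<le> t \<and> t < (\<Sum>i\<le>n. x i / q i)}"

text \<open>The last property is the decomposition at the first jump: \<open>PiM_iter\<close> splits
  off the first exponential variable, and the substitution \<open>x = q 0 * s\<close> turns it into
  the holding time \<open>s\<close>. Restricting \<open>s\<close> to \<open>{0..t}\<close> makes it
  an inequality.\<close>

lemma jump_count_prob_properties:
  fixes q :: "nat \<Rightarrow> real" and t :: real
  defines "h \<equiv> jump_count_prob"
  assumes q: "0 < q 0"
  shows "0 \<le> t \<Longrightarrow> h 0 q t = ennreal (exp (- q 0 * t))"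
    and "(\<lambda>s. h n q s) \<in> borel_measurable borel"
    and "(\<integral>\<^sup>+s. ennreal (q 0 * exp (- q 0 * s)) * h n (\<lambda>i. q (Suc i)) (t - s) * indicator {0..t} s \<partial>lborel)
           \<le> h (Suc n) q t"
proof -
  note h_def = h_def jump_count_prob_def
  have E: "prob_space Exp1" by (rule prob_space_exponential_density) simp
  interpret E: prob_space Exp1 by fact
  interpret sequence_space Exp1 by unfold_locales
  let ?S = "PiM UNIV (\<lambda>_::nat. Exp1)"
  have [measurable]: "(\<lambda>x. x i) \<in> borel_measurable ?S" for i
    using measurable_component_singleton[of i UNIV "\<lambda>_. Exp1"] by (simp cong: measurable_cong_sets)
  have sp: "space ?S = UNIV" by (simp add: space_PiM)
  have meas2: "(\<lambda>s. h n q s) \<in> borel_measurable borel" for n and q :: "nat \<Rightarrow> real"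
  proof -
    have "{x \<in> space (borel \<Otimes>\<^sub>M ?S). (\<Sum>i<n. snd x i / q i) \<le> fst x \<and> fst x < (\<Sum>i\<le>n. snd x i / q i)}
        \<in> sets (borel \<Otimes>\<^sub>M ?S)"
      by measurable
    from P.measurable_emeasure_Pair[OF this] show ?thesis
      by (simp add: h_def vimage_def sp space_pair_measure)
  qed
  then show "(\<lambda>s. h n q s) \<in> borel_measurable borel" .
  note meas2[measurable]
  show "h 0 q t = ennreal (exp (- q 0 * t))" if t: "0 \<le> t"
  proof -
    have "distributed Exp1 lborel (\<lambda>x. x) (exponential_density 1)"
      unfolding distributed_def by (simp add: distr_id2)
    from E.exponential_distributedD_gt[OF this]
    have tail: "measure Exp1 {a<..} = exp (- a)" if "0 \<le> a" for a
      using that by (simp add: greaterThan_def)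
    have "h 0 q t = emeasure ?S {x\<in>space ?S. x 0 \<in> {q 0 * t<..}}"
      unfolding h_def using t q by (intro arg_cong[where f="emeasure ?S"]) (auto simp: sp field_simps)
    also have "\<dots> = emeasure (distr ?S Exp1 (\<lambda>x. x 0)) {q 0 * t<..}"
      by (subst emeasure_distr) (auto simp: vimage_def Int_def conj_commute)
    also have "\<dots> = emeasure Exp1 {q 0 * t<..}"
      by (subst PiM_component) auto
    also have "\<dots> = ennreal (exp (- q 0 * t))"
      using tail[of "q 0 * t"] t q by (simp add: E.emeasure_eq_measure)
    finally show ?thesis .
  qed
  let ?q = "\<lambda>i. q (Suc i)"
  have "{x \<in> space ?S. x 0 / q 0 + (\<Sum>i<n. x (Suc i) / ?q i) \<le> t \<and>
         t < x 0 / q 0 + (\<Sum>i\<le>n. x (Suc i) / ?q i)} \<in> sets ?S" by measurable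
  note m = this[unfolded sp, simplified]
  have "{p \<in> space (borel \<Otimes>\<^sub>M ?S). (\<Sum>i<n. snd p i / ?q i) \<le> t - fst p / q 0 \<and>
      t - fst p / q 0 < (\<Sum>i\<le>n. snd p i / ?q i)} \<in> sets (borel \<Otimes>\<^sub>M ?S)" by measurable
  note m2 = this[unfolded space_pair_measure sp, simplified]
  have "h (Suc n) q t = emeasure (distr (Exp1 \<Otimes>\<^sub>M ?S) ?S (\<lambda>(s, \<omega>). case_nat s \<omega>))
       {x \<in> space ?S. (\<Sum>i<Suc n. x i / q i) \<le> t \<and> t < (\<Sum>i\<le>Suc n. x i / q i)}"
    unfolding PiM_iter h_def sp by simp
  also have "\<dots> = emeasure (Exp1 \<Otimes>\<^sub>M ?S) {p \<in> space (Exp1 \<Otimes>\<^sub>M ?S).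
      (\<Sum>i<n. snd p i / ?q i) \<le> t - fst p / q 0 \<and> t - fst p / q 0 < (\<Sum>i\<le>n. snd p i / ?q i)}"
    by (subst emeasure_distr)
      (auto simp: m sp space_pair_measure sum.lessThan_Suc_shift sum.atMost_Suc_shift
          simp del: sum.lessThan_Suc sum.atMost_Suc intro!: arg_cong[where f="emeasure (Exp1 \<Otimes>\<^sub>M ?S)"])
  also have "\<dots> = (\<integral>\<^sup>+x. h n ?q (t - x / q 0) \<partial>Exp1)"
    by (subst P.emeasure_pair_measure_alt) (auto simp: m2 h_def sp space_pair_measure vimage_def)
  also have "\<dots> = (\<integral>\<^sup>+x. ennreal (exponential_density 1 x) * h n ?q (t - x / q 0) \<partial>lborel)"
    by (subst nn_integral_density) auto
  also have "\<dots> = ennreal \<bar>q 0\<bar> * (\<integral>\<^sup>+s. ennreal (exponential_density 1 (0 + q 0 * s)) * h n ?q (t - (0 + q 0 * s) / q 0) \<partial>lborel)"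
    using q by (subst nn_integral_real_affine[where c="q 0" and t=0]) auto
  also have "\<dots> = (\<integral>\<^sup>+s. ennreal (q 0) * (ennreal (exponential_density 1 (q 0 * s)) * h n ?q (t - s)) \<partial>lborel)"
    using q by (subst nn_integral_cmult) auto
  also have "\<dots> \<ge> (\<integral>\<^sup>+s. ennreal (q 0 * exp (- q 0 * s)) * h n ?q (t - s) * indicator {0..t} s \<partial>lborel)"
    using q by (intro nn_integral_mono)
      (auto simp: exponential_density_def ennreal_mult mult.assoc mult_less_0_iff split: split_indicator)
  finally show "(\<integral>\<^sup>+s. ennreal (q 0 * exp (- q 0 * s)) * h n ?q (t - s) * indicator {0..t} s \<partial>lborel)
           \<le> h (Suc n) q t" .
qed

text \<open>The prescribed law says that, conditionally on the jump chain following \<open>y\<close>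
  up to index \<open>n\<close>, the variables \<open>q (y i) * S i\<close> are independent standard
  exponentials. Under this conditional measure, \<open>U\<close> in the proof, the jumps up to time
  \<open>t\<close> are counted by \<open>jump_count_prob\<close>.\<close>

lemma (in prob_space) jump_path_prob_ge:
  fixes Y :: "nat \<Rightarrow> 'a \<Rightarrow> 's" and S :: "nat \<Rightarrow> 'a \<Rightarrow> real" and c :: "'s \<Rightarrow> 's \<Rightarrow> real"
  assumes [measurable]: "\<And>n. Y n \<in> measurable M (count_space UNIV)" "\<And>n. S n \<in> borel_measurable M"
    and law: "\<And>n y s. (\<forall>i\<le>n. 0 \<le> s i) \<Longrightarrow>
           prob {w \<in> space M. \<forall>i\<le>n. Y i w = y i \<and> s i < S i w} =
             (if y 0 = x0 then 1 else 0) *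
             (\<Prod>i<n. c (y i) (y (Suc i)) / q (y i)) *
             (\<Prod>i\<le>n. exp (- q (y i) * s i))"
    and c: "\<And>x y. 0 \<le> c x y" and q: "\<And>x. 0 < q x" and y0: "y 0 = x0"
  shows "ennreal (\<Prod>i<n. c (y i) (y (Suc i)) / q (y i)) * jump_count_prob n (\<lambda>i. q (y i)) t
    \<le> emeasure M {w \<in> space M. (\<forall>i\<le>n. Y i w = y i \<and> 0 < S i w) \<and>
          (\<Sum>i<n. S i w) \<le> t \<and> t < (\<Sum>i\<le>n. S i w)}"
proof -
  define r where "r = (\<Prod>i<n. c (y i) (y (Suc i)) / q (y i))"
  have "0 \<le> r" unfolding r_def using c q by (intro prod_nonneg) (auto intro!: divide_nonneg_pos)
  show ?thesis
  proof (cases "r = 0")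
    case True then show ?thesis by (simp only: r_def[symmetric]) simp
  next
    case False
    with \<open>0 \<le> r\<close> have r: "0 < r" by simp
    define E where "E = {w\<in>space M. \<forall>i\<le>n. Y i w = y i \<and> 0 < S i w}"
    have [measurable]: "E \<in> events" unfolding E_def by measurable
    have PE: "prob E = r" using law[of n "\<lambda>_. 0" y] y0 by (simp add: E_def r_def)
    define U where "U = uniform_measure M E"
    have sU[simp, measurable_cong]: "sets U = sets M" and spU[simp]: "space U = space M" by (auto simp: U_def)
    have E0: "emeasure M E = ennreal r" using PE by (simp add: emeasure_eq_measure)
    interpret U: prob_space U
      unfolding U_def by (rule prob_space_uniform_measure) (use r E0 in auto)
    have UA: "emeasure U A = emeasure M (E \<inter> A) / ennreal r" if "A \<in> events" for A
      unfolding U_def using that E0 by (subst emeasure_uniform_measure) auto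
    let ?T = "\<lambda>i w. q (y i) * S i w"
    have "distr U (PiM {..n} (\<lambda>_. borel)) (\<lambda>w. \<lambda>i\<in>{..n}. ?T i w) = PiM {..n} (\<lambda>_. Exp1)"
    proof (rule U.exponential_family_distr_PiM)
      fix a :: "nat \<Rightarrow> real" assume a: "\<And>i. i \<le> n \<Longrightarrow> 0 \<le> a i"
      let ?A = "{w\<in>space M. \<forall>i\<le>n. a i < ?T i w}"
      have "E \<inter> ?A = {w \<in> space M. \<forall>i\<le>n. Y i w = y i \<and> a i / q (y i) < S i w}"
        using q a unfolding E_def
        by (auto simp: field_simps) (metis divide_nonneg_pos mult.commute order_le_less_trans pos_divide_less_eq)
      also have "prob \<dots> = r * (\<Prod>i\<le>n. exp (- a i))"
        using law[of n "\<lambda>i. a i / q (y i)" y] a q y0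
        by (auto simp: r_def less_imp_le divide_nonneg_pos less_imp_neq[THEN not_sym] cong: prod.cong)
      finally have "emeasure M (E \<inter> ?A) = ennreal (r * (\<Prod>i\<le>n. exp (- a i)))"
        by (simp add: emeasure_eq_measure)
      then have "emeasure U ?A = ennreal (r * (\<Prod>i\<le>n. exp (- a i))) / ennreal r"
        by (subst UA) measurable
      also have "\<dots> = ennreal (\<Prod>i\<le>n. exp (- a i))"
        using r by (simp add: divide_ennreal prod_nonneg)
      finally show "U.prob {w\<in>space U. \<forall>i\<le>n. a i < ?T i w} = (\<Prod>i\<le>n. exp (- a i))"
        by (simp add: U.emeasure_eq_measure prod_nonneg)
    qed measurable
    note distr = this
    let ?I = "\<lambda>x t. (\<Sum>i<n. x i / q (y i)) \<le> t \<and> t < (\<Sum>i\<le>n. x i / q (y i))"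
    let ?B = "{x\<in>space (PiM {..n} (\<lambda>_. Exp1)). ?I x t}"
    have comp: "(\<lambda>x. x i) \<in> borel_measurable (PiM {..n} (\<lambda>_. Exp1))" if "i \<le> n" for i
      using measurable_component_singleton[of i "{..n}" "\<lambda>_. Exp1"] that by (simp cong: measurable_cong_sets)
    have B: "?B \<in> sets (PiM {..n} (\<lambda>_. Exp1))"
      using comp by (intro sets.sets_Collect borel_measurable_le borel_measurable_less
        borel_measurable_sum borel_measurable_divide borel_measurable_const) auto
    have seq: "sets (PiM {..n} (\<lambda>_. Exp1)) = sets (PiM {..n} (\<lambda>_. borel))"
      by (intro sets_PiM_cong) auto
    interpret E1: prob_space Exp1 by (rule prob_space_exponential_density) simp
    interpret product_prob_space "\<lambda>_::nat. Exp1" UNIV by unfold_locales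
    \<comment> \<open>Only the coordinates up to \<open>n\<close> enter, so the infinite product may
      be replaced by the finite one, which is the law of \<open>?T\<close> under
      \<open>U\<close>.\<close>
    have "jump_count_prob n (\<lambda>i. q (y i)) t = emeasure (PiM UNIV (\<lambda>_::nat. Exp1)) (prod_emb UNIV (\<lambda>_. Exp1) {..n} ?B)"
      unfolding jump_count_prob_def
      by (intro arg_cong[where f="emeasure _"]) (auto simp: prod_emb_def space_PiM)
    also have "\<dots> = emeasure (PiM {..n} (\<lambda>_. Exp1)) ?B"
      by (rule emeasure_PiM_emb') (use B in auto)
    also have "\<dots> = emeasure U {w\<in>space M. ?I (\<lambda>i. ?T i w) t}"
      unfolding distr[symmetric] using B unfolding seq
      by (subst emeasure_distr)
        (auto simp: space_PiM distr[symmetric] seq intro!: arg_cong[where f="emeasure U"] measurable_restrict)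
    also have "\<dots> = emeasure U {w\<in>space M. (\<Sum>i<n. S i w) \<le> t \<and> t < (\<Sum>i\<le>n. S i w)}"
      using q by (simp add: less_imp_neq[THEN not_sym])
    also have "\<dots> = emeasure M (E \<inter> {w\<in>space M. (\<Sum>i<n. S i w) \<le> t \<and> t < (\<Sum>i\<le>n. S i w)}) / ennreal r"
      by (rule UA) measurable
    finally have "ennreal r * jump_count_prob n (\<lambda>i. q (y i)) t
      = emeasure M (E \<inter> {w\<in>space M. (\<Sum>i<n. S i w) \<le> t \<and> t < (\<Sum>i\<le>n. S i w)})"
      using r by (simp add: ennreal_times_divide) (subst mult.commute, rule mult_divide_eq_ennreal, auto)
    also have "E \<inter> {w\<in>space M. (\<Sum>i<n. S i w) \<le> t \<and> t < (\<Sum>i\<le>n. S i w)} =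
      {w \<in> space M. (\<forall>i\<le>n. Y i w = y i \<and> 0 < S i w) \<and> (\<Sum>i<n. S i w) \<le> t \<and> t < (\<Sum>i\<le>n. S i w)}"
      by (auto simp: E_def)
    finally show ?thesis by (simp add: r_def)
  qed
qed

text \<open>
  The backward step \<open>1 + Q/L\<close> of the chain with rates \<open>c\<close>, uniformized at rate \<open>L\<close> and killed
  outside \<open>D\<close>; here \<open>q\<close> stands for the exit rates.
\<close>

definition gen_step :: "('s \<Rightarrow> 's \<Rightarrow> real) \<Rightarrow> ('s \<Rightarrow> real) \<Rightarrow> real \<Rightarrow> 's set \<Rightarrow> ('s \<Rightarrow> real) \<Rightarrow> 's \<Rightarrow> real" where
  "gen_step c q L D f x =
     (if x \<in> D then (1 - q x / L) * f x + (\<Sum>y | c x y \<noteq> 0. c x y * f y) / L else 0)"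

text \<open>The backward equation for a truncated Poisson series: differentiation shifts the
  coefficients by one, and the shifted series is truncated one term earlier.\<close>

lemma exp_power_sum_deriv:
  fixes a :: "nat \<Rightarrow> real"
  shows "((\<lambda>t. exp (- L * t) * (\<Sum>n\<le>Suc N. (L * t) ^ n / fact n * a n)) has_real_derivative
     L * (exp (- L * t) * (\<Sum>n\<le>N. (L * t) ^ n / fact n * a (Suc n))
        - exp (- L * t) * (\<Sum>n\<le>Suc N. (L * t) ^ n / fact n * a n))) (at t)"
proof -
  have "((\<lambda>t. \<Sum>n\<le>Suc N. (L * t) ^ n / fact n * a n) has_real_derivative
     L * (\<Sum>n\<le>N. (L * t) ^ n / fact n * a (Suc n))) (at t)"
  proof (induction N)
    case 0 then show ?case by (auto intro!: derivative_eq_intros)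
  next
    case (Suc N)
    have "((\<lambda>t. (L * t) ^ Suc (Suc N) / fact (Suc (Suc N)) * a (Suc (Suc N))) has_real_derivative
      L * ((L * t) ^ Suc N / fact (Suc N) * a (Suc (Suc N)))) (at t)"
      by (auto intro!: derivative_eq_intros simp: fact_Suc[of "Suc N"] divide_simps simp del: fact_Suc power_Suc)
        (auto simp: algebra_simps)
    from DERIV_add[OF Suc this] show ?case
      by (simp add: algebra_simps)
  qed
  moreover have "((\<lambda>t. exp (- L * t)) has_real_derivative - L * exp (- L * t)) (at t)"
    by (auto intro!: derivative_eq_intros)
  ultimately show ?thesis
    by (rule DERIV_cong[OF DERIV_mult[rotated]]) (simp add: algebra_simps del: sum.atMost_Suc)
qed

lemma gen_step_nonneg:
  assumes "\<And>x y. 0 \<le> c x y" "\<And>x. x \<in> D \<Longrightarrow> q x \<le> L" "0 < L" "\<And>x. 0 \<le> f x"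
  shows "0 \<le> (gen_step c q L D ^^ n) f x"
proof (induction n arbitrary: x)
  case (Suc n)
  then show ?case using assms
    by (auto simp: gen_step_def intro!: add_nonneg_nonneg mult_nonneg_nonneg divide_nonneg_pos sum_nonneg)
qed (use assms in auto)

section \<open>Sums over finite jump paths\<close>

primrec jump_paths :: "('s \<Rightarrow> 's \<Rightarrow> real) \<Rightarrow> 's set \<Rightarrow> 's \<Rightarrow> nat \<Rightarrow> 's \<Rightarrow> 's list set" where
  "jump_paths c D x' 0 x = (if x \<in> D \<and> x = x' then {[x]} else {})"
| "jump_paths c D x' (Suc n) x =
     (if x \<in> D then (\<Union>y\<in>{y. c x y \<noteq> 0}. Cons x ` jump_paths c D x' n y) else {})"

lemma jump_paths_D:
  "zs \<in> jump_paths c D x' n x \<Longrightarrow> length zs = Suc n \<and> zs ! 0 = x \<and> zs ! n = x'"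
proof (induction n arbitrary: x zs)
  case 0 then show ?case by (auto split: if_splits)
next
  case (Suc n)
  then obtain y ys where "zs = x # ys" "ys \<in> jump_paths c D x' n y" by (auto split: if_splits)
  with Suc.IH[of ys y] show ?case by auto
qed

lemma finite_jump_paths:
  "(\<And>x. finite {y. c x y \<noteq> 0}) \<Longrightarrow> finite (jump_paths c D x' n x)"
  by (induction n arbitrary: x) auto

definition path_prob :: "('s \<Rightarrow> 's \<Rightarrow> real) \<Rightarrow> ('s \<Rightarrow> real) \<Rightarrow> nat \<Rightarrow> 's list \<Rightarrow> real \<Rightarrow> ennreal" where
  "path_prob c q n zs t = ennreal (\<Prod>i<n. c (zs ! i) (zs ! Suc i) / q (zs ! i)) *
     jump_count_prob n (\<lambda>i. q (zs ! i)) t"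

lemma path_prob_measurable: "(\<And>x. 0 < q x) \<Longrightarrow> path_prob c q n zs \<in> borel_measurable borel"
  unfolding path_prob_def using jump_count_prob_properties(2)[of "\<lambda>i. q (zs ! i)" n] by simp

text \<open>\<open>c x y * exp (- q x * s)\<close> is the density
  \<open>q x * exp (- q x * s)\<close> of the first holding time multiplied by the jump probability
  \<open>c x y / q x\<close>. Hence this is the decomposition at the first jump for a single
  path.\<close>

lemma path_prob_Cons:
  assumes c: "\<And>x y. 0 \<le> c x y" and q: "\<And>x. 0 < q x" and y: "y = zs ! 0"
  shows "(\<integral>\<^sup>+s. ennreal (c x y * exp (- q x * s)) * path_prob c q n zs (t - s) * indicator {0..t} s \<partial>lborel)
     \<le> path_prob c q (Suc n) (x # zs) t"
proof -
  let ?r = "\<Prod>i<n. c (zs ! i) (zs ! Suc i) / q (zs ! i)"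
  let ?h = "jump_count_prob n (\<lambda>i. q (zs ! i))"
  have [measurable]: "?h \<in> borel_measurable borel"
    using jump_count_prob_properties(2)[of "\<lambda>i. q (zs ! i)" n] q by simp
  have r: "0 \<le> ?r" using c q by (intro prod_nonneg) (auto intro!: divide_nonneg_pos)
  have rr: "(\<Prod>i<Suc n. c ((x # zs) ! i) ((x # zs) ! Suc i) / q ((x # zs) ! i)) = c x y / q x * ?r"
    by (simp only: prod.lessThan_Suc_shift) (simp add: y)
  have "ennreal (c x y * exp (- q x * s)) * (ennreal ?r * ?h (t - s)) * indicator {0..t} s =
     ennreal (c x y / q x * ?r) * (ennreal (q x * exp (- q x * s)) * ?h (t - s) * indicator {0..t} s)" for s
  proof -
    have "ennreal (c x y * exp (- q x * s)) * ennreal ?r = ennreal (c x y / q x * ?r) * ennreal (q x * exp (- q x * s))"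
      using c[of x y] q[of x] r by (simp add: ennreal_mult[symmetric] field_simps)
    then show ?thesis by (simp add: mult.assoc[symmetric])
  qed
  then have "(\<integral>\<^sup>+s. ennreal (c x y * exp (- q x * s)) * path_prob c q n zs (t - s) * indicator {0..t} s \<partial>lborel)
     = ennreal (c x y / q x * ?r) * (\<integral>\<^sup>+s. ennreal (q x * exp (- q x * s)) * ?h (t - s) * indicator {0..t} s \<partial>lborel)"
    unfolding path_prob_def by (simp add: nn_integral_cmult)
  also have "\<dots> \<le> ennreal (c x y / q x * ?r) * jump_count_prob (Suc n) (\<lambda>i. q ((x # zs) ! i)) t"
    using jump_count_prob_properties(3)[of "\<lambda>i. q ((x # zs) ! i)" n t] q
    by (intro mult_left_mono) auto
  finally show ?thesis unfolding path_prob_def rr .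
qed

context
  fixes c :: "'s \<Rightarrow> 's \<Rightarrow> real" and q :: "'s \<Rightarrow> real" and L :: real and D :: "'s set" and x' :: 's
  assumes c: "\<And>x y. 0 \<le> c x y" and fin: "\<And>x. finite {y. c x y \<noteq> 0}" and q: "\<And>x. 0 < q x"
    and qL: "\<And>x. x \<in> D \<Longrightarrow> q x \<le> L" and L: "0 < L" and x': "x' \<in> D"
begin

definition path_sum :: "nat \<Rightarrow> 's \<Rightarrow> real \<Rightarrow> ennreal" where
  "path_sum n x t = (\<Sum>zs\<in>jump_paths c D x' n x. path_prob c q n zs t)"

lemma path_sum_measurable: "path_sum n x \<in> borel_measurable borel"
  unfolding path_sum_def by (intro borel_measurable_sum path_prob_measurable q)

lemma path_sum_0: "x \<in> D \<Longrightarrow> 0 \<le> t \<Longrightarrow> path_sum 0 x t = ennreal (exp (- q x * t) * indicator {x'} x)"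
  unfolding path_sum_def path_prob_def
  using jump_count_prob_properties(1)[of "\<lambda>i. q ([x'] ! i)" t] q by (auto split: split_indicator)

lemma path_sum_Suc:
  assumes x: "x \<in> D"
  shows "(\<Sum>y | c x y \<noteq> 0. \<integral>\<^sup>+s. ennreal (c x y * exp (- q x * s)) * path_sum n y (t - s) * indicator {0..t} s \<partial>lborel)
     \<le> path_sum (Suc n) x t"
proof -
  have [measurable]: "path_prob c q n zs \<in> borel_measurable borel" for zs by (intro path_prob_measurable q)
  have "(\<integral>\<^sup>+s. ennreal (c x y * exp (- q x * s)) * path_sum n y (t - s) * indicator {0..t} s \<partial>lborel)
    \<le> (\<Sum>zs\<in>jump_paths c D x' n y. path_prob c q (Suc n) (x # zs) t)" for y
  proof -
    have "(\<integral>\<^sup>+s. ennreal (c x y * exp (- q x * s)) * path_sum n y (t - s) * indicator {0..t} s \<partial>lborel)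
      = (\<Sum>zs\<in>jump_paths c D x' n y. \<integral>\<^sup>+s. ennreal (c x y * exp (- q x * s)) * path_prob c q n zs (t - s) * indicator {0..t} s \<partial>lborel)"
      unfolding path_sum_def sum_distrib_left sum_distrib_right by (subst nn_integral_sum) auto
    also have "\<dots> \<le> (\<Sum>zs\<in>jump_paths c D x' n y. path_prob c q (Suc n) (x # zs) t)"
      using jump_paths_D[of _ c D x' n y] by (intro sum_mono path_prob_Cons c q) auto
    finally show ?thesis .
  qed
  then have "(\<Sum>y | c x y \<noteq> 0. \<integral>\<^sup>+s. ennreal (c x y * exp (- q x * s)) * path_sum n y (t - s) * indicator {0..t} s \<partial>lborel)
    \<le> (\<Sum>y | c x y \<noteq> 0. \<Sum>zs\<in>jump_paths c D x' n y. path_prob c q (Suc n) (x # zs) t)"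
    by (intro sum_mono)
  also have "\<dots> = (\<Sum>y | c x y \<noteq> 0. \<Sum>zs\<in>Cons x ` jump_paths c D x' n y. path_prob c q (Suc n) zs t)"
    by (rule sum.cong[OF refl], subst sum.reindex) auto
  also have "\<dots> = sum (\<lambda>zs. path_prob c q (Suc n) zs t) (\<Union>y\<in>{y. c x y \<noteq> 0}. Cons x ` jump_paths c D x' n y)"
  proof (rule sum.UNION_disjoint[symmetric])
    show "\<forall>y\<in>{y. c x y \<noteq> 0}. finite (Cons x ` jump_paths c D x' n y)"
      by (auto intro!: finite_jump_paths fin)
    \<comment> \<open>Paths with different first jumps differ in their second entry.\<close>
    show "\<forall>y\<in>{y. c x y \<noteq> 0}. \<forall>y'\<in>{y. c x y \<noteq> 0}. y \<noteq> y' \<longrightarrow>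
        Cons x ` jump_paths c D x' n y \<inter> Cons x ` jump_paths c D x' n y' = {}"
      using jump_paths_D[of _ c D x' n] by blast
  qed (rule fin)
  also have "\<dots> = path_sum (Suc n) x t"
    unfolding path_sum_def using x by simp
  finally show ?thesis .
qed

definition unif_kernel :: "nat \<Rightarrow> 's \<Rightarrow> real \<Rightarrow> real" where
  "unif_kernel N x t = exp (- L * t) *
     (\<Sum>n\<le>N. (L * t) ^ n / fact n * (gen_step c q L D ^^ n) (indicator {x'}) x)"

lemma gs_nonneg: "0 \<le> (gen_step c q L D ^^ n) (indicator {x'}) x"
  by (intro gen_step_nonneg c qL L) auto

lemma unif_kernel_nonneg: "0 \<le> t \<Longrightarrow> 0 \<le> unif_kernel N x t"
  unfolding unif_kernel_def using gs_nonneg L by (intro mult_nonneg_nonneg sum_nonneg) auto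

lemma unif_kernel_cont: "continuous_on A (unif_kernel N x)"
  unfolding unif_kernel_def by (intro continuous_intros) auto

lemma unif_kernel_outside: "x \<notin> D \<Longrightarrow> unif_kernel N x t = 0"
proof -
  assume "x \<notin> D"
  then have "(gen_step c q L D ^^ n) (indicator {x'}) x = 0" for n
    using x' by (cases n) (auto simp: gen_step_def indicator_def)
  then show ?thesis by (simp add: unif_kernel_def)
qed

text \<open>Duhamel's formula with an error of the right sign. Let \<open>v\<close> and
  \<open>u\<close> be the kernels truncated at \<open>Suc N\<close> and \<open>N\<close>. The
  derivative of \<open>- exp (- q x * s) * v (t - s)\<close> in \<open>s\<close> is
  \<open>exp (- q x * s)\<close> times \<open>?C + (L - q x) * (u - v)\<close> at
  \<open>t - s\<close>; the last term is at most 0 because \<open>u <= v\<close> and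
  \<open>q x <= L\<close>.\<close>

lemma unif_kernel_Suc:
  assumes x: "x \<in> D" and t: "0 \<le> t"
  shows "unif_kernel (Suc N) x t \<le> exp (- q x * t) * indicator {x'} x +
    (LINT s|lborel. exp (- q x * s) * (\<Sum>y | c x y \<noteq> 0. c x y * unif_kernel N y (t - s)) * indicator {0..t} s)"
proof -
  let ?a = "\<lambda>n. (gen_step c q L D ^^ n) (indicator {x'})"
  let ?C = "\<lambda>t. \<Sum>y | c x y \<noteq> 0. c x y * unif_kernel N y t"
  let ?V = "\<lambda>t. exp (- L * t) * (\<Sum>n\<le>N. (L * t) ^ n / fact n * ?a (Suc n) x)"
  have V: "?V t = (1 - q x / L) * unif_kernel N x t + ?C t / L" for t
  proof -
    have "?V t = (\<Sum>n\<le>N. exp (- L * t) * ((L * t) ^ n / fact n) * ((1 - q x / L) * ?a n x + (\<Sum>y | c x y \<noteq> 0. c x y * ?a n y) / L))"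
      using x by (simp add: gen_step_def sum_distrib_left mult.assoc)
    also have "\<dots> = (1 - q x / L) * unif_kernel N x t +
       (\<Sum>n\<le>N. exp (- L * t) * ((L * t) ^ n / fact n) * (\<Sum>y | c x y \<noteq> 0. c x y * ?a n y)) / L"
    proof -
      have "(\<Sum>n\<le>N. e * w n * (k * a n + S n / L)) = k * (e * (\<Sum>n\<le>N. w n * a n)) + (\<Sum>n\<le>N. e * w n * S n) / L"
        for e k :: real and w a S :: "nat \<Rightarrow> real"
        by (simp add: sum_distrib_left sum_divide_distrib sum.distrib algebra_simps)
      from this[of "exp (- L * t)" "\<lambda>n. (L * t) ^ n / fact n" "1 - q x / L" "\<lambda>n. ?a n x"
          "\<lambda>n. \<Sum>y | c x y \<noteq> 0. c x y * ?a n y"]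
      show ?thesis unfolding unif_kernel_def .
    qed
    also have "(\<Sum>n\<le>N. exp (- L * t) * ((L * t) ^ n / fact n) * (\<Sum>y | c x y \<noteq> 0. c x y * ?a n y)) = ?C t"
      unfolding unif_kernel_def sum_distrib_left by (subst sum.swap) (simp add: algebra_simps)
    finally show ?thesis .
  qed
  let ?v = "unif_kernel (Suc N) x"
  let ?v' = "\<lambda>t. L * (?V t - ?v t)"
  have dv: "(?v has_real_derivative ?v' t) (at t)" for t
    using exp_power_sum_deriv[where L=L and N=N and a="\<lambda>n. ?a n x" and t=t] unfolding unif_kernel_def .
  have cV: "isCont ?v s" "isCont (unif_kernel N x) s" "isCont (\<lambda>s. unif_kernel N y s) s" for s y
    using unif_kernel_cont[of UNIV] by (auto simp: continuous_on_eq_continuous_at)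
  have cv': "isCont ?v' s" for s
    unfolding V using L by (intro continuous_intros cV) auto
  let ?F = "\<lambda>s. - exp (- q x * s) * ?v (t - s)"
  let ?f = "\<lambda>s. exp (- q x * s) * (q x * ?v (t - s) + ?v' (t - s))"
  let ?g = "\<lambda>s. exp (- q x * s) * ?C (t - s)"
  have dF: "(?F has_real_derivative ?f s) (at s)" for s
    by (rule derivative_eq_intros DERIV_chain2[OF dv] refl)+ (simp add: algebra_simps)
  have shift: "isCont (\<lambda>s. h (t - s)) s" if "\<And>s. isCont h s" for h :: "real \<Rightarrow> real" and s
    using that by (intro isCont_o2[where f="\<lambda>s. t - s" and g=h]) auto
  have cf: "isCont ?f s" for s
    by (intro continuous_intros shift[OF cv'] shift[OF cV(1)])
  have I: "has_bochner_integral lborel (\<lambda>s. ?f s * indicator {0..t} s) (?F t - ?F 0)"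
    by (rule has_bochner_integral_FTC_Icc_real) (use t dF cf in auto)
  have "continuous_on {0..t} ?g"
    by (intro continuous_at_imp_continuous_on ballI continuous_intros shift[OF cV(3)])
  from borel_integrable_atLeastAtMost'[OF this]
  have Ig: "integrable lborel (\<lambda>s. ?g s * indicator {0..t} s)"
    by (simp add: set_integrable_def mult.commute)
  have le: "?f s \<le> ?g s" if "0 \<le> s" "s \<le> t" for s
  proof -
    have "unif_kernel N x (t - s) \<le> ?v (t - s)"
      unfolding unif_kernel_def using gs_nonneg L that
      by (intro mult_left_mono sum_mono2 mult_nonneg_nonneg) auto
    then have "(L - q x) * unif_kernel N x (t - s) \<le> (L - q x) * ?v (t - s)"
      using qL[OF x] by (intro mult_left_mono) auto
    moreover have "L * ?V (t - s) = (L - q x) * unif_kernel N x (t - s) + ?C (t - s)"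
      unfolding V using L by (simp add: field_simps)
    ultimately have "q x * ?v (t - s) + ?v' (t - s) \<le> ?C (t - s)"
    proof -
      have "k * v + L * (w - v) \<le> C" if "(L - k) * u \<le> (L - k) * v" "L * w = (L - k) * u + C"
        for k u v w C using that by (simp add: algebra_simps)
      then show "(L - q x) * unif_kernel N x (t - s) \<le> (L - q x) * ?v (t - s) \<Longrightarrow>
          L * ?V (t - s) = (L - q x) * unif_kernel N x (t - s) + ?C (t - s) \<Longrightarrow>
          q x * ?v (t - s) + ?v' (t - s) \<le> ?C (t - s)" by blast
    qed
    then show ?thesis by (intro mult_left_mono) auto
  qed
  have "?F t - ?F 0 = (LINT s|lborel. ?f s * indicator {0..t} s)"
    using I by (simp add: has_bochner_integral_iff)
  also have "\<dots> \<le> (LINT s|lborel. ?g s * indicator {0..t} s)"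
    using le I Ig by (intro integral_mono) (auto simp: has_bochner_integral_iff split: split_indicator)
  finally have "?F t - ?F 0 \<le> (LINT s|lborel. ?g s * indicator {0..t} s)" .
  moreover have "?v 0 = indicator {x'} x"
    unfolding unif_kernel_def by (simp add: sum.atMost_Suc_shift del: sum.atMost_Suc)
  ultimately show ?thesis by simp
qed

text \<open>
  The uniformized chain makes at most as many jumps as there are rings of its clock. Hence truncation
  at \<open>N\<close> rings is dominated by truncation at \<open>N\<close> jumps.
\<close>

lemma unif_kernel_le_path_sum:
  assumes "0 \<le> t"
  shows "ennreal (unif_kernel N x t) \<le> (\<Sum>n\<le>N. path_sum n x t)"
  using assms
proof (induction N arbitrary: x t)
  case 0
  show ?case
  proof (cases "x \<in> D")
    case True
    have "exp (- L * t) * indicator {x'} x \<le> exp (- q x * t) * indicator {x'} x"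
      using qL[OF True] 0 by (intro mult_right_mono) (auto intro: mult_right_mono)
    then show ?thesis using True 0 by (auto simp: path_sum_0 unif_kernel_def intro!: ennreal_leI)
  qed (simp add: unif_kernel_outside)
next
  case (Suc N)
  show ?case
  proof (cases "x \<in> D")
    case True
    note [measurable] = path_sum_measurable
    let ?C = "\<lambda>t. \<Sum>y | c x y \<noteq> 0. c x y * unif_kernel N y t"
    let ?g = "\<lambda>s. exp (- q x * s) * ?C (t - s)"
    have C0: "0 \<le> ?C s" if "0 \<le> s" for s using c that by (intro sum_nonneg mult_nonneg_nonneg unif_kernel_nonneg) auto
    have "continuous_on {0..t} ?g"
      unfolding unif_kernel_def by (intro continuous_intros) auto
    from borel_integrable_atLeastAtMost'[OF this]
    have Ig: "integrable lborel (\<lambda>s. ?g s * indicator {0..t} s)"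
      by (simp add: set_integrable_def mult.commute)
    have "ennreal (unif_kernel (Suc N) x t) \<le> ennreal (exp (- q x * t) * indicator {x'} x +
      (LINT s|lborel. ?g s * indicator {0..t} s))"
      by (intro ennreal_leI unif_kernel_Suc True Suc.prems)
    also have "\<dots> = path_sum 0 x t + ennreal (LINT s|lborel. ?g s * indicator {0..t} s)"
      using True Suc.prems C0
      by (subst ennreal_plus) (auto simp: path_sum_0 intro!: integral_nonneg split: split_indicator)
    also have "ennreal (LINT s|lborel. ?g s * indicator {0..t} s) = (\<integral>\<^sup>+s. ennreal (?g s * indicator {0..t} s) \<partial>lborel)"
      using C0 by (intro nn_integral_eq_integral[symmetric] Ig) (auto split: split_indicator)
    also have "\<dots> \<le> (\<integral>\<^sup>+s. (\<Sum>y | c x y \<noteq> 0. \<Sum>n\<le>N. ennreal (c x y * exp (- q x * s)) * path_sum n y (t - s) * indicator {0..t} s) \<partial>lborel)"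
    proof (intro nn_integral_mono)
      fix s :: real
      show "ennreal (?g s * indicator {0..t} s) \<le> (\<Sum>y | c x y \<noteq> 0. \<Sum>n\<le>N. ennreal (c x y * exp (- q x * s)) * path_sum n y (t - s) * indicator {0..t} s)"
      proof (cases "s \<in> {0..t}")
        case s: True
        have "ennreal (?g s) = (\<Sum>y | c x y \<noteq> 0. ennreal (c x y * exp (- q x * s)) * ennreal (unif_kernel N y (t - s)))"
          using s c unif_kernel_nonneg[of "t - s" N] unfolding sum_distrib_left
          by (subst sum_ennreal[symmetric]) (auto simp: ennreal_mult[symmetric] mult_ac)
        also have "\<dots> \<le> (\<Sum>y | c x y \<noteq> 0. ennreal (c x y * exp (- q x * s)) * (\<Sum>n\<le>N. path_sum n y (t - s)))"
          using s by (intro sum_mono mult_left_mono Suc.IH) auto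
        finally show ?thesis using s by (simp add: sum_distrib_left)
      qed simp
    qed
    also have "\<dots> = (\<Sum>n\<le>N. \<Sum>y | c x y \<noteq> 0. \<integral>\<^sup>+s. ennreal (c x y * exp (- q x * s)) * path_sum n y (t - s) * indicator {0..t} s \<partial>lborel)"
      by (subst nn_integral_sum, simp, subst nn_integral_sum, simp, rule sum.swap)
    also have "\<dots> \<le> (\<Sum>n\<le>N. path_sum (Suc n) x t)"
      by (intro sum_mono path_sum_Suc True)
    finally show ?thesis by (simp add: sum.atMost_Suc_shift del: sum.atMost_Suc)
  qed (simp add: unif_kernel_outside)
qed

end

text \<open>A single term of the Poisson series is kept; it is part of the kernel truncated at
  \<open>n\<close> rings, hence dominated by the paths with at most \<open>n\<close> jumps.
  Different paths give disjoint events, because with positive holding times both the number of jumps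
  up to \<open>t\<close> and the visited sites are determined.\<close>

lemma markov_chain_prob_ge:
  fixes c :: "'s \<Rightarrow> 's \<Rightarrow> real" and X :: "real \<Rightarrow> 'b \<Rightarrow> 's"
  assumes chain: "markov_chain_with_rates N X c x0"
    and c: "\<And>x y. 0 \<le> c x y" and fin: "\<And>x. finite {y. c x y \<noteq> 0}"
    and q: "\<And>x. 0 < exit_rate c x" and qL: "\<And>x. x \<in> D \<Longrightarrow> exit_rate c x \<le> L"
    and L: "0 < L" and x': "x' \<in> D" and t: "0 \<le> t"
  shows "exp (- L * t) * ((L * t) ^ n / fact n * (gen_step c (exit_rate c) L D ^^ n) (indicator {x'}) x0)
    \<le> measure N {w \<in> space N. X t w = x'}"
proof -
  let ?q = "exit_rate c"
  from chain interpret N: prob_space N by (simp add: markov_chain_with_rates_def)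
  from chain t have [measurable]: "X t \<in> measurable N (count_space UNIV)"
    by (simp add: markov_chain_with_rates_def)
  from chain obtain Y S where [measurable]: "\<And>n. Y n \<in> measurable N (count_space UNIV)"
      "\<And>n. S n \<in> borel_measurable N" and
    law: "\<And>n y s. (\<forall>i\<le>n. 0 \<le> s i) \<Longrightarrow>
           measure N {w \<in> space N. \<forall>i\<le>n. Y i w = y i \<and> s i < S i w} =
             (if y 0 = x0 then 1 else 0) *
             (\<Prod>i<n. c (y i) (y (Suc i)) / exit_rate c (y i)) *
             (\<Prod>i\<le>n. exp (- exit_rate c (y i) * s i))" and
    path: "AE w in N. \<forall>n t. (\<Sum>i<n. S i w) \<le> t \<and> t < (\<Sum>i\<le>n. S i w) \<longrightarrow> X t w = Y n w"
    unfolding markov_chain_with_rates_def by blast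
  define A where "A = (\<lambda>(m, zs). {w \<in> space N. (\<forall>i\<le>m. Y i w = zs ! i \<and> 0 < S i w) \<and>
          (\<Sum>i<m. S i w) \<le> t \<and> t < (\<Sum>i\<le>m. S i w)})"
  have A: "A p \<in> sets N" for p
    unfolding A_def by (cases p) simp
  let ?P = "Sigma {..n} (\<lambda>m. jump_paths c D x' m x0)"
  have finP: "finite ?P" by (intro finite_SigmaI finite_jump_paths fin) auto
  have disj: "disjoint_family_on A ?P"
  proof -
    have lt: "A (m, zs) \<inter> A (m', zs') = {}" if "m < m'" for m m' zs zs'
    proof (rule equals0I)
      fix w assume w: "w \<in> A (m, zs) \<inter> A (m', zs')"
      have "(\<Sum>i\<le>m. S i w) \<le> (\<Sum>i<m'. S i w)"
        using w that by (intro sum_mono2) (auto simp: A_def less_imp_le)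
      with w show False by (auto simp: A_def)
    qed
    have eq: "A (m, zs) \<inter> A (m, zs') = {}"
      if "zs \<noteq> zs'" "zs \<in> jump_paths c D x' m x0" "zs' \<in> jump_paths c D x' m x0" for m zs zs'
    proof -
      from that(2,3) have "length zs = Suc m" "length zs' = Suc m" by (auto dest: jump_paths_D)
      with that(1) obtain i where "i \<le> m" "zs ! i \<noteq> zs' ! i"
        by (metis less_Suc_eq_le nth_equalityI)
      then show ?thesis by (auto simp: A_def)
    qed
    show ?thesis
      unfolding disjoint_family_on_def
    proof (intro ballI impI)
      fix p p' assume "p \<in> ?P" "p' \<in> ?P" "p \<noteq> p'"
      then show "A p \<inter> A p' = {}"
        using lt[of "fst p" "fst p'" "snd p" "snd p'"] lt[of "fst p'" "fst p" "snd p'" "snd p"]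
          eq[of "snd p" "snd p'" "fst p"]
        by (cases p; cases p'; cases "fst p" "fst p'" rule: linorder_cases) auto
    qed
  qed
  have "ennreal (unif_kernel c ?q L D x' n x0 t) \<le> (\<Sum>m\<le>n. path_sum c ?q D x' m x0 t)"
    by (rule unif_kernel_le_path_sum[OF c fin q qL L x' t])
  also have "\<dots> = (\<Sum>(m, zs)\<in>?P. path_prob c ?q m zs t)"
    by (simp add: path_sum_def[OF c fin q qL L x'] sum.Sigma finite_jump_paths fin)
  also have "\<dots> \<le> (\<Sum>p\<in>?P. emeasure N (A p))"
  proof (rule sum_mono)
    fix p assume p: "p \<in> ?P"
    obtain m zs where pe: "p = (m, zs)" by (cases p)
    with p have "zs ! 0 = x0" by (auto dest: jump_paths_D)
    from N.jump_path_prob_ge[where Y=Y and S=S and c=c and q="?q" and ?x0.0=x0 and n=m and y="\<lambda>i. zs ! i" and t=t, OF _ _ law c q this]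
    show "(case p of (m, zs) \<Rightarrow> path_prob c ?q m zs t) \<le> emeasure N (A p)"
      unfolding path_prob_def A_def pe by simp
  qed
  also have "\<dots> = emeasure N (\<Union>p\<in>?P. A p)"
    using A by (intro sum_emeasure disj finP) auto
  also have "\<dots> \<le> emeasure N {w \<in> space N. X t w = x'}"
  proof (rule emeasure_mono_AE)
    show "AE w in N. w \<in> (\<Union>p\<in>?P. A p) \<longrightarrow> w \<in> {w \<in> space N. X t w = x'}"
      using path
    proof eventually_elim
      case (elim w)
      show ?case
      proof
        assume "w \<in> (\<Union>p\<in>?P. A p)"
        then obtain m zs where "zs \<in> jump_paths c D x' m x0" "w \<in> A (m, zs)" by auto
        with elim show "w \<in> {w \<in> space N. X t w = x'}" by (auto simp: A_def dest: jump_paths_D)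
      qed
    qed
  qed measurable
  finally have "unif_kernel c ?q L D x' n x0 t \<le> measure N {w \<in> space N. X t w = x'}"
    by (simp add: N.emeasure_eq_measure)
  moreover have "exp (- L * t) * ((L * t) ^ n / fact n * (gen_step c ?q L D ^^ n) (indicator {x'}) x0)
     \<le> unif_kernel c ?q L D x' n x0 t"
  proof -
    have "(L * t) ^ n / fact n * (gen_step c ?q L D ^^ n) (indicator {x'}) x0
      \<le> (\<Sum>m\<le>n. (L * t) ^ m / fact m * (gen_step c ?q L D ^^ m) (indicator {x'}) x0)"
      using L t by (intro member_le_sum mult_nonneg_nonneg gen_step_nonneg c qL) auto
    then show ?thesis using qL by (simp only: unif_kernel_def[OF c fin q qL L x'] mult_left_mono exp_ge_zero)
  qed
  ultimately show ?thesis by linarith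
qed

text \<open>With \<open>m = Suc n\<close> the induction step is
  \<open>e <= (1 + 1/m)^(m + 1)\<close>. Compared with Stirling's formula a factor of order
  \<open>sqrt m\<close> is lost, which is only polynomial.\<close>

lemma fact_le_power_exp: "fact (Suc n) \<le> real (Suc n) ^ (n + 2) * exp (1 - real (Suc n))"
proof (induction n)
  case (Suc n)
  let ?m = "real (Suc n)"
  have "exp 1 * ?m ^ (n + 2) \<le> (?m + 1) ^ (n + 2)"
  proof -
    have "1 / (?m + 1) \<le> ln (1 + 1 / ?m)"
      using ln_one_plus_pos_lower_bound ln_add_one_self_le_self2 ln_le_minus_one[of "?m / (?m + 1)"]
      by (simp add: ln_div field_simps)
    then have "1 \<le> real (n + 2) * ln (1 + 1 / ?m)" by (simp add: field_simps)
    then have "exp 1 \<le> exp (real (n + 2) * ln (1 + 1 / ?m))" by simp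
    also have "\<dots> = (1 + 1 / ?m) ^ (n + 2)"
      by (subst exp_of_nat_mult) (auto simp: add_pos_pos)
    finally have "exp 1 * ?m ^ (n + 2) \<le> (1 + 1 / ?m) ^ (n + 2) * ?m ^ (n + 2)"
      by (intro mult_right_mono) auto
    also have "\<dots> = (?m + 1) ^ (n + 2)"
    proof -
      have "(1 + 1 / ?m) * ?m = ?m + 1" by (simp add: distrib_right)
      then show ?thesis by (simp only: power_mult_distrib[symmetric])
    qed
    finally show ?thesis .
  qed
  then have *: "(?m + 1) * exp (- ?m) * (exp 1 * ?m ^ (n + 2)) \<le> (?m + 1) * exp (- ?m) * (?m + 1) ^ (n + 2)"
    by (intro mult_left_mono) auto
  have "fact (Suc (Suc n)) = (?m + 1) * fact (Suc n)" by (simp add: add.commute)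
  also have "\<dots> \<le> (?m + 1) * (?m ^ (n + 2) * exp (1 - ?m))"
    using Suc by (intro mult_left_mono) auto
  also have "\<dots> = (?m + 1) * exp (- ?m) * (exp 1 * ?m ^ (n + 2))"
    by (simp add: exp_diff exp_minus field_simps)
  also note *
  also have "(?m + 1) * exp (- ?m) * (?m + 1) ^ (n + 2) = real (Suc (Suc n)) ^ (Suc n + 2) * exp (1 - real (Suc (Suc n)))"
    by (simp add: exp_diff exp_minus field_simps add.commute)
  finally show ?case .
qed simp

lemma poisson_mode_ge:
  assumes "0 < n"
  shows "1 / (exp 1 * real n) \<le> exp (- real n) * (real n ^ n / fact n)"
proof -
  obtain k where n: "n = Suc k" using assms by (cases n) auto
  have "fact n \<le> real n ^ (n + 1) * exp (1 - real n)"
    using fact_le_power_exp[of k] by (simp add: n)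
  also have "\<dots> = (exp 1 * real n) * (exp (- real n) * real n ^ n)"
    by (simp add: exp_diff exp_minus field_simps)
  finally show ?thesis using assms by (simp add: field_simps)
qed

section \<open>Simple random walk killed outside a box\<close>

text \<open>\<open>D\<close> kills at the site where the step starts, and values of \<open>f\<close>
  outside \<open>D\<close> do enter. Comparison functions that are non-positive outside
  \<open>D\<close> can thus be used without truncation, while the symmetry statements need supports
  in \<open>D\<close>.\<close>

definition srw_step :: "real \<Rightarrow> (int ^ 'd) set \<Rightarrow> (int ^ 'd \<Rightarrow> real) \<Rightarrow> int ^ 'd \<Rightarrow> real" where
  "srw_step L D f a = (if a \<in> D then (1 - 2 * real CARD('d) / L) * f a +
     (\<Sum>i\<in>UNIV. f (a + axis i 1) + f (a - axis i 1)) / L else 0)"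

definition cube :: "nat \<Rightarrow> (int ^ 'd) set" where
  "cube r = {a. \<forall>i. \<bar>a $ i\<bar> \<le> int r}"

lemma cube_iff: "a \<in> cube r \<longleftrightarrow> (\<forall>i. \<bar>a $ i\<bar> \<le> int r)" by (simp add: cube_def)

lemma zero_in_cube [simp]: "0 \<in> cube r" by (simp add: cube_def)

lemma cube_mono: "r \<le> R \<Longrightarrow> cube r \<subseteq> cube R"
  unfolding subset_iff cube_iff by (meson of_nat_le_iff order_trans)

lemma card_cube: "finite (cube r :: (int ^ 'd) set)" "card (cube r :: (int ^ 'd) set) = (2 * r + 1) ^ CARD('d)"
proof -
  have b: "bij_betw (\<lambda>f. \<chi> i. f i) (PiE (UNIV :: 'd set) (\<lambda>_. {- int r .. int r})) (cube r)"
    by (rule bij_betwI[where g="\<lambda>a. vec_nth a"]) (auto simp: cube_def PiE_iff abs_le_iff minus_le_iff)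
  have f: "finite (PiE (UNIV :: 'd set) (\<lambda>_. {- int r .. int r}))" by (intro finite_PiE) auto
  show "finite (cube r :: (int ^ 'd) set)" using b f bij_betw_finite by blast
  have "card (cube r :: (int ^ 'd) set) = card (PiE (UNIV :: 'd set) (\<lambda>_. {- int r .. int r}))"
    using bij_betw_same_card[OF b] by simp
  also have "\<dots> = (2 * r + 1) ^ CARD('d)" by (subst card_PiE) (auto simp: nat_add_distrib nat_mult_distrib)
  finally show "card (cube r :: (int ^ 'd) set) = (2 * r + 1) ^ CARD('d)" .
qed

section \<open>Monotonicity, linearity and symmetry of the killed step\<close>

lemma srw_step_mono:
  fixes f g :: "int ^ 'd \<Rightarrow> real"
  assumes L: "2 * real CARD('d) \<le> L" and fg: "\<And>a. f a \<le> g a"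
  shows "srw_step L D f a \<le> srw_step L D g a"
proof -
  have "0 < L" using L by (smt (verit) of_nat_0_less_iff zero_less_card_finite)
  then show ?thesis
    unfolding srw_step_def using L fg by (auto intro!: add_mono mult_left_mono divide_right_mono sum_mono)
qed

lemma srw_pow_mono:
  fixes f g :: "int ^ 'd \<Rightarrow> real"
  assumes L: "2 * real CARD('d) \<le> L" and fg: "\<And>a. f a \<le> g a"
  shows "(srw_step L D ^^ n) f a \<le> (srw_step L D ^^ n) g a"
  by (induction n arbitrary: a) (auto intro!: srw_step_mono L fg)

lemma srw_step_zero [simp]: "srw_step L D (\<lambda>_. 0) = (\<lambda>_. 0)"
  by (auto simp: srw_step_def)

lemma srw_pow_zero [simp]: "(srw_step L D ^^ n) (\<lambda>_. 0) = (\<lambda>_. 0)"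
  by (induction n) auto

lemma srw_pow_nonneg:
  fixes f :: "int ^ 'd \<Rightarrow> real"
  assumes "2 * real CARD('d) \<le> L" "\<And>a. 0 \<le> f a"
  shows "0 \<le> (srw_step L D ^^ n) f a"
  using srw_pow_mono[OF assms(1), of "\<lambda>_. 0" f n D a] assms(2) by simp

lemma srw_pow_support: "a \<notin> D \<Longrightarrow> f a = 0 \<Longrightarrow> (srw_step L D ^^ n) f a = 0"
  by (cases n) (auto simp: srw_step_def)

lemma srw_step_add: "srw_step L D (\<lambda>a. f a + g a) a = srw_step L D f a + srw_step L D g a"
  by (auto simp: srw_step_def sum.distrib add_divide_distrib algebra_simps)

lemma srw_step_sum: "srw_step L D (\<lambda>a. \<Sum>j\<in>J. f j a) a = (\<Sum>j\<in>J. srw_step L D (f j) a)"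
  by (cases "finite J", induction J rule: finite_induct) (auto simp: srw_step_add)

lemma srw_step_cmult: "srw_step L D (\<lambda>a. c * f a) a = c * srw_step L D f a"
  by (auto simp: srw_step_def sum_distrib_left algebra_simps add_divide_distrib)

lemma sum_shift_support:
  fixes f g :: "int ^ 'd \<Rightarrow> real"
  assumes "finite D" "\<And>a. a \<notin> D \<Longrightarrow> f a = 0" "\<And>a. a \<notin> D \<Longrightarrow> g a = 0"
  shows "(\<Sum>a\<in>D. g a * f (a + v)) = (\<Sum>a\<in>D. g (a - v) * f a)"
  by (rule sum.reindex_bij_witness_not_neutral[where
        S'="{a\<in>D. a + v \<notin> D}" and T'="{a\<in>D. a - v \<notin> D}" and i="\<lambda>a. a - v" and j="\<lambda>a. a + v"])
    (use assms in auto)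

lemma srw_step_adjoint:
  fixes f g :: "int ^ 'd \<Rightarrow> real"
  assumes D: "finite D" "\<And>a. a \<notin> D \<Longrightarrow> f a = 0" "\<And>a. a \<notin> D \<Longrightarrow> g a = 0"
  shows "(\<Sum>a\<in>D. g a * srw_step L D f a) = (\<Sum>a\<in>D. srw_step L D g a * f a)"
proof -
  have *: "(\<Sum>a\<in>D. g a * srw_step L D f a) = (1 - 2 * real CARD('d) / L) * (\<Sum>a\<in>D. g a * f a)
    + (\<Sum>i\<in>UNIV. (\<Sum>a\<in>D. g a * f (a + axis i 1)) + (\<Sum>a\<in>D. g a * f (a + - axis i 1))) / L" for f g
  proof -
    have "(\<Sum>a\<in>D. g a * srw_step L D f a) = (\<Sum>a\<in>D. (1 - 2 * real CARD('d) / L) * (g a * f a) +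
       (\<Sum>i\<in>UNIV. g a * f (a + axis i 1) + g a * f (a + - axis i 1)) / L)"
      by (rule sum.cong) (auto simp: srw_step_def distrib_left sum_distrib_left)
    also have "\<dots> = (1 - 2 * real CARD('d) / L) * (\<Sum>a\<in>D. g a * f a) +
       (\<Sum>a\<in>D. \<Sum>i\<in>UNIV. g a * f (a + axis i 1) + g a * f (a + - axis i 1)) / L"
      by (simp only: sum.distrib sum_distrib_left[symmetric] sum_divide_distrib[symmetric])
    also have "(\<Sum>a\<in>D. \<Sum>i\<in>UNIV. g a * f (a + axis i 1) + g a * f (a + - axis i 1)) =
       (\<Sum>i\<in>UNIV. \<Sum>a\<in>D. g a * f (a + axis i 1) + g a * f (a + - axis i 1))"
      by (rule sum.swap)
    finally show ?thesis unfolding sum.distrib .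
  qed
  have "(\<Sum>a\<in>D. g a * f (a + axis i 1)) + (\<Sum>a\<in>D. g a * f (a + - axis i 1)) =
     (\<Sum>a\<in>D. f a * g (a + axis i 1)) + (\<Sum>a\<in>D. f a * g (a + - axis i 1))" for i
    using sum_shift_support[where f=f and g=g and v="axis i 1", OF D] sum_shift_support[where f=f and g=g and v="- axis i 1", OF D]
    by (simp add: mult.commute[of "f _"])
  then have "(\<Sum>a\<in>D. g a * srw_step L D f a) = (\<Sum>a\<in>D. f a * srw_step L D g a)"
    unfolding * by (simp add: mult.commute)
  then show ?thesis by (simp add: mult.commute)
qed

lemma srw_pow_adjoint:
  fixes f g :: "int ^ 'd \<Rightarrow> real"
  assumes "finite D" "\<And>a. a \<notin> D \<Longrightarrow> f a = 0" "\<And>a. a \<notin> D \<Longrightarrow> g a = 0"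
  shows "(\<Sum>a\<in>D. g a * (srw_step L D ^^ n) f a) = (\<Sum>a\<in>D. (srw_step L D ^^ n) g a * f a)"
  using assms
proof (induction n arbitrary: f g)
  case (Suc n)
  have "(\<Sum>a\<in>D. g a * (srw_step L D ^^ Suc n) f a) = (\<Sum>a\<in>D. srw_step L D g a * (srw_step L D ^^ n) f a)"
    using Suc.prems by (simp add: srw_step_adjoint srw_pow_support)
  also have "\<dots> = (\<Sum>a\<in>D. (srw_step L D ^^ n) (srw_step L D g) a * f a)"
    by (rule Suc.IH) (use Suc.prems in \<open>auto simp: srw_step_def\<close>)
  finally show ?case by (simp add: funpow_Suc_right del: funpow.simps)
qed simp

text \<open>By symmetry, expectations for the walk started at 0 become sums against the iterates of
  \<open>indicator {0}\<close>, and these are the functions whose unimodality is available.\<close>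

lemma srw_pow_at_0:
  fixes f :: "int ^ 'd \<Rightarrow> real"
  assumes "finite D" "0 \<in> D" "\<And>a. a \<notin> D \<Longrightarrow> f a = 0"
  shows "(srw_step L D ^^ n) f 0 = (\<Sum>a\<in>D. (srw_step L D ^^ n) (indicator {0}) a * f a)"
proof -
  have "(\<Sum>a\<in>D. indicator {0} a * (srw_step L D ^^ n) f a) = (\<Sum>a\<in>D. (srw_step L D ^^ n) (indicator {0}) a * f a)"
    by (rule srw_pow_adjoint) (use assms in \<open>auto simp: indicator_def\<close>)
  moreover have "(\<Sum>a\<in>D. indicator {0} a * (srw_step L D ^^ n) f a) = (srw_step L D ^^ n) f 0"
    using assms by (simp add: indicator_def if_distrib[of "\<lambda>x. x * _"] sum.delta cong: if_cong)
  ultimately show ?thesis by simp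
qed

section \<open>Unimodality in the second coordinate\<close>

definition unimodal :: "(int ^ 'd \<Rightarrow> real) \<Rightarrow> bool" where
  "unimodal f \<longleftrightarrow> (\<forall>x y. (\<forall>i. \<bar>x $ i\<bar> \<le> \<bar>y $ i\<bar>) \<longrightarrow> f y \<le> f x)"

text \<open>For \<open>|k| < |l|\<close> the site \<open>l\<close> is compared with
  \<open>k - 1\<close>, the neighbour of \<open>l\<close> closer to 0 with \<open>k\<close>, and the
  other neighbour with \<open>k + 1\<close>. The first comparison takes weight \<open>a\<close> out
  of the holding term, hence \<open>a <= b\<close>. Without holding the claim fails: the step of the
  indicator of 0 vanishes at 0. There are two functions because the slices through two different
  points of the lattice get compared.\<close>

lemma unimodal_step_1d:
  fixes f g :: "int \<Rightarrow> real"
  assumes fg: "\<And>k l. \<bar>k\<bar> \<le> \<bar>l\<bar> \<Longrightarrow> g l \<le> f k" and kl: "\<bar>k\<bar> \<le> \<bar>l\<bar>" and ab: "0 \<le> a" "a \<le> b"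
  shows "b * g l + a * (g (l + 1) + g (l - 1)) \<le> b * f k + a * (f (k + 1) + f (k - 1))"
proof (cases "\<bar>k\<bar> = \<bar>l\<bar>")
  case True
  have "g (l + 1) + g (l - 1) \<le> f (k + 1) + f (k - 1)"
  proof (cases "k = l")
    case True then show ?thesis using fg by (intro add_mono) auto
  next
    case False
    with \<open>\<bar>k\<bar> = \<bar>l\<bar>\<close> have "k = - l" by linarith
    then have "g (l + 1) \<le> f (k - 1)" "g (l - 1) \<le> f (k + 1)" by (auto intro!: fg)
    then show ?thesis by linarith
  qed
  with fg[OF kl] ab show ?thesis by (auto intro: add_mono[OF mult_left_mono mult_left_mono])
next
  case False
  with kl have lt: "\<bar>k\<bar> < \<bar>l\<bar>" by linarith
  have 1: "g (l + 1) + g (l - 1) \<le> f k + f (k + 1)"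
  proof (cases "0 < l")
    case True
    then have "g (l - 1) \<le> f k" "g (l + 1) \<le> f (k + 1)" using lt by (auto intro!: fg)
    then show ?thesis by linarith
  next
    case False
    then have "g (l + 1) \<le> f k" "g (l - 1) \<le> f (k + 1)" using lt by (auto intro!: fg)
    then show ?thesis by linarith
  qed
  have 2: "g l \<le> f (k - 1)" using lt by (intro fg) linarith
  have "b * g l + a * (g (l + 1) + g (l - 1)) = (b - a) * g l + a * (g l + (g (l + 1) + g (l - 1)))"
    by (simp add: algebra_simps)
  also have "\<dots> \<le> (b - a) * f k + a * (f (k - 1) + (f k + f (k + 1)))"
    using add_mono[OF 2 1] fg[OF kl] ab by (auto intro: add_mono[OF mult_left_mono mult_left_mono])
  also have "\<dots> = b * f k + a * (f (k + 1) + f (k - 1))" by (simp add: algebra_simps)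
  finally show ?thesis .
qed

text \<open>The step is a sum over the axes of one-dimensional steps with holding weight
  \<open>1 / d - 2 / L\<close>, and \<open>3 d <= L\<close> makes this at least the jump weight
  \<open>1 / L\<close>. A cube is stable under shrinking coordinates, so killing respects the
  order.\<close>

lemma srw_step_unimodal:
  fixes f :: "int ^ 'd \<Rightarrow> real"
  assumes L: "3 * real CARD('d) \<le> L" and f: "unimodal f" "\<And>a. 0 \<le> f a"
  shows "unimodal (srw_step L (cube r) f)"
  unfolding unimodal_def
proof (intro allI impI)
  fix x y :: "int ^ 'd" assume xy: "\<forall>i. \<bar>x $ i\<bar> \<le> \<bar>y $ i\<bar>"
  have L0: "0 < L" using L by (smt (verit) of_nat_0_less_iff zero_less_card_finite)
  let ?d = "real CARD('d)"
  let ?b = "1 / ?d - 2 / L"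
  have d0: "0 < ?d" by simp
  have "3 / L \<le> 3 / (3 * ?d)" using mult_pos_pos[OF L0 d0] by (intro divide_left_mono L) auto
  then have b: "1 / L \<le> ?b" by simp
  have split: "(1 - 2 * ?d / L) * f a + (\<Sum>i\<in>UNIV. f (a + axis i 1) + f (a - axis i 1)) / L
     = (\<Sum>i\<in>UNIV. ?b * f a + 1 / L * (f (a + axis i 1) + f (a - axis i 1)))" for a
    using d0 by (simp add: sum.distrib sum_divide_distrib add_divide_distrib) (simp add: field_simps)
  have le: "(\<Sum>i\<in>UNIV. ?b * f y + 1 / L * (f (y + axis i 1) + f (y - axis i 1)))
     \<le> (\<Sum>i\<in>UNIV. ?b * f x + 1 / L * (f (x + axis i 1) + f (x - axis i 1)))"
  proof (rule sum_mono)
    fix i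
    \<comment> \<open>The slice of \<open>f\<close> through \<open>a\<close> in direction
      \<open>i\<close>.\<close>
    let ?f = "\<lambda>a k. f (\<chi> j. if j = i then k else a $ j)"
    have *: "a = (\<chi> j. if j = i then a $ i else a $ j)"
      "a + axis i 1 = (\<chi> j. if j = i then a $ i + 1 else a $ j)"
      "a - axis i 1 = (\<chi> j. if j = i then a $ i - 1 else a $ j)" for a :: "int ^ 'd"
      by (auto simp: vec_eq_iff axis_def)
    have "?b * ?f y (y $ i) + 1 / L * (?f y (y $ i + 1) + ?f y (y $ i - 1))
       \<le> ?b * ?f x (x $ i) + 1 / L * (?f x (x $ i + 1) + ?f x (x $ i - 1))"
      using xy b L0 f(1) by (intro unimodal_step_1d) (auto simp: unimodal_def)
    then show "?b * f y + 1 / L * (f (y + axis i 1) + f (y - axis i 1))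
       \<le> ?b * f x + 1 / L * (f (x + axis i 1) + f (x - axis i 1))"
      using *[of x] *[of y] by metis
  qed
  show "srw_step L (cube r) f y \<le> srw_step L (cube r) f x"
  proof (cases "y \<in> cube r")
    case True
    then have "x \<in> cube r" using xy by (meson cube_iff order_trans)
    with True le show ?thesis by (simp add: srw_step_def split)
  next
    case False
    then show ?thesis using srw_pow_nonneg[of L f 1 "cube r" x] L f(2) by (simp add: srw_step_def)
  qed
qed

lemma srw_pow_unimodal:
  fixes L :: real
  assumes L: "3 * real CARD('d) \<le> L"
  shows "unimodal ((srw_step L (cube r) ^^ n) (indicator {0 :: int ^ 'd}))"
proof (induction n)
  case 0
  have "x = 0" if "\<forall>i. \<bar>x $ i\<bar> \<le> \<bar>(0 :: int ^ 'd) $ i\<bar>" for x :: "int ^ 'd"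
    using that by (simp add: vec_eq_iff)
  then show ?case by (auto simp: unimodal_def indicator_def)
next
  case (Suc n)
  have "0 \<le> (srw_step L (cube r) ^^ n) (indicator {0}) a" for a :: "int ^ 'd"
    by (intro srw_pow_nonneg) (use L in auto)
  with Suc show ?case using srw_step_unimodal[OF L] by simp
qed

lemma axis_component: "axis i (c :: int) $ j = (if j = i then c else 0)"
  by (simp add: axis_def)

section \<open>Second differences and comparison functions\<close>

lemma sum_axis_shift:
  fixes w :: "int \<Rightarrow> real"
  shows "(\<Sum>j\<in>UNIV. w ((a + axis i 1 :: int ^ 'd) $ j)) = (\<Sum>j\<in>UNIV. w (a $ j)) + (w (a $ i + 1) - w (a $ i))"
    and "(\<Sum>j\<in>UNIV. w ((a - axis i 1 :: int ^ 'd) $ j)) = (\<Sum>j\<in>UNIV. w (a $ j)) + (w (a $ i - 1) - w (a $ i))"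
  by (subst (1 2) sum.remove[of _ i]; simp add: axis_component)+

lemma sum_second_difference:
  fixes w :: "int \<Rightarrow> real"
  shows "(\<Sum>i\<in>UNIV. (\<Sum>j\<in>UNIV. w ((a + axis i 1 :: int ^ 'd) $ j)) + (\<Sum>j\<in>UNIV. w ((a - axis i 1) $ j)))
     = 2 * real CARD('d) * (\<Sum>j\<in>UNIV. w (a $ j)) + (\<Sum>i\<in>UNIV. w (a $ i + 1) + w (a $ i - 1) - 2 * w (a $ i))"
  unfolding sum_axis_shift by (simp add: sum.distrib sum_subtractf algebra_simps)

lemma coord_second_difference:
  fixes w :: "int \<Rightarrow> real"
  shows "(\<Sum>j\<in>UNIV. w ((a + axis j 1 :: int ^ 'd) $ i) + w ((a - axis j 1) $ i))
     = 2 * real CARD('d) * w (a $ i) + (w (a $ i + 1) + w (a $ i - 1) - 2 * w (a $ i))"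
proof -
  have "w ((a + axis j 1) $ i) + w ((a - axis j 1) $ i) =
     2 * w (a $ i) + (if j = i then w (a $ i + 1) + w (a $ i - 1) - 2 * w (a $ i) else 0)" for j
    by (simp add: axis_component)
  then show ?thesis by (simp add: sum.distrib)
qed

definition sqnorm :: "int ^ 'd \<Rightarrow> real" where "sqnorm a = (\<Sum>j\<in>UNIV. (real_of_int (a $ j))\<^sup>2)"

lemma sqnorm_diff:
  "(\<Sum>i\<in>UNIV. sqnorm (a + axis i 1 :: int ^ 'd) + sqnorm (a - axis i 1)) = 2 * real CARD('d) * sqnorm a + 2 * real CARD('d)"
  unfolding sqnorm_def using sum_second_difference[of "\<lambda>x. (real_of_int x)\<^sup>2" a]
  by (simp add: power2_eq_square algebra_simps)

lemma sqnorm_nonneg: "0 \<le> sqnorm a" unfolding sqnorm_def by (simp add: sum_nonneg)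

lemma sqnorm_ge: "(real_of_int (a $ i))\<^sup>2 \<le> sqnorm a"
  unfolding sqnorm_def by (rule member_le_sum) auto

lemma sqnorm_outside:
  assumes "a \<notin> cube r" shows "(real r)\<^sup>2 \<le> sqnorm a"
proof -
  obtain i where "int r < \<bar>a $ i\<bar>" using assms by (auto simp: cube_iff not_le)
  then have "real r \<le> \<bar>real_of_int (a $ i)\<bar>" by linarith
  then have "(real r)\<^sup>2 \<le> \<bar>real_of_int (a $ i)\<bar>\<^sup>2" by (intro power_mono) auto
  then show ?thesis using sqnorm_ge[of a i] by simp
qed

text \<open>In this and the next bounds the comparison function is non-positive outside the box, so that killing does not affect the induction.\<close>

lemma survival_ge:
  fixes a :: "int ^ 'd"
  assumes L: "2 * real CARD('d) \<le> L" and r: "0 < r"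
  shows "1 - sqnorm a / (real r)\<^sup>2 - 2 * real CARD('d) * real n / (L * (real r)\<^sup>2)
    \<le> (srw_step L (cube r) ^^ n) (indicator (cube r)) a"
proof (induction n arbitrary: a)
  have L0: "0 < L" using L by (smt (verit) of_nat_0_less_iff zero_less_card_finite)
  {
    case 0
    show ?case
      using sqnorm_outside[of a r] sqnorm_nonneg[of a] r by (cases "a \<in> cube r") (auto simp: divide_simps)
  next
    case (Suc n)
    show ?case
    proof (cases "a \<in> cube r")
      case False
      have "1 - sqnorm a / (real r)\<^sup>2 \<le> 0" using sqnorm_outside[OF False] r by (simp add: divide_simps)
      moreover have "0 \<le> 2 * real CARD('d) * real (Suc n) / (L * (real r)\<^sup>2)" using L0 by simp
      ultimately have "1 - sqnorm a / (real r)\<^sup>2 - 2 * real CARD('d) * real (Suc n) / (L * (real r)\<^sup>2) \<le> 0" by linarith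
      also have "0 \<le> (srw_step L (cube r) ^^ Suc n) (indicator (cube r)) a"
        by (intro srw_pow_nonneg L) auto
      finally show ?thesis .
    next
      case True
      let ?c = "1 - 2 * real CARD('d) * real n / (L * (real r)\<^sup>2)"
      have "srw_step L (cube r) (\<lambda>a. 1 - sqnorm a / (real r)\<^sup>2 - 2 * real CARD('d) * real n / (L * (real r)\<^sup>2)) a
        \<le> srw_step L (cube r) ((srw_step L (cube r) ^^ n) (indicator (cube r))) a"
        by (intro srw_step_mono L Suc)
      moreover have "srw_step L (cube r) (\<lambda>a. 1 - sqnorm a / (real r)\<^sup>2 - 2 * real CARD('d) * real n / (L * (real r)\<^sup>2)) a
        = (1 - 2 * real CARD('d) / L) * (?c - sqnorm a / (real r)\<^sup>2) +
          (2 * real CARD('d) * ?c - (\<Sum>i\<in>UNIV. sqnorm (a + axis i 1) + sqnorm (a - axis i 1)) / (real r)\<^sup>2) / L"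
      proof -
        have "(\<Sum>i\<in>UNIV. (1 - sqnorm (a + axis i 1) / (real r)\<^sup>2 - 2 * real CARD('d) * real n / (L * (real r)\<^sup>2)) +
            (1 - sqnorm (a - axis i 1) / (real r)\<^sup>2 - 2 * real CARD('d) * real n / (L * (real r)\<^sup>2)))
          = (\<Sum>i\<in>(UNIV :: 'd set). 2 * ?c - (sqnorm (a + axis i 1) + sqnorm (a - axis i 1)) / (real r)\<^sup>2)"
          by (rule sum.cong) (auto simp: add_divide_distrib)
        also have "\<dots> = 2 * real CARD('d) * ?c - (\<Sum>i\<in>UNIV. sqnorm (a + axis i 1) + sqnorm (a - axis i 1)) / (real r)\<^sup>2"
          unfolding sum_subtractf sum_divide_distrib by simp
        finally show ?thesis using True by (simp add: srw_step_def)
      qed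
      moreover have "\<dots> = 1 - sqnorm a / (real r)\<^sup>2 - 2 * real CARD('d) * real (Suc n) / (L * (real r)\<^sup>2)"
        unfolding sqnorm_diff using L0 r by (simp add: field_simps)
      ultimately show ?thesis by simp
    qed
  }
qed

text \<open>For the free walk the second moment of one coordinate grows by \<open>2 / L\<close> per
  step. The quartic term in \<open>psi\<close>, with \<open>R = r^2\<close>, makes the comparison
  function non-positive outside the box. Its drift per step is
  \<open>24 sqnorm / (L R) + 4 d / (L R)\<close>; the first part is collected in the
  \<open>sqnorm\<close> term of \<open>psi\<close>, whose own drift is quadratic in time and enters
  \<open>B\<close> together with the second part. The number 28 is 4 + 24, the two losses in
  \<open>B\<close> at \<open>1 <= s\<close>.\<close>

lemma second_moment_ge:
  fixes i :: "'d :: finite" and L :: real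
  assumes L: "2 * real CARD('d) \<le> L" and r: "0 < r"
    and s: "s = real n / L" "1 \<le> s" "28 * real CARD('d) * s \<le> (real r)\<^sup>2"
  shows "s \<le> (srw_step L (cube r) ^^ n) (\<lambda>a. if a \<in> cube r then (real_of_int (a $ i))\<^sup>2 else 0) 0"
proof -
  have L0: "0 < L" using L by (smt (verit) of_nat_0_less_iff zero_less_card_finite)
  let ?d = "real CARD('d)" and ?R = "(real r)\<^sup>2"
  have R0: "0 < ?R" using r by simp
  have d1: "1 \<le> ?d" by simp
  define B where "B m = 2 * (real m / L) - 4 * ?d * (real m / L) / ?R - 24 * ?d * (real m / L)\<^sup>2 / ?R" for m
  define quart where "quart a = (\<Sum>j\<in>UNIV. (real_of_int (a $ j)) ^ 4)" for a :: "int ^ 'd"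
  define psi where "psi m a = (real_of_int (a $ i))\<^sup>2 - 2 / ?R * quart a - 24 * real m / (L * ?R) * sqnorm a + B m"
    for m and a :: "int ^ 'd"
  have quart_diff: "(\<Sum>i\<in>UNIV. quart (a + axis i 1) + quart (a - axis i 1)) = 2 * ?d * quart a + 12 * sqnorm a + 2 * ?d" for a
  proof -
    have "(real_of_int (x + 1)) ^ 4 + (real_of_int (x - 1)) ^ 4 - 2 * (real_of_int x) ^ 4 = 12 * (real_of_int x)\<^sup>2 + 2" for x
      by (simp add: power4_eq_xxxx power2_eq_square algebra_simps)
    then show ?thesis
      unfolding quart_def sqnorm_def using sum_second_difference[of "\<lambda>x. (real_of_int x) ^ 4" a]
      by (simp add: sum.distrib sum_distrib_left)
  qed
  have coord: "(\<Sum>j\<in>UNIV. (real_of_int ((a + axis j 1) $ i))\<^sup>2 + (real_of_int ((a - axis j 1) $ i))\<^sup>2)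
     = 2 * ?d * (real_of_int (a $ i))\<^sup>2 + 2" for a :: "int ^ 'd"
    using coord_second_difference[of "\<lambda>x. (real_of_int x)\<^sup>2" a i] by (simp add: power2_eq_square algebra_simps)
  have out: "psi m a \<le> 0" if a: "a \<notin> cube r" and m: "m \<le> n" for m a
  proof -
    obtain j where "int r < \<bar>a $ j\<bar>" using a by (auto simp: cube_iff not_le)
    then have "real r \<le> \<bar>real_of_int (a $ j)\<bar>" by linarith
    then have j: "?R \<le> (real_of_int (a $ j))\<^sup>2" using power_mono[where a="real r" and n=2 and b="\<bar>real_of_int (a $ j)\<bar>"] by simp
    have mL: "real m / L \<le> s" using m L0 s(1) by (simp add: divide_right_mono)
    have "B m \<le> 2 * s"
      using mL R0 L0 unfolding B_def by (smt (verit) divide_nonneg_pos mult_nonneg_nonneg of_nat_0_le_iff zero_le_power2)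
    also have "2 * s \<le> ?R" using s d1 mult_right_mono[of 2 "28 * ?d" s] by linarith
    finally have B: "B m \<le> ?R" .
    \<comment> \<open>Some coordinate \<open>j\<close> has left the box, and its fourth power must
      beat both the square of coordinate \<open>i\<close> and \<open>B m <= R\<close>;
      \<open>j\<close> may or may not be \<open>i\<close>.\<close>
    have key: "?R * ((real_of_int (a $ i))\<^sup>2 + ?R) \<le> 2 * quart a"
    proof (cases "j = i")
      case True
      have "R * (x + R) \<le> 2 * (x * x)" if "0 < R" "R \<le> x" for R x :: real
      proof -
        have "R * (x + R) \<le> x * (x + x)" using that by (intro mult_mono) auto
        then show ?thesis by simp
      qed
      from this[OF R0 j] True have "?R * ((real_of_int (a $ i))\<^sup>2 + ?R) \<le> 2 * (real_of_int (a $ i)) ^ 4"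
        by (simp add: power2_eq_square power4_eq_xxxx mult.assoc)
      also have "(real_of_int (a $ i)) ^ 4 \<le> quart a" unfolding quart_def by (rule member_le_sum) auto
      finally show ?thesis by simp
    next
      case False
      have "(\<Sum>k\<in>{i,j}. (real_of_int (a $ k)) ^ 4) \<le> quart a"
        unfolding quart_def by (rule sum_mono2) auto
      then have q: "(real_of_int (a $ i)) ^ 4 + (real_of_int (a $ j)) ^ 4 \<le> quart a" using False by simp
      have "R * (x + R) \<le> 2 * (x * x + y * y)" if "0 < R" "R \<le> y" for R x y :: real
      proof -
        have "R * R \<le> y * y" using that by (intro mult_mono) auto
        moreover have "2 * (R * x) \<le> x * x + R * R"
          using zero_le_square[of "x - R"] by (simp add: algebra_simps)
        moreover have "0 \<le> x * x" "0 \<le> y * y" by simp_all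
        ultimately show ?thesis unfolding distrib_left by linarith
      qed
      from this[OF R0 j, of "(real_of_int (a $ i))\<^sup>2"]
      have "?R * ((real_of_int (a $ i))\<^sup>2 + ?R) \<le> 2 * ((real_of_int (a $ i)) ^ 4 + (real_of_int (a $ j)) ^ 4)"
        by (simp add: power2_eq_square power4_eq_xxxx mult.assoc)
      also have "\<dots> \<le> 2 * quart a" using q by simp
      finally show ?thesis .
    qed
    then have "(real_of_int (a $ i))\<^sup>2 + ?R \<le> 2 / ?R * quart a" using R0 by (simp add: pos_le_divide_eq mult.commute)
    moreover have "0 \<le> 24 * real m / (L * ?R) * sqnorm a" using L0 sqnorm_nonneg[of a] by simp
    ultimately show ?thesis unfolding psi_def using B by linarith
  qed
  have step: "psi (Suc m) a \<le> (1 - 2 * ?d / L) * psi m a + (\<Sum>j\<in>UNIV. psi m (a + axis j 1) + psi m (a - axis j 1)) / L" for m a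
  proof -
    let ?A = "24 * real m / (L * ?R)"
    have "(\<Sum>j\<in>UNIV. psi m (a + axis j 1) + psi m (a - axis j 1)) =
        (\<Sum>j\<in>UNIV. (real_of_int ((a + axis j 1) $ i))\<^sup>2 + (real_of_int ((a - axis j 1) $ i))\<^sup>2)
        - 2 / ?R * (\<Sum>j\<in>UNIV. quart (a + axis j 1) + quart (a - axis j 1))
        - ?A * (\<Sum>j\<in>UNIV. sqnorm (a + axis j 1) + sqnorm (a - axis j 1)) + 2 * ?d * B m"
    proof -
      have "(\<Sum>j\<in>(UNIV :: 'd set). (p j - k * q j - l * t j + c) + (p' j - k * q' j - l * t' j + c)) =
         (\<Sum>j\<in>UNIV. p j + p' j) - k * (\<Sum>j\<in>UNIV. q j + q' j) - l * (\<Sum>j\<in>UNIV. t j + t' j) + 2 * ?d * c"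
        for p p' q q' t t' :: "'d \<Rightarrow> real" and k l c :: real
        by (simp add: sum.distrib sum_subtractf sum_distrib_left algebra_simps)
      then show ?thesis unfolding psi_def by (simp only: times_divide_eq_left[symmetric])
    qed
    also have "\<dots> = 2 * ?d * psi m a + (2 - 2 / ?R * (12 * sqnorm a + 2 * ?d) - ?A * (2 * ?d))"
    proof -
      have "2 * d * P + 2 - k * (2 * d * q + 12 * t + 2 * d) - A * (2 * d * t + 2 * d) + 2 * d * b
         = 2 * d * (P - k * q - A * t + b) + (2 - k * (12 * t + 2 * d) - A * (2 * d))"
        for d P k q t A b :: real by (simp add: algebra_simps)
      then show ?thesis unfolding coord quart_diff sqnorm_diff psi_def .
    qed
    finally have sum: "(\<Sum>j\<in>UNIV. psi m (a + axis j 1) + psi m (a - axis j 1)) =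
       2 * ?d * psi m a + (2 - 2 / ?R * (12 * sqnorm a + 2 * ?d) - ?A * (2 * ?d))" .
    have "(1 - 2 * ?d / L) * p + (2 * ?d * p + x) / L = p + x / L" for p x
      using L0 by (simp add: field_simps)
    then have "(1 - 2 * ?d / L) * psi m a + (\<Sum>j\<in>UNIV. psi m (a + axis j 1) + psi m (a - axis j 1)) / L
       = psi m a + (2 - 2 / ?R * (12 * sqnorm a + 2 * ?d) - ?A * (2 * ?d)) / L"
      unfolding sum .
    moreover have "psi (Suc m) a = psi m a - 24 / (L * ?R) * sqnorm a + (B (Suc m) - B m)"
    proof -
      have "p - x - 24 * real (Suc m) / c * y + b' = p - x - 24 * real m / c * y + b - 24 / c * y + (b' - b)"
        for p x c y b b' :: real by (simp add: algebra_simps add_divide_distrib)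
      then show ?thesis unfolding psi_def .
    qed
    moreover have "B (Suc m) - B m = 2 / L - 4 * ?d / (L * ?R) - 24 * ?d * (2 * real m + 1) / (L\<^sup>2 * ?R)"
    proof -
      have "2 * ((m + 1) / L) - 4 * d * ((m + 1) / L) / R - 24 * d * ((m + 1) / L)\<^sup>2 / R
          - (2 * (m / L) - 4 * d * (m / L) / R - 24 * d * (m / L)\<^sup>2 / R)
         = 2 / L - 4 * d / (L * R) - 24 * d * (2 * m + 1) / (L\<^sup>2 * R)" if "R \<noteq> 0" for d m R :: real
        using L0 that by (simp add: field_simps power2_eq_square)
      from this[of ?R "real m" ?d] R0 show ?thesis unfolding B_def by (simp add: add.commute)
    qed
    moreover have "(2 - 2 / ?R * (12 * sqnorm a + 2 * ?d) - ?A * (2 * ?d)) / L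
       = 2 / L - 24 / (L * ?R) * sqnorm a - 4 * ?d / (L * ?R) - 48 * ?d * real m / (L\<^sup>2 * ?R)"
    proof -
      have "(2 - 2 / R * (12 * q + 2 * d) - 24 * m / (L * R) * (2 * d)) / L
         = 2 / L - 24 / (L * R) * q - 4 * d / (L * R) - 48 * d * m / (L\<^sup>2 * R)" if "R \<noteq> 0" for d m q R :: real
        using L0 that by (simp add: field_simps power2_eq_square)
      from this[of ?R] R0 show ?thesis by simp
    qed
    \<comment> \<open>The increment of the quadratic loss in \<open>B\<close> exceeds the drift of
      the \<open>sqnorm\<close> term, \<open>2 m + 1\<close> against \<open>2 m\<close>; only here
      is equality lost.\<close>
    moreover have "48 * ?d * real m / (L\<^sup>2 * ?R) \<le> 24 * ?d * (2 * real m + 1) / (L\<^sup>2 * ?R)"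
      using L0 R0 by (intro divide_right_mono) (auto simp: algebra_simps)
    ultimately show ?thesis by linarith
  qed
  let ?f = "\<lambda>a :: int ^ 'd. if a \<in> cube r then (real_of_int (a $ i))\<^sup>2 else 0"
  have "psi m a \<le> (srw_step L (cube r) ^^ m) ?f a" if "m \<le> n" for m a
    using that
  proof (induction m arbitrary: a)
    case 0
    have "0 \<le> quart a" unfolding quart_def by (intro sum_nonneg) auto
    then show ?case using out[of a 0] R0 by (auto simp: psi_def B_def)
  next
    case (Suc m)
    show ?case
    proof (cases "a \<in> cube r")
      case False
      have "0 \<le> (srw_step L (cube r) ^^ Suc m) ?f a" by (intro srw_pow_nonneg L) auto
      then show ?thesis using out[OF False Suc.prems] by linarith
    next
      case True
      have "psi (Suc m) a \<le> srw_step L (cube r) (psi m) a" using step[of m a] True by (simp add: srw_step_def)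
      also have "\<dots> \<le> srw_step L (cube r) ((srw_step L (cube r) ^^ m) ?f) a"
        using Suc by (intro srw_step_mono L) auto
      finally show ?thesis by simp
    qed
  qed
  from this[of n 0] have "B n \<le> (srw_step L (cube r) ^^ n) ?f 0"
    by (simp add: psi_def quart_def sqnorm_def)
  moreover have "s \<le> B n"
  proof -
    have "4 * ?d * s / ?R + 24 * ?d * s\<^sup>2 / ?R \<le> s"
    proof -
      have "4 * ?d + 24 * ?d * s \<le> 28 * ?d * s" using s(2) d1 by (simp add: mult_le_cancel_left1)
      then have "(4 * ?d + 24 * ?d * s) * s \<le> ?R * s" using s(2,3) by (intro mult_right_mono) linarith+
      then have "(4 * ?d + 24 * ?d * s) * s / ?R \<le> s" using R0 by (simp only: pos_divide_le_eq mult.commute)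
      moreover have "4 * d * s / R + 24 * d * s\<^sup>2 / R = (4 * d + 24 * d * s) * s / R" for d R :: real
        by (simp add: algebra_simps add_divide_distrib power2_eq_square)
      ultimately show ?thesis by simp
    qed
    then show ?thesis unfolding B_def s(1)[symmetric] by linarith
  qed
  ultimately show ?thesis by linarith
qed

lemma srw_pow_indicator_le_1:
  fixes L :: real and a :: "int ^ 'd"
  assumes L: "2 * real CARD('d) \<le> L"
  shows "(srw_step L D ^^ n) (indicator D) a \<le> 1"
proof (induction n arbitrary: a)
  case (Suc n)
  have L0: "0 < L" using L by (smt (verit) of_nat_0_less_iff zero_less_card_finite)
  have "srw_step L D ((srw_step L D ^^ n) (indicator D)) a \<le> srw_step L D (\<lambda>_. 1) a"
    by (intro srw_step_mono L Suc)
  also have "\<dots> \<le> 1" using L0 by (simp add: srw_step_def)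
  finally show ?case by simp
qed auto

lemma mass_le_1:
  fixes L :: real
  assumes L: "2 * real CARD('d) \<le> L"
  shows "(\<Sum>a\<in>cube r. (srw_step L (cube r) ^^ n) (indicator {0 :: int ^ 'd}) a) \<le> 1"
proof -
  have "(srw_step L (cube r) ^^ n) (indicator (cube r)) (0 :: int ^ 'd) =
     (\<Sum>a\<in>cube r. (srw_step L (cube r) ^^ n) (indicator {0 :: int ^ 'd}) a * indicator (cube r) a)"
    by (rule srw_pow_at_0) (auto simp: card_cube(1))
  also have "\<dots> = (\<Sum>a\<in>cube r. (srw_step L (cube r) ^^ n) (indicator {0 :: int ^ 'd}) a)"
    by (rule sum.cong) auto
  finally show ?thesis using srw_pow_indicator_le_1[OF L, of n "cube r" 0] by simp
qed

text \<open>The mass is at most 1, so sites with \<open>|a $ i| <= K\<close> carry at most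
  \<open>K^2 <= s / 2\<close> of the second moment \<open>s\<close>. Some site of the box beyond
  them therefore has mass at least \<open>s / 2\<close>, divided by \<open>r^2\<close> and by the
  number of sites. By unimodality \<open>axis i k\<close>, whose other coordinates are 0, has at
  least as much.\<close>

lemma move_ge:
  fixes i :: "'d :: finite" and L :: real
  assumes L: "3 * real CARD('d) \<le> L" and r: "0 < r"
    and s: "s = real n / L" "1 \<le> s" "28 * real CARD('d) * s \<le> (real r)\<^sup>2"
    and K: "2 * (real K)\<^sup>2 \<le> s" "\<bar>k\<bar> \<le> int K"
  shows "s / (2 * (real r)\<^sup>2 * (2 * real r + 1) ^ CARD('d)) \<le> (srw_step L (cube r) ^^ n) (indicator {0}) (axis i k)"
proof -
  let ?u = "(srw_step L (cube r) ^^ n) (indicator {0 :: int ^ 'd})"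
  let ?R = "(real r)\<^sup>2" and ?C = "(2 * real r + 1) ^ CARD('d)"
  have L2: "2 * real CARD('d) \<le> L" using L by linarith
  have u0: "0 \<le> ?u a" for a by (intro srw_pow_nonneg L2) auto
  have C: "real (card (cube r :: (int ^ 'd) set)) = ?C" by (simp add: card_cube(2) add.commute)
  have R0: "0 < ?R" using r by simp
  have C0: "0 < ?C" by simp
  let ?sq = "\<lambda>a :: int ^ 'd. (real_of_int (a $ i))\<^sup>2"
  have "s \<le> (srw_step L (cube r) ^^ n) (\<lambda>a. if a \<in> cube r then ?sq a else 0) 0"
    by (rule second_moment_ge[OF L2 r s])
  also have "\<dots> = (\<Sum>a\<in>cube r. ?u a * (if a \<in> cube r then ?sq a else 0))"
    by (rule srw_pow_at_0) (auto simp: card_cube(1))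
  also have "\<dots> = (\<Sum>a\<in>cube r. ?u a * ?sq a)" by (rule sum.cong) auto
  finally have M: "s \<le> (\<Sum>a\<in>cube r. ?u a * ?sq a)" .
  have "s / 2 \<le> s - (real K)\<^sup>2 * 1" using K by simp
  also have "\<dots> \<le> (\<Sum>a\<in>cube r. ?u a * ?sq a) - (real K)\<^sup>2 * (\<Sum>a\<in>cube r. ?u a)"
    using M mass_le_1[OF L2, of n r] by (intro diff_mono mult_left_mono) auto
  also have "\<dots> = (\<Sum>a\<in>cube r. ?u a * (?sq a - (real K)\<^sup>2))"
    by (simp add: sum_distrib_left sum_subtractf algebra_simps)
  finally have S: "s / 2 \<le> (\<Sum>a\<in>cube r. ?u a * (?sq a - (real K)\<^sup>2))" .
  have "\<exists>a\<in>cube r. s / 2 / ?C \<le> ?u a * (?sq a - (real K)\<^sup>2)"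
  proof (rule ccontr)
    assume "\<not> ?thesis"
    then have "(\<Sum>a\<in>cube r. ?u a * (?sq a - (real K)\<^sup>2)) < (\<Sum>a\<in>(cube r :: (int ^ 'd) set). s / 2 / ?C)"
      by (intro sum_strict_mono) (auto simp: card_cube(1) not_le intro: zero_in_cube)
    also have "\<dots> = s / 2" using C C0 by simp
    finally show False using S by simp
  qed
  then obtain a where a: "a \<in> cube r" "s / 2 / ?C \<le> ?u a * (?sq a - (real K)\<^sup>2)" by blast
  have "0 < s / 2 / ?C" using s(2) by simp
  with a(2) have "0 < ?u a * (?sq a - (real K)\<^sup>2)" by linarith
  with u0[of a] have "(real K)\<^sup>2 < ?sq a" by (smt (verit) mult_nonneg_nonpos)
  then have "real K < \<bar>real_of_int (a $ i)\<bar>" using abs_le_square_iff[of "real_of_int (a $ i)" "real K"] by linarith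
  then have Ka: "int K < \<bar>a $ i\<bar>" by linarith
  have "?u a * (?sq a - (real K)\<^sup>2) \<le> ?u a * ?R"
  proof -
    have "\<bar>real_of_int (a $ i)\<bar> \<le> real r" using a(1) by (simp add: cube_iff) (metis of_int_abs of_int_le_iff of_int_of_nat_eq)
    then have "?sq a \<le> ?R" using power_mono[of "\<bar>real_of_int (a $ i)\<bar>" "real r" 2] by simp
    then have "?sq a - (real K)\<^sup>2 \<le> ?R" by (smt (verit) zero_le_power2)
    then show ?thesis by (rule mult_left_mono[OF _ u0])
  qed
  with a(2) have "s / 2 / ?C \<le> ?u a * ?R" by linarith
  then have "s / 2 / ?C / ?R \<le> ?u a" using R0 by (simp only: pos_divide_le_eq)
  then have "s / (2 * ?R * ?C) \<le> ?u a" by (simp add: mult_ac)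
  also have "?u a \<le> ?u (axis i k)"
    using srw_pow_unimodal[OF L, where r=r and n=n] Ka K(2) by (auto simp: unimodal_def axis_component)
  finally show ?thesis .
qed

text \<open>
  The function \<open>phi\<close> in the proof is the Huber function: convex, quadratic for \<open>\<bar>x\<bar> < K\<close> and linear
  outside. Its growth along the walk counts the time spent in the strip.
\<close>

lemma occupation_le:
  fixes i :: "'d :: finite" and L :: real
  assumes L: "2 * real CARD('d) \<le> L" and eta: "0 < \<eta>"
  shows "(\<Sum>v<n. (srw_step L D ^^ v) (\<lambda>a. if a \<in> D \<and> \<bar>a $ i\<bar> < int K then 1 else 0) 0)
    \<le> \<eta> * real n + L * (real K)\<^sup>2 / (2 * \<eta>)"
proof -
  have L0: "0 < L" using L by (smt (verit) of_nat_0_less_iff zero_less_card_finite)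
  define phi :: "int \<Rightarrow> real" where "phi x = (if \<bar>x\<bar> < int K then (real_of_int x)\<^sup>2 else 2 * real K * \<bar>real_of_int x\<bar> - (real K)\<^sup>2)" for x
  have sq: "2 * real K * \<bar>x\<bar> - (real K)\<^sup>2 \<le> x\<^sup>2" for x :: real
    using zero_le_power2[of "\<bar>x\<bar> - real K"] by (simp add: power2_diff algebra_simps)
  have phi_ge: "2 * real K * \<bar>real_of_int x\<bar> - (real K)\<^sup>2 \<le> phi x" for x
    unfolding phi_def using sq[of "real_of_int x"] by simp
  have phi_le: "phi x \<le> \<eta> * (real_of_int x)\<^sup>2 + (real K)\<^sup>2 / \<eta>" for x
  proof -
    have "phi x \<le> 2 * real K * \<bar>real_of_int x\<bar>"
    proof (cases "\<bar>x\<bar> < int K")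
      case True
      then have "\<bar>real_of_int x\<bar> \<le> 2 * real K" by linarith
      then have "\<bar>real_of_int x\<bar> * \<bar>real_of_int x\<bar> \<le> 2 * real K * \<bar>real_of_int x\<bar>" by (intro mult_right_mono) auto
      then show ?thesis using True by (simp add: phi_def power2_eq_square)
    qed (simp add: phi_def)
    also have "\<dots> \<le> \<eta> * (real_of_int x)\<^sup>2 + (real K)\<^sup>2 / \<eta>"
    proof -
      have "0 \<le> (\<eta> * \<bar>real_of_int x\<bar> - real K)\<^sup>2 / \<eta>" using eta by simp
      also have "\<dots> = \<eta> * (real_of_int x)\<^sup>2 + (real K)\<^sup>2 / \<eta> - 2 * real K * \<bar>real_of_int x\<bar>"
        using eta by (simp add: power2_diff field_simps power2_eq_square)
      finally show ?thesis by linarith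
    qed
    finally show ?thesis .
  qed
  have phi_diff: "(if \<bar>x\<bar> < int K then 2 else 0) \<le> phi (x + 1) + phi (x - 1) - 2 * phi x" for x
  proof (cases "\<bar>x\<bar> < int K")
    case True
    have *: "(real_of_int y)\<^sup>2 \<le> phi y" if "\<bar>y\<bar> \<le> int K" for y
    proof (cases "\<bar>y\<bar> < int K")
      case False
      with that have K: "real K = \<bar>real_of_int y\<bar>" by linarith
      have "phi y = 2 * real K * \<bar>real_of_int y\<bar> - (real K)\<^sup>2" using False by (simp add: phi_def)
      then show ?thesis unfolding K by (simp add: power2_eq_square)
    qed (simp add: phi_def)
    have "(real_of_int (x + 1))\<^sup>2 \<le> phi (x + 1)" "(real_of_int (x - 1))\<^sup>2 \<le> phi (x - 1)"
      by (rule *, use True in linarith)+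
    moreover have "phi x = (real_of_int x)\<^sup>2" using True by (simp add: phi_def)
    ultimately show ?thesis using True by (simp add: power2_eq_square algebra_simps)
  next
    case False
    have "2 * real K * \<bar>real_of_int (x + 1)\<bar> + 2 * real K * \<bar>real_of_int (x - 1)\<bar> \<ge> 2 * (2 * real K * \<bar>real_of_int x\<bar>)"
    proof -
      have "2 * \<bar>real_of_int x\<bar> \<le> \<bar>real_of_int (x + 1)\<bar> + \<bar>real_of_int (x - 1)\<bar>" by linarith
      from mult_left_mono[OF this, of "2 * real K"] show ?thesis by (simp add: algebra_simps)
    qed
    then show ?thesis using phi_ge[of "x + 1"] phi_ge[of "x - 1"] False by (simp add: phi_def)
  qed
  let ?f = "\<lambda>a. if a \<in> D \<and> \<bar>a $ i\<bar> < int K then 1 else (0 :: real)"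
  \<comment> \<open>Chosen so that \<open>Phi (Suc m)\<close> exceeds a step of \<open>Phi m\<close>
    by half the second difference of \<open>phi\<close>, which is at least 1 in the strip and
    non-negative elsewhere. The quadratic term keeps \<open>Phi\<close> non-negative, so killing
    only helps.\<close>
  define Phi where "Phi m a = L / 2 * (\<eta> * ((real_of_int (a $ i))\<^sup>2 + 2 * real m / L) + (real K)\<^sup>2 / \<eta> - phi (a $ i))"
    for m and a :: "int ^ 'd"
  have Phi0: "0 \<le> Phi m a" for m a
  proof -
    have "0 \<le> \<eta> * (2 * real m / L)" using L0 eta by simp
    then have "0 \<le> \<eta> * ((real_of_int (a $ i))\<^sup>2 + 2 * real m / L) + (real K)\<^sup>2 / \<eta> - phi (a $ i)"
      using phi_le[of "a $ i"] unfolding distrib_left by linarith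
    then show ?thesis unfolding Phi_def using L0 by (intro mult_nonneg_nonneg) auto
  qed
  have "(\<Sum>v<m. (srw_step L D ^^ v) ?f a) \<le> Phi m a" for m a
  proof (induction m arbitrary: a)
    case (Suc m)
    have "(\<Sum>v<Suc m. (srw_step L D ^^ v) ?f a) = ?f a + srw_step L D (\<lambda>a. \<Sum>v<m. (srw_step L D ^^ v) ?f a) a"
      by (subst srw_step_sum) (simp add: sum.lessThan_Suc_shift del: sum.lessThan_Suc)
    also have "\<dots> \<le> ?f a + srw_step L D (Phi m) a"
      using Suc by (intro add_left_mono srw_step_mono L) auto
    also have "\<dots> \<le> Phi (Suc m) a"
    proof (cases "a \<in> D")
      case False then show ?thesis using Phi0[of "Suc m" a] by (simp add: srw_step_def)
    next
      case True
      define w where "w x = L / 2 * (\<eta> * ((real_of_int x)\<^sup>2 + 2 * real m / L) + (real K)\<^sup>2 / \<eta> - phi x)" for x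
      have w: "Phi m b = w (b $ i)" for b by (simp add: Phi_def w_def)
      have "(\<Sum>j\<in>UNIV. Phi m (a + axis j 1) + Phi m (a - axis j 1)) =
          2 * real CARD('d) * Phi m a + (w (a $ i + 1) + w (a $ i - 1) - 2 * w (a $ i))"
        unfolding w by (rule coord_second_difference)
      also have "w (a $ i + 1) + w (a $ i - 1) - 2 * w (a $ i) =
          L / 2 * (2 * \<eta> - (phi (a $ i + 1) + phi (a $ i - 1) - 2 * phi (a $ i)))"
        unfolding w_def by (simp add: power2_eq_square algebra_simps)
      finally have sum: "(\<Sum>j\<in>UNIV. Phi m (a + axis j 1) + Phi m (a - axis j 1)) =
          2 * real CARD('d) * Phi m a + L / 2 * (2 * \<eta> - (phi (a $ i + 1) + phi (a $ i - 1) - 2 * phi (a $ i)))" .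
      have "(1 - 2 * d / L) * p + (2 * d * p + L / 2 * x) / L = p + x / 2" for d p x
        using L0 by (simp add: field_simps)
      then have "srw_step L D (Phi m) a = Phi m a + (2 * \<eta> - (phi (a $ i + 1) + phi (a $ i - 1) - 2 * phi (a $ i))) / 2"
        using True by (simp only: srw_step_def sum if_True)
      moreover have "Phi (Suc m) a = Phi m a + \<eta>"
        unfolding Phi_def using L0 by (simp add: field_simps)
      moreover have "2 * ?f a \<le> phi (a $ i + 1) + phi (a $ i - 1) - 2 * phi (a $ i)"
        using phi_diff[of "a $ i"] by (auto split: if_splits)
      moreover have "x + y \<le> z" if "y = p + (2 * \<eta> - w) / 2" "z = p + \<eta>" "2 * x \<le> w" for x y z p w :: real
        using that by (simp add: field_simps)
      ultimately show ?thesis by blast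
    qed
    finally show ?case .
  qed (use Phi0 in simp)
  from this[where m=n and a=0] have "(\<Sum>v<n. (srw_step L D ^^ v) ?f 0) \<le> Phi n 0" .
  also have "\<dots> \<le> \<eta> * real n + L * (real K)\<^sup>2 / (2 * \<eta>)"
  proof -
    have "phi 0 = 0" by (simp add: phi_def)
    then have "Phi n 0 = L / 2 * (\<eta> * (2 * real n / L) + (real K)\<^sup>2 / \<eta>)" by (simp add: Phi_def)
    also have "\<dots> = \<eta> * real n + L * (real K)\<^sup>2 / (2 * \<eta>)" using L0 eta by (simp add: distrib_left)
    finally show ?thesis by simp
  qed
  finally show ?thesis .
qed

text \<open>
  The strips \<open>\<bar>a $ i\<bar> < K\<close> carry at most half of the occupation time, so the Green function is large
  at some point outside of all of them, and by unimodality everywhere in \<open>cube K\<close>.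
\<close>

lemma green_ge:
  fixes L :: real and y :: "int ^ 'd"
  assumes L: "3 * real CARD('d) \<le> L" and n: "0 < n" and R: "0 < R" "4 * real CARD('d) * real n \<le> L * (real R)\<^sup>2"
    and K: "32 * (real CARD('d))\<^sup>2 * L * (real K)\<^sup>2 \<le> real n" and y: "y \<in> cube K"
  shows "real n / (4 * (2 * real R + 1) ^ CARD('d)) \<le> (\<Sum>v<n. (srw_step L (cube R) ^^ v) (indicator {0}) y)"
proof -
  have L2: "2 * real CARD('d) \<le> L" using L by linarith
  have L0: "0 < L" using L by (smt (verit) of_nat_0_less_iff zero_less_card_finite)
  let ?d = "real CARD('d)" and ?C = "(2 * real R + 1) ^ CARD('d)"
  let ?D = "cube R :: (int ^ 'd) set"
  have d0: "0 < ?d" by simp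
  have C: "real (card ?D) = ?C" by (simp add: card_cube(2) add.commute)
  have C0: "0 < ?C" by simp
  define u where "u v = (srw_step L ?D ^^ v) (indicator {0 :: int ^ 'd})" for v
  define g where "g a = (\<Sum>v<n. u v a)" for a
  have at0: "(\<Sum>a\<in>?D. g a * f a) = (\<Sum>v<n. (srw_step L ?D ^^ v) f 0)" if "\<And>a. a \<notin> ?D \<Longrightarrow> f a = 0" for f
  proof -
    have "(\<Sum>v<n. (srw_step L ?D ^^ v) f 0) = (\<Sum>v<n. \<Sum>a\<in>?D. u v a * f a)"
      unfolding u_def using that by (intro sum.cong refl srw_pow_at_0) (auto simp: card_cube(1))
    also have "\<dots> = (\<Sum>a\<in>?D. g a * f a)"
      unfolding g_def sum_distrib_right by (rule sum.swap)
    finally show ?thesis by simp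
  qed
  have g0: "0 \<le> g a" for a
    unfolding g_def u_def by (intro sum_nonneg srw_pow_nonneg L2) auto
  have "real n / 2 \<le> (\<Sum>v<n. (srw_step L ?D ^^ v) (indicator ?D) 0)"
  proof -
    have "1 / 2 \<le> (srw_step L ?D ^^ v) (indicator ?D) 0" if "v < n" for v
    proof -
      have "4 * ?d * real v \<le> 4 * ?d * real n" using that by (intro mult_left_mono) auto
      then have "4 * ?d * real v \<le> L * (real R)\<^sup>2" using R(2) by linarith
      then have "2 * ?d * real v / (L * (real R)\<^sup>2) \<le> 1 / 2"
        using R L0 by (simp add: pos_divide_le_eq)
      moreover have "sqnorm (0 :: int ^ 'd) = 0" by (simp add: sqnorm_def)
      ultimately show ?thesis using survival_ge[OF L2 R(1), of "0 :: int ^ 'd" v] by simp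
    qed
    then have "(\<Sum>v<n. 1 / 2) \<le> (\<Sum>v<n. (srw_step L ?D ^^ v) (indicator ?D) (0 :: int ^ 'd))"
      by (intro sum_mono) auto
    then show ?thesis by simp
  qed
  also have "\<dots> = (\<Sum>a\<in>?D. g a)"
    using at0[of "indicator ?D"] by simp
  finally have tot: "real n / 2 \<le> (\<Sum>a\<in>?D. g a)" .
  have occ: "(\<Sum>a\<in>?D. if \<bar>a $ i\<bar> < int K then g a else 0) \<le> real n / (4 * ?d)" for i :: 'd
  proof -
    let ?f = "\<lambda>a. if a \<in> ?D \<and> \<bar>a $ i\<bar> < int K then 1 else (0 :: real)"
    have "(\<Sum>a\<in>?D. if \<bar>a $ i\<bar> < int K then g a else 0) = (\<Sum>a\<in>?D. g a * ?f a)"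
      by (rule sum.cong) auto
    also have "\<dots> = (\<Sum>v<n. (srw_step L ?D ^^ v) ?f 0)" by (rule at0) auto
    \<comment> \<open>With \<open>\<eta> = 1 / (8 d)\<close> each of the \<open>d\<close> strips
      gets at most \<open>n / (4 d)\<close>, together \<open>n / 4\<close>, half of the lower bound
      for the total.\<close>
    also have "\<dots> \<le> 1 / (8 * ?d) * real n + L * (real K)\<^sup>2 / (2 * (1 / (8 * ?d)))"
      by (rule occupation_le[OF L2]) simp
    also have "\<dots> = (real n + 32 * ?d\<^sup>2 * L * (real K)\<^sup>2) / (8 * ?d)"
      using d0 by (simp add: field_simps power2_eq_square)
    also have "\<dots> \<le> (real n + real n) / (8 * ?d)"
      using K d0 by (intro divide_right_mono) auto
    also have "\<dots> = real n / (4 * ?d)" by simp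
    finally show ?thesis .
  qed
  let ?h = "\<lambda>a :: int ^ 'd. if \<forall>i. int K \<le> \<bar>a $ i\<bar> then g a else 0"
  have "(\<Sum>a\<in>?D. g a) \<le> (\<Sum>a\<in>?D. ?h a + (\<Sum>i\<in>UNIV. if \<bar>a $ i\<bar> < int K then g a else 0))"
  proof (rule sum_mono)
    fix a :: "int ^ 'd"
    show "g a \<le> ?h a + (\<Sum>i\<in>UNIV. if \<bar>a $ i\<bar> < int K then g a else 0)"
    proof (cases "\<forall>i. int K \<le> \<bar>a $ i\<bar>")
      case True then show ?thesis using g0[of a] by (simp add: sum_nonneg)
    next
      case False
      then obtain j where j: "\<bar>a $ j\<bar> < int K" by (auto simp: not_le)
      have "(if \<bar>a $ j\<bar> < int K then g a else 0) \<le> (\<Sum>i\<in>UNIV. if \<bar>a $ i\<bar> < int K then g a else 0)"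
        by (rule member_le_sum) (use g0[of a] in auto)
      with False j show ?thesis by auto
    qed
  qed
  also have "\<dots> = (\<Sum>a\<in>?D. ?h a) + (\<Sum>i\<in>UNIV. \<Sum>a\<in>?D. if \<bar>a $ i\<bar> < int K then g a else 0)"
    unfolding sum.distrib by (subst sum.swap) simp
  also have "\<dots> \<le> (\<Sum>a\<in>?D. ?h a) + (\<Sum>i\<in>(UNIV :: 'd set). real n / (4 * ?d))"
    using occ by (intro add_left_mono sum_mono) auto
  also have "(\<Sum>i\<in>(UNIV :: 'd set). real n / (4 * ?d)) = real n / 4" by simp
  finally have H: "real n / 4 \<le> (\<Sum>a\<in>?D. ?h a)" using tot by linarith
  have "\<exists>a\<in>?D. real n / 4 / ?C \<le> ?h a"
  proof (rule ccontr)
    assume neg: "\<not> ?thesis"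
    have "(\<Sum>a\<in>?D. ?h a) < (\<Sum>a\<in>?D. real n / 4 / ?C)"
    proof (rule sum_strict_mono)
      show "finite ?D" by (rule card_cube(1))
      show "?D \<noteq> {}" using zero_in_cube by blast
      show "?h a < real n / 4 / ?C" if "a \<in> ?D" for a
        using neg that not_le by blast
    qed
    also have "\<dots> = real n / 4" using C C0 by simp
    finally show False using H by simp
  qed
  then obtain a where a: "real n / 4 / ?C \<le> ?h a" by blast
  have pos: "0 < real n / 4 / ?C" using n C0 by simp
  have K: "\<forall>i. int K \<le> \<bar>a $ i\<bar>"
  proof (rule ccontr)
    assume "\<not> ?thesis"
    then have "?h a = 0" by (rule if_not_P)
    with a pos show False by linarith
  qed
  then have "?h a = g a" by (rule if_P)
  with a have "real n / (4 * ?C) \<le> g a" by (simp only: divide_divide_eq_left)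
  also have "g a \<le> g y"
    unfolding g_def u_def
  proof (rule sum_mono)
    fix v
    show "(srw_step L ?D ^^ v) (indicator {0}) a \<le> (srw_step L ?D ^^ v) (indicator {0}) y"
      using srw_pow_unimodal[OF L, where r=R and n=v] K y
      unfolding unimodal_def cube_iff by (meson order_trans)
  qed
  finally show ?thesis unfolding g_def u_def .
qed

section \<open>The uniformized layered walk\<close>

text \<open>Only the second coordinate is confined to \<open>D\<close>, and the rates do not depend
  on \<open>k\<close>. Hence the step commutes with shifts of \<open>k\<close>, and summing over
  \<open>k\<close> leaves \<open>srw_step\<close>.\<close>

definition lay_step :: "(int ^ 'd \<Rightarrow> real) \<Rightarrow> real \<Rightarrow> (int ^ 'd) set \<Rightarrow> (int \<Rightarrow> int ^ 'd \<Rightarrow> real) \<Rightarrow> int \<Rightarrow> int ^ 'd \<Rightarrow> real" where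
  "lay_step z L D F k a = (if a \<in> D then (1 - (2 * z a + 2 * real CARD('d)) / L) * F k a
     + z a / L * (F (k + 1) a + F (k - 1) a)
     + (\<Sum>i\<in>UNIV. F k (a + axis i 1) + F k (a - axis i 1)) / L else 0)"

lemma lay_step_cmult: "lay_step z L D (\<lambda>k a. c * F k a) = (\<lambda>k a. c * lay_step z L D F k a)"
  by (intro ext) (auto simp: lay_step_def sum_distrib_left distrib_left mult_ac)

lemma lay_pow_cmult: "(lay_step z L D ^^ n) (\<lambda>k a. c * F k a) = (\<lambda>k a. c * (lay_step z L D ^^ n) F k a)"
  by (induction n) (auto simp: lay_step_cmult)

lemma lay_step_shift: "lay_step z L D (\<lambda>k. F (k + m)) = (\<lambda>k. lay_step z L D F (k + m))"
proof (intro ext)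
  fix k a
  have "k + 1 + m = k + m + 1" "k - 1 + m = k + m - 1" by auto
  then show "lay_step z L D (\<lambda>k. F (k + m)) k a = lay_step z L D F (k + m) a"
    by (simp only: lay_step_def)
qed

lemma lay_pow_shift: "(lay_step z L D ^^ n) (\<lambda>k. F (k + m)) = (\<lambda>k. (lay_step z L D ^^ n) F (k + m))"
  by (induction n) (simp_all add: lay_step_shift)

lemma lay_pow_support:
  "(\<And>k a. 0 < \<bar>k\<bar> \<Longrightarrow> F k a = 0) \<Longrightarrow> int n < \<bar>k\<bar> \<Longrightarrow> (lay_step z L D ^^ n) F k a = 0"
proof (induction n arbitrary: k a)
  case (Suc n)
  then have "(lay_step z L D ^^ n) F l b = 0" if "int n < \<bar>l\<bar>" for l b using that by blast
  moreover have "lay_step z L D G k a = 0" if "\<And>l b. int n < \<bar>l\<bar> \<Longrightarrow> G l b = 0" for G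
    using Suc.prems(2) by (simp add: lay_step_def that)
  ultimately show ?case by simp
qed simp

lemma sum_shift_int:
  fixes f w :: "int \<Rightarrow> real"
  assumes "\<And>k. int m \<le> \<bar>k\<bar> \<Longrightarrow> f k = 0"
  shows "(\<Sum>k\<in>{-int m..int m}. w k * f (k + 1)) = (\<Sum>k\<in>{-int m..int m}. w (k - 1) * f k)"
    and "(\<Sum>k\<in>{-int m..int m}. w k * f (k - 1)) = (\<Sum>k\<in>{-int m..int m}. w (k + 1) * f k)"
proof -
  have "(\<Sum>k\<in>{-int m..int m}. w k * f (k + 1)) = (\<Sum>k\<in>{1-int m..int m + 1}. w (k - 1) * f k)"
    by (rule sum.reindex_bij_witness[of _ "\<lambda>k. k - 1" "\<lambda>k. k + 1"]) auto
  also have "\<dots> = (\<Sum>k\<in>{1-int m..int m}. w (k - 1) * f k)"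
    by (rule sum.mono_neutral_right) (auto intro!: assms)
  also have "\<dots> = (\<Sum>k\<in>{-int m..int m}. w (k - 1) * f k)"
    by (rule sum.mono_neutral_left) (auto intro!: assms)
  finally show "(\<Sum>k\<in>{-int m..int m}. w k * f (k + 1)) = (\<Sum>k\<in>{-int m..int m}. w (k - 1) * f k)" .
  have "(\<Sum>k\<in>{-int m..int m}. w k * f (k - 1)) = (\<Sum>k\<in>{-int m-1..int m - 1}. w (k + 1) * f k)"
    by (rule sum.reindex_bij_witness[of _ "\<lambda>k. k + 1" "\<lambda>k. k - 1"]) auto
  also have "\<dots> = (\<Sum>k\<in>{-int m..int m - 1}. w (k + 1) * f k)"
    by (rule sum.mono_neutral_right) (auto intro!: assms)
  also have "\<dots> = (\<Sum>k\<in>{-int m..int m}. w (k + 1) * f k)"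
    by (rule sum.mono_neutral_left) (auto intro!: assms)
  finally show "(\<Sum>k\<in>{-int m..int m}. w k * f (k - 1)) = (\<Sum>k\<in>{-int m..int m}. w (k + 1) * f k)" .
qed

text \<open>Summation by parts in \<open>k\<close>; vanishing for \<open>|k| >= m\<close> removes
  the boundary terms. A constant weight recovers \<open>srw_step\<close>, and the weight
  \<open>k^2\<close>, with second difference 2, produces the source term of
  \<open>second_moment\<close>.\<close>

lemma sum_lay_step:
  fixes w :: "int \<Rightarrow> real" and F :: "int \<Rightarrow> int ^ 'd \<Rightarrow> real"
  assumes F: "\<And>k. int m \<le> \<bar>k\<bar> \<Longrightarrow> F k a = 0"
  shows "(\<Sum>k\<in>{-int m..int m}. w k * lay_step z L D F k a) =
     srw_step L D (\<lambda>a. \<Sum>k\<in>{-int m..int m}. w k * F k a) a +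
     (if a \<in> D then z a / L * (\<Sum>k\<in>{-int m..int m}. (w (k + 1) + w (k - 1) - 2 * w k) * F k a) else 0)"
proof (cases "a \<in> D")
  case True
  let ?I = "{-int m..int m}" and ?d = "real CARD('d)"
  have "(\<Sum>k\<in>?I. w k * lay_step z L D F k a) = (\<Sum>k\<in>?I. (1 - (2 * z a + 2 * ?d) / L) * (w k * F k a)
      + z a / L * (w k * F (k + 1) a + w k * F (k - 1) a)
      + (\<Sum>i\<in>UNIV. w k * F k (a + axis i 1) + w k * F k (a - axis i 1)) / L)"
    using True by (intro sum.cong refl) (simp add: lay_step_def distrib_left sum_distrib_left mult_ac)
  also have "\<dots> = (1 - (2 * z a + 2 * ?d) / L) * (\<Sum>k\<in>?I. w k * F k a)
      + z a / L * ((\<Sum>k\<in>?I. w k * F (k + 1) a) + (\<Sum>k\<in>?I. w k * F (k - 1) a))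
      + (\<Sum>k\<in>?I. \<Sum>i\<in>UNIV. w k * F k (a + axis i 1) + w k * F k (a - axis i 1)) / L"
    by (simp only: sum.distrib sum_distrib_left[symmetric] sum_divide_distrib[symmetric])
  also have "(\<Sum>k\<in>?I. \<Sum>i\<in>UNIV. w k * F k (a + axis i 1) + w k * F k (a - axis i 1)) =
      (\<Sum>i\<in>UNIV. (\<Sum>k\<in>?I. w k * F k (a + axis i 1)) + (\<Sum>k\<in>?I. w k * F k (a - axis i 1)))"
    unfolding sum.distrib[symmetric] by (rule sum.swap)
  also have "(\<Sum>k\<in>?I. w k * F (k + 1) a) = (\<Sum>k\<in>?I. w (k - 1) * F k a)"
    by (rule sum_shift_int(1)) (rule F)
  also have "(\<Sum>k\<in>?I. w k * F (k - 1) a) = (\<Sum>k\<in>?I. w (k + 1) * F k a)"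
    by (rule sum_shift_int(2)) (rule F)
  finally have 1: "(\<Sum>k\<in>?I. w k * lay_step z L D F k a) = (1 - (2 * z a + 2 * ?d) / L) * (\<Sum>k\<in>?I. w k * F k a)
      + z a / L * ((\<Sum>k\<in>?I. w (k - 1) * F k a) + (\<Sum>k\<in>?I. w (k + 1) * F k a))
      + (\<Sum>i\<in>UNIV. (\<Sum>k\<in>?I. w k * F k (a + axis i 1)) + (\<Sum>k\<in>?I. w k * F k (a - axis i 1))) / L" .
  have 2: "(\<Sum>k\<in>?I. (w (k + 1) + w (k - 1) - 2 * w k) * F k a) =
     (\<Sum>k\<in>?I. w (k + 1) * F k a) + (\<Sum>k\<in>?I. w (k - 1) * F k a) - 2 * (\<Sum>k\<in>?I. w k * F k a)"
    by (simp add: sum.distrib sum_subtractf sum_distrib_left algebra_simps)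
  have "(1 - (2 * q + 2 * d) / L) * x + q / L * (y + y') + s / L =
     (1 - 2 * d / L) * x + s / L + q / L * (y' + y - 2 * x)" for q d x y y' s
    by (simp add: algebra_simps add_divide_distrib)
  then show ?thesis using True unfolding 1 2 by (simp add: srw_step_def)
next
  case False
  then show ?thesis by (simp add: lay_step_def srw_step_def)
qed

text \<open>The recursion for the second moment of the displacement in the first coordinate, see \<open>lay_pow_second_moment\<close>\<close>

primrec second_moment :: "(int ^ 'd \<Rightarrow> real) \<Rightarrow> real \<Rightarrow> (int ^ 'd) set \<Rightarrow> nat \<Rightarrow> int ^ 'd \<Rightarrow> real" where
  "second_moment z L D 0 = (\<lambda>_. 0)"
| "second_moment z L D (Suc n) = (\<lambda>a. srw_step L D (second_moment z L D n) a +
     (if a \<in> D then 2 * z a / L * (srw_step L D ^^ n) (indicator D) a else 0))"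

lemma lay_pow_total:
  assumes "n < m"
  shows "(\<Sum>k\<in>{-int m..int m}. (lay_step z L D ^^ n) (\<lambda>k a. if k = 0 then f a else 0) k a) = (srw_step L D ^^ n) f a"
  using assms
proof (induction n arbitrary: a)
  case (Suc n)
  let ?F = "(lay_step z L D ^^ n) (\<lambda>k a. if k = 0 then f a else 0)"
  have "?F k a = 0" if "int m \<le> \<bar>k\<bar>" for k a
    by (rule lay_pow_support) (use that Suc.prems in auto)
  from sum_lay_step[of m ?F a "\<lambda>_. 1" z L D, OF this] show ?case using Suc by simp
qed simp

lemma lay_pow_second_moment:
  assumes "n < m"
  shows "(\<Sum>k\<in>{-int m..int m}. (real_of_int k)\<^sup>2 * (lay_step z L D ^^ n) (\<lambda>k a. if k = 0 then indicator D a else 0) k a)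
    = second_moment z L D n a"
  using assms
proof (induction n arbitrary: a)
  case 0
  then show ?case by (auto intro!: sum.neutral)
next
  case (Suc n)
  let ?F = "(lay_step z L D ^^ n) (\<lambda>k a. if k = 0 then indicator D a else 0)"
  have "?F k a = 0" if "int m \<le> \<bar>k\<bar>" for k a
    by (rule lay_pow_support) (use that Suc.prems in auto)
  from sum_lay_step[of m ?F a "\<lambda>k. (real_of_int k)\<^sup>2" z L D, OF this]
  have "(\<Sum>k\<in>{-int m..int m}. (real_of_int k)\<^sup>2 * lay_step z L D ?F k a) =
     srw_step L D (\<lambda>a. \<Sum>k\<in>{-int m..int m}. (real_of_int k)\<^sup>2 * ?F k a) a +
     (if a \<in> D then z a / L * (\<Sum>k\<in>{-int m..int m}. ((real_of_int (k + 1))\<^sup>2 + (real_of_int (k - 1))\<^sup>2 - 2 * (real_of_int k)\<^sup>2) * ?F k a) else 0)" .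
  moreover have "(real_of_int (k + 1))\<^sup>2 + (real_of_int (k - 1))\<^sup>2 - 2 * (real_of_int k)\<^sup>2 = 2" for k
    by (simp add: power2_eq_square algebra_simps)
  moreover have "(\<Sum>k\<in>{-int m..int m}. 2 * ?F k a) = 2 * (srw_step L D ^^ n) (indicator D) a"
    unfolding sum_distrib_left[symmetric] using lay_pow_total[of n m z L D "indicator D" a] Suc.prems by simp
  ultimately show ?case using Suc by simp
qed

lemma srw_pow_translate:
  "(srw_step L ((+) c ` D) ^^ n) f (c + a) = (srw_step L D ^^ n) (\<lambda>x. f (c + x)) a"
proof (induction n arbitrary: a)
  case (Suc n)
  have "srw_step L ((+) c ` D) G (c + a) = srw_step L D (\<lambda>x. G (c + x)) a" for G
  proof -
    have "c + a \<in> (+) c ` D \<longleftrightarrow> a \<in> D" by auto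
    then show ?thesis by (simp add: srw_step_def add.assoc add_diff_eq)
  qed
  moreover have "(\<lambda>x. (srw_step L ((+) c ` D) ^^ n) f (c + x)) = (srw_step L D ^^ n) (\<lambda>x. f (c + x))"
    using Suc by blast
  ultimately show ?case by simp
qed simp

section \<open>The layered walk in a fixed non-negative environment\<close>

context
  fixes z :: "int ^ 'd \<Rightarrow> real" and L :: real
  assumes z0: "\<And>a. 0 \<le> z a"
begin

text \<open>With 2 in place of 3 the weights would merely be non-negative. The factor 3 leaves
  holding weight at least \<open>z a / L\<close> at each site of \<open>D\<close>, as
  \<open>unimodal_step_1d\<close> requires in the first coordinate; \<open>3 d <= L\<close> does the
  same for the second.\<close>

definition admissible :: "(int ^ 'd) set \<Rightarrow> bool" where
  "admissible D \<longleftrightarrow> 3 * real CARD('d) \<le> L \<and> (\<forall>a\<in>D. 3 * z a + 3 * real CARD('d) \<le> L)"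

lemma admissible_subset: "admissible D' \<Longrightarrow> D \<subseteq> D' \<Longrightarrow> admissible D"
  by (auto simp: admissible_def)

lemma admissible_pos: "admissible D \<Longrightarrow> 0 < L"
  unfolding admissible_def by (smt (verit) of_nat_0_less_iff zero_less_card_finite)

lemma admissible_coeff:
  assumes "admissible D" "a \<in> D"
  shows "z a / L \<le> 1 - (2 * z a + 2 * real CARD('d)) / L" "0 \<le> 1 - (2 * z a + 2 * real CARD('d)) / L"
proof -
  have L: "0 < L" using admissible_pos assms by blast
  have "3 * z a + 3 * real CARD('d) \<le> L" using assms by (auto simp: admissible_def)
  then have "z a + (2 * z a + 2 * real CARD('d)) \<le> L" by simp
  then have "(z a + (2 * z a + 2 * real CARD('d))) / L \<le> 1" using L by simp
  then show 1: "z a / L \<le> 1 - (2 * z a + 2 * real CARD('d)) / L" by (simp add: add_divide_distrib)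
  have "0 \<le> z a / L" using z0[of a] L by simp
  with 1 show "0 \<le> 1 - (2 * z a + 2 * real CARD('d)) / L" by linarith
qed

lemma lay_step_mono:
  assumes D: "admissible D" and FG: "\<And>k a. F k a \<le> G k a"
  shows "lay_step z L D F k a \<le> lay_step z L D G k a"
  unfolding lay_step_def using admissible_coeff[OF D, of a] admissible_pos[OF D] z0[of a] FG
  by (auto intro!: add_mono mult_left_mono divide_right_mono sum_mono)

lemma lay_pow_mono:
  assumes D: "admissible D" and FG: "\<And>k a. F k a \<le> G k a"
  shows "(lay_step z L D ^^ n) F k a \<le> (lay_step z L D ^^ n) G k a"
  by (induction n arbitrary: k a) (auto intro!: lay_step_mono D FG)

lemma lay_pow_nonneg:
  assumes D: "admissible D" and F: "\<And>k a. 0 \<le> F k a"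
  shows "0 \<le> (lay_step z L D ^^ n) F k a"
proof -
  have "(lay_step z L D ^^ n) (\<lambda>_ _. 0) = (\<lambda>_ _. 0)"
    by (induction n) (auto simp: lay_step_def fun_eq_iff)
  then show ?thesis using lay_pow_mono[OF D, where F="\<lambda>_ _. 0" and G=F and n=n and k=k and a=a] F by simp
qed

lemma lay_pow_dom_mono:
  assumes D: "admissible D'" "D \<subseteq> D'" and F: "\<And>k a. 0 \<le> F k a"
  shows "(lay_step z L D ^^ n) F k a \<le> (lay_step z L D' ^^ n) F k a"
proof (induction n arbitrary: k a)
  case (Suc n)
  note DD = admissible_subset[OF D]
  have n: "0 \<le> (lay_step z L D ^^ n) F k a" for k a by (rule lay_pow_nonneg[OF DD F])
  have "lay_step z L D ((lay_step z L D ^^ n) F) k a \<le> lay_step z L D' ((lay_step z L D ^^ n) F) k a"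

    proof (cases "a \<in> D")
      case True
      then show ?thesis using D(2) by (simp only: lay_step_def subset_iff if_True)
    next
      case False
      have "0 \<le> (lay_step z L D' ^^ 1) ((lay_step z L D ^^ n) F) k a" by (rule lay_pow_nonneg[OF D(1) n])
      then show ?thesis using False by (simp only: lay_step_def[of z L D] if_False) simp
    qed
  also have "\<dots> \<le> lay_step z L D' ((lay_step z L D' ^^ n) F) k a"
    by (intro lay_step_mono D Suc)
  finally show ?case by simp
qed simp

text \<open>At a fixed \<open>a\<close> the jump weight is the same for all \<open>k\<close>, so the
  one-dimensional step applies in each layer; adding contributions of other layers at the same
  \<open>k\<close> preserves the order.\<close>

lemma lay_pow_unimodal:
  assumes D: "admissible D" and F: "\<And>k l a. \<bar>k\<bar> \<le> \<bar>l\<bar> \<Longrightarrow> F l a \<le> F k a" and kl: "\<bar>k\<bar> \<le> \<bar>l\<bar>"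
  shows "(lay_step z L D ^^ n) F l a \<le> (lay_step z L D ^^ n) F k a"
  using kl
proof (induction n arbitrary: k l a)
  case (Suc n)
  let ?F = "(lay_step z L D ^^ n) F"
  have L: "0 < L" by (rule admissible_pos[OF D])
  show ?case
  proof (cases "a \<in> D")
    case True
    have "(1 - (2 * z a + 2 * real CARD('d)) / L) * ?F l a + z a / L * (?F (l + 1) a + ?F (l - 1) a)
      \<le> (1 - (2 * z a + 2 * real CARD('d)) / L) * ?F k a + z a / L * (?F (k + 1) a + ?F (k - 1) a)"
      by (rule unimodal_step_1d) (use Suc admissible_coeff[OF D True] z0[of a] L in auto)
    moreover have "(\<Sum>i\<in>UNIV. ?F l (a + axis i 1) + ?F l (a - axis i 1)) / L
       \<le> (\<Sum>i\<in>UNIV. ?F k (a + axis i 1) + ?F k (a - axis i 1)) / L"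
      using Suc L by (intro divide_right_mono sum_mono add_mono) auto
    ultimately have "lay_step z L D ?F l a \<le> lay_step z L D ?F k a"
      using True by (simp only: lay_step_def if_True)
    then show ?thesis by simp
  next
    case False
    then have "lay_step z L D G j a = 0" for G j by (simp add: lay_step_def)
    then show ?thesis by simp
  qed
qed (use F in auto)

text \<open>At most \<open>2 n + 1\<close> values of \<open>k\<close> carry mass after
  \<open>n\<close> steps, and by unimodality \<open>k = 0\<close> carries the most.\<close>

lemma lay_pow_return_ge:
  assumes D: "admissible D" and f: "\<And>a. 0 \<le> f a"
  shows "(srw_step L D ^^ n) f a / (2 * real n + 1) \<le> (lay_step z L D ^^ n) (\<lambda>k a. if k = 0 then f a else 0) 0 a"
proof -
  let ?F = "(lay_step z L D ^^ n) (\<lambda>k a. if k = 0 then f a else 0)"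
  have "(srw_step L D ^^ n) f a = (\<Sum>k\<in>{-int (Suc n)..int (Suc n)}. ?F k a)"
    by (rule lay_pow_total[symmetric]) simp
  also have "\<dots> = (\<Sum>k\<in>{-int n..int n}. ?F k a)"
    by (rule sum.mono_neutral_right) (auto intro!: lay_pow_support)
  also have "\<dots> \<le> (\<Sum>k\<in>{-int n..int n}. ?F 0 a)"
    by (intro sum_mono lay_pow_unimodal[OF D]) (use f in auto)
  also have "\<dots> = (2 * real n + 1) * ?F 0 a" by (simp add: nat_add_distrib nat_mult_distrib)
  finally show ?thesis by (simp add: pos_divide_le_eq mult.commute)
qed

text \<open>Displacements \<open>|k| <= |x|\<close> contribute at most \<open>x^2\<close> to the
  second moment, because the mass is at most 1. Each of the others has \<open>k^2 <= n^2\<close>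
  and, by unimodality, at most the mass of \<open>x\<close>. A second moment of
  \<open>x^2 + 1\<close> leaves at least 1 for the latter.\<close>

lemma lay_pow_displacement_ge:
  assumes D: "admissible D" and n: "0 < n" and x: "(real_of_int x)\<^sup>2 + 1 \<le> second_moment z L D n a"
  shows "1 / ((2 * real n + 1) * (real n)\<^sup>2) \<le> (lay_step z L D ^^ n) (\<lambda>k a. if k = 0 then indicator D a else 0) x a"
proof -
  let ?F = "(lay_step z L D ^^ n) (\<lambda>k a. if k = 0 then indicator D a else 0)"
  let ?I = "{-int n..int n}"
  have L2: "2 * real CARD('d) \<le> L" using D by (auto simp: admissible_def)
  have F0: "0 \<le> ?F k a" for k by (rule lay_pow_nonneg[OF D]) auto
  have "second_moment z L D n a = (\<Sum>k\<in>{-int (Suc n)..int (Suc n)}. (real_of_int k)\<^sup>2 * ?F k a)"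
    by (rule lay_pow_second_moment[symmetric]) simp
  also have "\<dots> = (\<Sum>k\<in>?I. (real_of_int k)\<^sup>2 * ?F k a)"
    by (rule sum.mono_neutral_right) (auto intro!: lay_pow_support)
  finally have S: "second_moment z L D n a = (\<Sum>k\<in>?I. (real_of_int k)\<^sup>2 * ?F k a)" .
  have "(\<Sum>k\<in>{-int (Suc n)..int (Suc n)}. ?F k a) = (srw_step L D ^^ n) (indicator D) a"
    by (rule lay_pow_total) simp
  moreover have "(\<Sum>k\<in>{-int (Suc n)..int (Suc n)}. ?F k a) = (\<Sum>k\<in>?I. ?F k a)"
    by (rule sum.mono_neutral_right) (auto intro!: lay_pow_support)
  ultimately have T: "(\<Sum>k\<in>?I. ?F k a) \<le> 1"
    using srw_pow_indicator_le_1[OF L2, of n D a] by simp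
  have "(\<Sum>k\<in>?I. (real_of_int k)\<^sup>2 * ?F k a) \<le> (\<Sum>k\<in>?I. (real_of_int x)\<^sup>2 * ?F k a + (real n)\<^sup>2 * ?F x a)"
  proof (rule sum_mono)
    fix k assume k: "k \<in> ?I"
    show "(real_of_int k)\<^sup>2 * ?F k a \<le> (real_of_int x)\<^sup>2 * ?F k a + (real n)\<^sup>2 * ?F x a"
    proof (cases "\<bar>k\<bar> \<le> \<bar>x\<bar>")
      case True
      then have "(real_of_int k)\<^sup>2 \<le> (real_of_int x)\<^sup>2"
        by (metis abs_le_square_iff of_int_abs of_int_le_iff)
      then have "(real_of_int k)\<^sup>2 * ?F k a \<le> (real_of_int x)\<^sup>2 * ?F k a" by (rule mult_right_mono) (rule F0)
      moreover have "0 \<le> (real n)\<^sup>2 * ?F x a" using F0[of x] by simp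
      ultimately show ?thesis by linarith
    next
      case False
      then have "?F k a \<le> ?F x a" by (intro lay_pow_unimodal[OF D]) auto
      moreover have "(real_of_int k)\<^sup>2 \<le> (real n)\<^sup>2"
      proof -
        have "\<bar>real_of_int k\<bar> \<le> \<bar>real n\<bar>" using k by auto
        then show ?thesis by (simp only: abs_le_square_iff)
      qed
      ultimately have "(real_of_int k)\<^sup>2 * ?F k a \<le> (real n)\<^sup>2 * ?F x a"
        using F0 by (intro mult_mono) auto
      moreover have "0 \<le> (real_of_int x)\<^sup>2 * ?F k a" using F0[of k] by simp
      ultimately show ?thesis by linarith
    qed
  qed
  also have "\<dots> = (real_of_int x)\<^sup>2 * (\<Sum>k\<in>?I. ?F k a) + (2 * real n + 1) * ((real n)\<^sup>2 * ?F x a)"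
    by (simp add: sum.distrib sum_distrib_left nat_add_distrib nat_mult_distrib)
  also have "\<dots> \<le> (real_of_int x)\<^sup>2 * 1 + (2 * real n + 1) * ((real n)\<^sup>2 * ?F x a)"
    by (intro add_right_mono mult_left_mono T) auto
  finally have "1 \<le> ((2 * real n + 1) * (real n)\<^sup>2) * ?F x a" using x S by (simp add: mult.assoc)
  moreover have "0 < (2 * real n + 1) * (real n)\<^sup>2" using n by (intro mult_pos_pos) auto
  ultimately show ?thesis by (simp add: pos_divide_le_eq mult.commute)
qed

section \<open>Moves of the second coordinate that bring the first one back\<close>

definition stay_kernel :: "(int ^ 'd) set \<Rightarrow> nat \<Rightarrow> int ^ 'd \<Rightarrow> int ^ 'd \<Rightarrow> real" where
  "stay_kernel D n a b = (lay_step z L D ^^ n) (\<lambda>k x. if k = 0 then indicator {b} x else 0) 0 a"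

text \<open>One term of the Chapman-Kolmogorov equation: the path is required to be at
  \<open>b\<close> with first displacement 0 after \<open>n\<close> steps.\<close>

lemma lay_pow_compose:
  assumes D: "admissible D" and F: "\<And>k a. 0 \<le> F k a"
  shows "stay_kernel D n a b * (lay_step z L D ^^ m) F l b \<le> (lay_step z L D ^^ (n + m)) F l a"
proof -
  let ?G = "(lay_step z L D ^^ m) F"
  let ?c = "?G l b"
  have G: "0 \<le> ?G k x" for k x by (rule lay_pow_nonneg[OF D F])
  have "(lay_step z L D ^^ n) (\<lambda>k x. ?c * (if k = 0 then indicator {b} x else 0)) 0 a \<le> (lay_step z L D ^^ n) (\<lambda>k. ?G (k + l)) 0 a"
    by (rule lay_pow_mono[OF D]) (use G in \<open>auto simp: indicator_def\<close>)
  then show ?thesis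
    unfolding lay_pow_cmult lay_pow_shift stay_kernel_def by (simp add: funpow_add mult.commute)
qed

lemma stay_kernel_nonneg: "admissible D \<Longrightarrow> 0 \<le> stay_kernel D n a b"
  unfolding stay_kernel_def by (rule lay_pow_nonneg) auto

lemma stay_kernel_compose:
  assumes "admissible D"
  shows "stay_kernel D n a b * stay_kernel D m b c \<le> stay_kernel D (n + m) a c"
  using lay_pow_compose[OF assms, of "\<lambda>k x. if k = 0 then indicator {c} x else 0" n a b m 0]
  unfolding stay_kernel_def[of D m] stay_kernel_def[of D "n + m"] by (simp add: indicator_def)

text \<open>The move takes place in the cube of radius \<open>r\<close> around \<open>c\<close>,
  where \<open>move_ge\<close> applies after translation; enlarging the domain to \<open>D\<close>
  only increases the kernel. The return of the first coordinate costs the factor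
  \<open>2 n + 1\<close>.\<close>

lemma stay_kernel_move_ge:
  assumes D: "admissible D" "(+) c ` cube r \<subseteq> D" and r: "0 < r"
    and s: "s = real n / L" "1 \<le> s" "28 * real CARD('d) * s \<le> (real r)\<^sup>2"
    and K: "2 * (real K)\<^sup>2 \<le> s" "\<bar>k\<bar> \<le> int K"
  shows "s / (2 * (real r)\<^sup>2 * (2 * real r + 1) ^ CARD('d)) / (2 * real n + 1) \<le> stay_kernel D n c (c + axis i k)"
proof -
  have L: "3 * real CARD('d) \<le> L" using D by (auto simp: admissible_def)
  let ?D = "(+) c ` cube r"
  have D': "admissible ?D" by (rule admissible_subset[OF D])
  have "real K \<le> real r"
  proof -
    have "2 * (real K)\<^sup>2 \<le> 28 * real CARD('d) * s"
    proof -
      have "1 \<le> real CARD('d)" by simp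
      then have "1 * s \<le> 28 * real CARD('d) * s" using s(2) by (intro mult_right_mono) linarith+
      then show ?thesis using K(1) by linarith
    qed
    then have "(real K)\<^sup>2 \<le> (real r)\<^sup>2" using s(3) zero_le_power2[of "real K"] by linarith
    then show ?thesis by (simp add: power2_le_iff_abs_le)
  qed
  then have kr: "\<bar>k\<bar> \<le> int r" using K(2) by linarith
  then have ax: "axis i k \<in> cube r" by (auto simp: cube_iff axis_component)
  have "(srw_step L (cube r) ^^ n) (indicator {0}) (axis i k) =
     (\<Sum>a\<in>cube r. (srw_step L (cube r) ^^ n) (indicator {0}) a * indicator {axis i k} a)"
    using ax by (simp add: indicator_def if_distrib[of "\<lambda>x. _ * x"] card_cube(1) sum.delta cong: if_cong)
  also have "\<dots> = (srw_step L (cube r) ^^ n) (indicator {axis i k}) 0"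
    by (rule srw_pow_at_0[symmetric]) (use ax in \<open>auto simp: card_cube(1) indicator_def\<close>)
  also have "indicator {axis i k} = (\<lambda>x. indicator {c + axis i k} (c + x) :: real)"
    by (auto simp: indicator_def fun_eq_iff)
  also have "(srw_step L (cube r) ^^ n) \<dots> 0 = (srw_step L ?D ^^ n) (indicator {c + axis i k}) c"
    using srw_pow_translate[where c=c and D="cube r" and n=n and a=0 and L=L and f="indicator {c + axis i k}"] by simp
  finally have "s / (2 * (real r)\<^sup>2 * (2 * real r + 1) ^ CARD('d)) \<le> (srw_step L ?D ^^ n) (indicator {c + axis i k}) c"
    using move_ge[OF L r s K, of i] by (simp only:)
  then have "s / (2 * (real r)\<^sup>2 * (2 * real r + 1) ^ CARD('d)) / (2 * real n + 1)
     \<le> (srw_step L ?D ^^ n) (indicator {c + axis i k}) c / (2 * real n + 1)"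
    by (rule divide_right_mono) simp
  also have "\<dots> \<le> stay_kernel ?D n c (c + axis i k)"
    unfolding stay_kernel_def by (rule lay_pow_return_ge[OF D']) simp
  also have "\<dots> \<le> stay_kernel D n c (c + axis i k)"
    unfolding stay_kernel_def by (rule lay_pow_dom_mono[OF D]) simp
  finally show ?thesis .
qed

lemma stay_kernel_axis_chain_ge:
  assumes D: "admissible D" and eta: "0 \<le> \<eta>"
    and move: "\<And>c k. c \<in> cube \<rho> \<Longrightarrow> \<bar>k\<bar> \<le> int K \<Longrightarrow> \<eta> \<le> stay_kernel D n c (c + axis i k)"
    and a: "a \<in> cube \<rho>" "a + axis i m \<in> cube \<rho>" "\<bar>m\<bar> \<le> int (J * K)"
  shows "\<eta> ^ J \<le> stay_kernel D (J * n) a (a + axis i m)"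
  using a
proof (induction J arbitrary: a m)
  case 0
  then have "axis i m = 0" by (simp add: vec_eq_iff axis_component)
  then show ?case by (simp add: stay_kernel_def)
next
  case (Suc J)
  \<comment> \<open>The remaining distance clipped to one move. Once the target is reached, all
    further moves are by 0, so that the number of steps is \<open>J * n\<close> for every
    \<open>m\<close>.\<close>
  define k where "k = max (- int K) (min (int K) m)"
  have k: "\<bar>k\<bar> \<le> int K" by (auto simp: k_def)
  have m': "\<bar>m - k\<bar> \<le> int (J * K)"
  proof -
    have "0 \<le> int (J * K)" by simp
    moreover have "\<bar>m\<bar> \<le> int K + int (J * K)" using Suc.prems(3) by simp
    ultimately show ?thesis unfolding k_def by linarith
  qed
  have between: "\<bar>x + k\<bar> \<le> y" if "\<bar>x\<bar> \<le> y" "\<bar>x + m\<bar> \<le> y" for x y :: int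
    using that by (auto simp: k_def)
  have c: "a + axis i k \<in> cube \<rho>"
    unfolding cube_iff
  proof
    fix j
    show "\<bar>(a + axis i k) $ j\<bar> \<le> int \<rho>"
      using Suc.prems(1,2)[unfolded cube_iff, rule_format, of j] between[of "a $ j" "int \<rho>"]
      by (auto simp: axis_component split: if_splits)
  qed
  have ax: "axis i k + axis i (m - k) = axis i m" by (simp add: vec_eq_iff axis_component)
  have "\<eta> ^ J \<le> stay_kernel D (J * n) (a + axis i k) (a + axis i k + axis i (m - k))"
    using Suc.prems(2) c m' ax by (intro Suc.IH) (auto simp: add.assoc)
  then have "\<eta> * \<eta> ^ J \<le> stay_kernel D n a (a + axis i k) * stay_kernel D (J * n) (a + axis i k) (a + axis i m)"
    using move[OF Suc.prems(1) k] eta ax by (intro mult_mono) (auto simp: add.assoc stay_kernel_nonneg[OF D])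
  also have "\<dots> \<le> stay_kernel D (n + J * n) a (a + axis i m)"
    by (rule stay_kernel_compose[OF D])
  finally show ?case by simp
qed

text \<open>The coordinates are corrected one after another, each by at most
  \<open>2 \<rho> <= J K\<close>; in \<open>h I\<close> those in \<open>I\<close> already agree with
  \<open>b\<close>. The number of steps is the same for all \<open>a\<close> and \<open>b\<close>,
  which permits concatenation to a prescribed total.\<close>

lemma stay_kernel_chain_ge:
  assumes D: "admissible D" and eta: "0 \<le> \<eta>"
    and move: "\<And>c i k. c \<in> cube \<rho> \<Longrightarrow> \<bar>k\<bar> \<le> int K \<Longrightarrow> \<eta> \<le> stay_kernel D n c (c + axis i k)"
    and ab: "a \<in> cube \<rho>" "b \<in> cube \<rho>" and J: "2 * \<rho> \<le> J * K"
  shows "\<eta> ^ (CARD('d) * J) \<le> stay_kernel D (CARD('d) * J * n) a b"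
proof -
  define h where "h I = (\<chi> i. if i \<in> I then b $ i else a $ i)" for I
  have h: "h I \<in> cube \<rho>" for I using ab by (auto simp: h_def cube_iff)
  have "\<eta> ^ (card I * J) \<le> stay_kernel D (card I * J * n) a (h I)" if "finite I" for I
    using that
  proof (induction I)
    case empty
    have "h {} = a" by (simp add: h_def)
    then show ?case by (simp add: stay_kernel_def)
  next
    case (insert i I)
    have hi: "h (insert i I) = h I + axis i (b $ i - a $ i)"
      using insert.hyps by (auto simp: h_def vec_eq_iff axis_component)
    have "\<bar>b $ i - a $ i\<bar> \<le> int (J * K)"
      using ab[unfolded cube_iff, rule_format, of i] J by linarith
    then have "\<eta> ^ J \<le> stay_kernel D (J * n) (h I) (h (insert i I))"
      unfolding hi using h[of I] h[of "insert i I"] hi by (intro stay_kernel_axis_chain_ge[OF D eta move]) auto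
    then have "\<eta> ^ (card I * J) * \<eta> ^ J \<le> stay_kernel D (card I * J * n) a (h I) * stay_kernel D (J * n) (h I) (h (insert i I))"
      using insert.IH eta by (intro mult_mono) (auto simp: stay_kernel_nonneg[OF D])
    also have "\<dots> \<le> stay_kernel D (card I * J * n + J * n) a (h (insert i I))"
      by (rule stay_kernel_compose[OF D])
    finally show ?case using insert.hyps by (simp add: power_add[symmetric] algebra_simps)
  qed
  from this[of UNIV] show ?thesis by (simp add: h_def)
qed

section \<open>Second moment of the first coordinate from below\<close>

lemma second_moment_nonneg:
  assumes D: "admissible D" shows "0 \<le> second_moment z L D n a"
proof (induction n arbitrary: a)
  case (Suc n)
  have L: "2 * real CARD('d) \<le> L" using D by (auto simp: admissible_def)
  have "0 \<le> (srw_step L D ^^ 1) (second_moment z L D n) a" by (intro srw_pow_nonneg L Suc)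
  moreover have "0 \<le> (srw_step L D ^^ n) (indicator D) a" by (intro srw_pow_nonneg L) auto
  ultimately show ?case using z0[of a] admissible_pos[OF D] by auto
qed simp

text \<open>Unrolled, the recursion sums over \<open>v\<close> the expectation of
  \<open>2 z / L\<close> after \<open>v\<close> steps times the survival probability for the
  remaining steps. Survival with probability 1/2 absorbs the factor 2, and symmetry turns expected
  visits into the Green function.\<close>

lemma second_moment_ge_green:
  assumes D: "admissible (cube R)" and K: "K \<le> R"
    and surv: "\<And>v a. v < n \<Longrightarrow> (a :: int ^ 'd) \<in> cube K \<Longrightarrow> 1 / 2 \<le> (srw_step L (cube R) ^^ v) (indicator (cube R)) a"
  shows "(\<Sum>a\<in>cube K. z a * (\<Sum>v<n. (srw_step L (cube R) ^^ v) (indicator {0}) a)) / L \<le> second_moment z L (cube R) n 0"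
proof -
  let ?D = "cube R :: (int ^ 'd) set" and ?f = "\<lambda>a. if a \<in> cube K then z a else 0"
  have L: "2 * real CARD('d) \<le> L" using D by (auto simp: admissible_def)
  have L0: "0 < L" by (rule admissible_pos[OF D])
  have sub: "cube K \<subseteq> ?D" by (rule cube_mono[OF K])
  have "(\<Sum>v<m. (srw_step L ?D ^^ v) ?f a) / L \<le> second_moment z L ?D m a" if "m \<le> n" for m a
    using that
  proof (induction m arbitrary: a)
    case (Suc m)
    have "(\<Sum>v<Suc m. (srw_step L ?D ^^ v) ?f a) / L = srw_step L ?D (\<lambda>a. (\<Sum>v<m. (srw_step L ?D ^^ v) ?f a) / L) a + ?f a / L"
    proof -
      have "srw_step L ?D (\<lambda>a. 1 / L * (\<Sum>v<m. (srw_step L ?D ^^ v) ?f a)) a = 1 / L * (\<Sum>v<m. (srw_step L ?D ^^ Suc v) ?f a)"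
        unfolding srw_step_cmult srw_step_sum by simp
      then show ?thesis by (simp add: sum.lessThan_Suc_shift add_divide_distrib del: sum.lessThan_Suc)
    qed
    also have "\<dots> \<le> srw_step L ?D (second_moment z L ?D m) a + (if a \<in> ?D then 2 * z a / L * (srw_step L ?D ^^ m) (indicator ?D) a else 0)"
    proof (rule add_mono)
      show "srw_step L ?D (\<lambda>a. (\<Sum>v<m. (srw_step L ?D ^^ v) ?f a) / L) a \<le> srw_step L ?D (second_moment z L ?D m) a"
        using Suc by (intro srw_step_mono L) auto
      have nn: "0 \<le> 2 * z a / L" using z0[of a] L0 by simp
      show "?f a / L \<le> (if a \<in> ?D then 2 * z a / L * (srw_step L ?D ^^ m) (indicator ?D) a else 0)"
      proof (cases "a \<in> cube K")
        case True
        have "2 * z a / L * (1 / 2) \<le> 2 * z a / L * (srw_step L ?D ^^ m) (indicator ?D) a"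
          using surv[of m a] Suc.prems True by (intro mult_left_mono nn) auto
        then show ?thesis using True sub by auto
      next
        case False
        have "0 \<le> (srw_step L ?D ^^ m) (indicator ?D) a" by (intro srw_pow_nonneg L) auto
        with nn have "0 \<le> 2 * z a / L * (srw_step L ?D ^^ m) (indicator ?D) a" by (rule mult_nonneg_nonneg)
        with False show ?thesis by auto
      qed
    qed
    finally show ?case by simp
  qed simp
  from this[of n 0] have "(\<Sum>v<n. (srw_step L ?D ^^ v) ?f 0) / L \<le> second_moment z L ?D n 0" by simp
  moreover have "(\<Sum>v<n. (srw_step L ?D ^^ v) ?f 0) = (\<Sum>a\<in>cube K. z a * (\<Sum>v<n. (srw_step L ?D ^^ v) (indicator {0}) a))"
  proof -
    have "(srw_step L ?D ^^ v) ?f 0 = (\<Sum>a\<in>cube K. z a * (srw_step L ?D ^^ v) (indicator {0}) a)" for v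
    proof -
      have "(srw_step L ?D ^^ v) ?f 0 = (\<Sum>a\<in>?D. (srw_step L ?D ^^ v) (indicator {0}) a * ?f a)"
        by (rule srw_pow_at_0) (use sub in \<open>auto simp: card_cube(1)\<close>)
      also have "\<dots> = (\<Sum>a\<in>cube K. (srw_step L ?D ^^ v) (indicator {0}) a * ?f a)"
        by (rule sum.mono_neutral_right) (use sub in \<open>auto simp: card_cube(1)\<close>)
      finally show ?thesis by (simp add: mult.commute)
    qed
    then show ?thesis by (simp add: sum_distrib_left sum.swap[of _ "{..<n}"])
  qed
  ultimately show ?thesis by simp
qed

text \<open>Only the paths whose second coordinate never leaves \<open>a\<close> are kept; each step
  leaves it in place with weight \<open>1 - 2 d / L\<close>.\<close>

lemma second_moment_ge_site:
  assumes D: "admissible D" and a: "a \<in> D"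
  shows "real n * (2 * z a / L) * (1 - 2 * real CARD('d) / L) ^ n \<le> second_moment z L D n a"
proof -
  let ?p = "1 - 2 * real CARD('d) / L"
  have L: "2 * real CARD('d) \<le> L" using D by (auto simp: admissible_def)
  have L0: "0 < L" by (rule admissible_pos[OF D])
  have p: "0 \<le> ?p" "?p \<le> 1" using L L0 by auto
  have step: "?p * F a \<le> srw_step L D F a" if "\<And>x. 0 \<le> F x" for F
    using a that L0 by (simp add: srw_step_def sum_nonneg)
  have surv: "?p ^ n \<le> (srw_step L D ^^ n) (indicator D) a" for n
  proof (induction n)
    case (Suc n)
    have "?p * ?p ^ n \<le> ?p * (srw_step L D ^^ n) (indicator D) a" by (rule mult_left_mono[OF Suc p(1)])
    also have "\<dots> \<le> srw_step L D ((srw_step L D ^^ n) (indicator D)) a"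
      by (rule step) (intro srw_pow_nonneg L, auto)
    finally show ?case by simp
  qed (use a in simp)
  have c: "0 \<le> 2 * z a / L" using z0[of a] L0 by simp
  show ?thesis
  proof (induction n)
    case (Suc n)
    have "real (Suc n) * (2 * z a / L) * ?p ^ Suc n = ?p * (real n * (2 * z a / L) * ?p ^ n) + 2 * z a / L * (?p * ?p ^ n)"
    proof -
      have "real (Suc n) * c * (p * q) = p * (real n * c * q) + c * (p * q)" for c p q :: real
        by (simp add: algebra_simps)
      then show ?thesis unfolding power_Suc .
    qed
    also have "\<dots> \<le> ?p * second_moment z L D n a + 2 * z a / L * (1 * ?p ^ n)"
      using Suc p c by (intro add_mono mult_left_mono mult_right_mono) auto
    also have "\<dots> \<le> srw_step L D (second_moment z L D n) a + 2 * z a / L * (srw_step L D ^^ n) (indicator D) a"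
      using surv[of n] c by (intro add_mono step second_moment_nonneg D mult_left_mono) auto
    finally show ?case using a by simp
  qed simp
qed

end

section \<open>The random environment\<close>

lemma tail_bounds:
  fixes p :: "real \<Rightarrow> real"
  assumes lim: "((\<lambda>r. ln (p r) / ln r) \<longlongrightarrow> - \<alpha>) at_top" and p: "\<And>r. 0 \<le> p r" and \<alpha>: "0 < \<alpha>"
  shows "eventually (\<lambda>r. p r \<le> r powr (- \<alpha> / 2)) at_top"
    and "0 < \<epsilon> \<Longrightarrow> eventually (\<lambda>r. r powr (- \<alpha> - \<epsilon>) \<le> p r) at_top"
proof -
  have up: "eventually (\<lambda>r. ln (p r) / ln r < - \<alpha> / 2) at_top"
    by (rule order_tendstoD(2)[OF lim]) (use \<alpha> in auto)
  then have up': "eventually (\<lambda>r. 0 < p r \<and> p r \<le> r powr (- \<alpha> / 2)) at_top"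
    using eventually_gt_at_top[of 1]
  proof eventually_elim
    case (elim r)
    then have l: "0 < ln r" by simp
    then have "ln (p r) < (- \<alpha> / 2) * ln r" using elim by (simp add: pos_divide_less_eq)
    moreover have "0 < (\<alpha> / 2) * ln r" using l \<alpha> by (intro mult_pos_pos) auto
    ultimately have ln: "ln (p r) < 0" by linarith
    \<comment> \<open>Since \<open>ln 0 = 0\<close>, a negative logarithm excludes a vanishing
      tail.\<close>
    then have "p r \<noteq> 0" by auto
    then have p0: "0 < p r" using p[of r] by linarith
    then have "p r = exp (ln (p r))" by simp
    also have "\<dots> \<le> exp ((- \<alpha> / 2) * ln r)" using \<open>ln (p r) < (- \<alpha> / 2) * ln r\<close> by (simp only: exp_le_cancel_iff)
    also have "\<dots> = r powr (- \<alpha> / 2)" using elim by (simp add: powr_def)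
    finally show ?case using p0 by simp
  qed
  then show "eventually (\<lambda>r. p r \<le> r powr (- \<alpha> / 2)) at_top" by eventually_elim auto
  assume eps: "0 < \<epsilon>"
  have "eventually (\<lambda>r. - \<alpha> - \<epsilon> < ln (p r) / ln r) at_top"
    by (rule order_tendstoD(1)[OF lim]) (use eps in auto)
  then show "eventually (\<lambda>r. r powr (- \<alpha> - \<epsilon>) \<le> p r) at_top"
    using up' eventually_gt_at_top[of 1]
  proof eventually_elim
    case (elim r)
    then have l: "0 < ln r" by simp
    then have "(- \<alpha> - \<epsilon>) * ln r \<le> ln (p r)" using elim by (simp add: pos_less_divide_eq less_imp_le)
    then have "exp ((- \<alpha> - \<epsilon>) * ln r) \<le> exp (ln (p r))" by (simp only: exp_le_cancel_iff)
    then show ?case using elim by (simp add: powr_def)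
  qed
qed

lemma cube_card_bounds:
  assumes "1 \<le> n"
  shows "real n powr real CARD('d) \<le> real (card (cube n :: (int ^ 'd) set))"
    and "real (card (cube n :: (int ^ 'd) set)) \<le> 3 ^ CARD('d) * real n powr real CARD('d)"
proof -
  have "real (card (cube n :: (int ^ 'd) set)) = (2 * real n + 1) ^ CARD('d)"
    by (simp add: card_cube(2) add.commute)
  moreover have "real n ^ CARD('d) \<le> (2 * real n + 1) ^ CARD('d)" by (intro power_mono) auto
  moreover have "(2 * real n + 1) ^ CARD('d) \<le> (3 * real n) ^ CARD('d)" using assms by (intro power_mono) auto
  moreover have "real n powr real CARD('d) = real n ^ CARD('d)" using assms by (simp add: powr_realpow)
  ultimately show "real n powr real CARD('d) \<le> real (card (cube n :: (int ^ 'd) set))"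
    "real (card (cube n :: (int ^ 'd) set)) \<le> 3 ^ CARD('d) * real n powr real CARD('d)"
    by (simp_all add: power_mult_distrib)
qed

lemma (in prob_space) borel_cantelli_eventually:
  assumes A: "\<And>n. A n \<in> events" and b: "eventually (\<lambda>n. prob (A n) \<le> b n) sequentially" and s: "summable b"
  shows "AE w in M. eventually (\<lambda>n. w \<notin> A n) sequentially"
proof -
  have "summable (\<lambda>n. prob (A n))"
    by (rule summable_comparison_test_ev[OF _ s]) (use b in eventually_elim, simp)
  from borel_cantelli_AE1[OF A _ this] have "AE w in M. eventually (\<lambda>n. w \<in> space M - A n) sequentially"
    by (simp add: emeasure_eq_measure)
  then show ?thesis by eventually_elim (auto elim: eventually_mono)
qed

context prob_space
begin

text \<open>A union bound with half of the tail exponent: \<open>\<kappa>\<close> solves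
  \<open>d - \<kappa> \<alpha> / 2 = -2\<close>, so the probabilities are summable.\<close>

lemma environment_upper:
  fixes z :: "int ^ 'd \<Rightarrow> 'a \<Rightarrow> real"
  assumes [measurable]: "\<And>x. z x \<in> borel_measurable M"
    and tail: "\<And>x r. prob {w\<in>space M. r < z x w} = p r"
    and lim: "((\<lambda>r. ln (p r) / ln r) \<longlongrightarrow> - \<alpha>) at_top" and \<alpha>: "0 < \<alpha>"
  defines "\<kappa> \<equiv> 2 * (real CARD('d) + 2) / \<alpha>"
  shows "AE w in M. eventually (\<lambda>n. \<forall>y\<in>cube n. z y w \<le> real n powr \<kappa>) sequentially"
proof -
  have k: "0 < \<kappa>" using \<alpha> by (simp add: \<kappa>_def add_pos_pos)
  have p0: "0 \<le> p r" for r by (metis tail measure_nonneg)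
  define A where "A n = (\<Union>y\<in>cube n. {w\<in>space M. real n powr \<kappa> < z y w})" for n
  have A: "A n \<in> events" for n unfolding A_def by (intro sets.finite_UN card_cube(1)) measurable
  have lim1: "filterlim (\<lambda>n. real n powr \<kappa>) at_top sequentially" using k by real_asymp
  have "AE w in M. eventually (\<lambda>n. w \<notin> A n) sequentially"
  proof (rule borel_cantelli_eventually[OF A])
    show "summable (\<lambda>n. 3 ^ CARD('d) * real n powr (-2))"
      by (intro summable_mult) (simp add: summable_real_powr_iff)
    show "eventually (\<lambda>n. prob (A n) \<le> 3 ^ CARD('d) * real n powr (-2)) sequentially"
      using eventually_compose_filterlim[OF tail_bounds(1)[OF lim p0 \<alpha>] lim1] eventually_ge_at_top[of 1]
    proof eventually_elim
      case (elim n)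
      have "prob (A n) \<le> (\<Sum>y\<in>cube n. prob {w\<in>space M. real n powr \<kappa> < z y w})"
        unfolding A_def by (rule finite_measure_subadditive_finite) (auto simp: card_cube(1))
      also have "\<dots> = real (card (cube n :: (int ^ 'd) set)) * p (real n powr \<kappa>)" by (simp add: tail)
      also have "\<dots> \<le> (3 ^ CARD('d) * real n powr real CARD('d)) * (real n powr \<kappa>) powr (- \<alpha> / 2)"
        using elim cube_card_bounds(2)[OF elim(2), where 'd='d] p0 by (intro mult_mono) auto
      also have "\<dots> = 3 ^ CARD('d) * real n powr (-2)"
      proof -
        have "real CARD('d) + \<kappa> * (- \<alpha> / 2) = - 2" using \<alpha> by (simp add: \<kappa>_def field_simps)
        then show ?thesis using elim by (simp add: powr_powr mult.assoc powr_add[symmetric])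
      qed
      finally show ?case .
    qed
  qed
  then show ?thesis using AE_space
  proof eventually_elim
    case (elim w)
    from elim(1) show ?case by eventually_elim (use elim(2) in \<open>auto simp: A_def not_less\<close>)
  qed
qed

text \<open>Markov's inequality for the exponential of minus the count. Each site contributes a
  factor \<open>1 - p + p / e <= exp (- p / 2)\<close>, and the threshold at a quarter of the mean
  gives back half of the exponent.\<close>

lemma count_chernoff:
  fixes z :: "'i \<Rightarrow> 'a \<Rightarrow> real"
  assumes indep: "indep_vars (\<lambda>_. borel) z I" and B: "finite B" "B \<subseteq> I"
    and tail: "\<And>x. x \<in> I \<Longrightarrow> prob {w\<in>space M. r < z x w} = p"
  shows "prob {w\<in>space M. real (card {y\<in>B. r < z y w}) \<le> p * card B / 4} \<le> exp (- p * card B / 4)"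
proof (cases "B = {}")
  case False
  with B tail measure_nonneg prob_le_1 have p: "0 \<le> p" "p \<le> 1" by (metis all_not_in_conv subsetD)+
  have meas: "z y \<in> borel_measurable M" if "y \<in> B" for y
    using indep that B(2) by (auto simp: indep_vars_def2)
  let ?Y = "\<lambda>y w. if r < z y w then ennreal (exp (-1)) else 1"
  let ?N = "\<lambda>w. card {y\<in>B. r < z y w}"
  have "indep_vars (\<lambda>_. borel) (\<lambda>y w. (\<lambda>x. if r < x then ennreal (exp (-1)) else 1) (z y w)) B"
    by (rule indep_vars_compose2[OF indep_vars_subset[OF indep B(2)]]) measurable
  then have iY: "indep_vars (\<lambda>_. borel) ?Y B" .
  have prodN: "(\<Prod>y\<in>B. ?Y y w) = ennreal (exp (- real (?N w)))" for w
  proof -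
    have "(\<Prod>y\<in>B. ?Y y w) = (\<Prod>y\<in>B. if y \<in> {y\<in>B. r < z y w} then ennreal (exp (-1)) else 1)"
      by (rule prod.cong) auto
    also have "\<dots> = (\<Prod>y\<in>{y\<in>B. r < z y w}. ennreal (exp (-1)))"
    proof -
      have "B \<inter> {y\<in>B. r < z y w} = {y\<in>B. r < z y w}" by auto
      then show ?thesis using prod.inter_restrict[OF B(1), of "\<lambda>_. ennreal (exp (-1))" "{y\<in>B. r < z y w}"] by simp
    qed
    also have "\<dots> = ennreal (exp (- real (?N w)))"
      by (simp add: ennreal_power exp_of_nat_mult[symmetric])
    finally show ?thesis .
  qed
  have EY: "(\<integral>\<^sup>+w. ?Y y w \<partial>M) \<le> ennreal (exp (- p / 2))" if y: "y \<in> B" for y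
  proof -
    note [measurable] = meas[OF y]
    have "(\<integral>\<^sup>+w. ?Y y w \<partial>M) = (\<integral>\<^sup>+w. ennreal (exp (-1)) * indicator {w\<in>space M. r < z y w} w + indicator (space M - {w\<in>space M. r < z y w}) w \<partial>M)"
      by (rule nn_integral_cong) (auto split: split_indicator)
    also have "\<dots> = ennreal (exp (-1)) * emeasure M {w\<in>space M. r < z y w} + emeasure M (space M - {w\<in>space M. r < z y w})"
      by (subst nn_integral_add) (auto simp: nn_integral_cmult)
    also have "\<dots> = ennreal (exp (-1) * p + (1 - p))"
      using tail[of y] y B(2) p by (auto simp: emeasure_eq_measure prob_compl ennreal_mult[symmetric] ennreal_plus[symmetric] simp del: ennreal_plus)
    also have "exp (-1) * p + (1 - p) \<le> exp (- p / 2)"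
    proof -
      have "exp (-1 :: real) \<le> 1 / 2" using exp_ge_add_one_self[of 1] by (simp add: exp_minus field_simps)
      then have "exp (-1) * p \<le> 1 / 2 * p" using p by (intro mult_right_mono) auto
      then have "exp (-1) * p + (1 - p) \<le> 1 + (- p / 2)" by simp
      also have "\<dots> \<le> exp (- p / 2)" by (rule exp_ge_add_one_self)
      finally show ?thesis .
    qed
    finally show ?thesis by (simp add: ennreal_leI)
  qed
  have [measurable]: "(\<lambda>w. \<Prod>y\<in>B. ?Y y w) \<in> borel_measurable M"
    using meas by (intro borel_measurable_prod_ennreal) measurable
  let ?c = "p * card B / 4"
  have ev: "{w\<in>space M. real (?N w) \<le> ?c} = {w\<in>space M. 1 \<le> ennreal (exp ?c) * (\<Prod>y\<in>B. ?Y y w)}"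
    unfolding prodN by (auto simp: ennreal_mult[symmetric] exp_add[symmetric] ennreal_1[symmetric] simp del: ennreal_1)
  have "emeasure M {w\<in>space M. real (?N w) \<le> ?c} \<le> ennreal (exp ?c) * (\<integral>\<^sup>+w. (\<Prod>y\<in>B. ?Y y w) * indicator (space M) w \<partial>M)"
    unfolding ev by (rule nn_integral_Markov_inequality) auto
  also have "(\<integral>\<^sup>+w. (\<Prod>y\<in>B. ?Y y w) * indicator (space M) w \<partial>M) = (\<integral>\<^sup>+w. (\<Prod>y\<in>B. ?Y y w) \<partial>M)"
    by (rule nn_integral_cong) auto
  also have "\<dots> = (\<Prod>y\<in>B. \<integral>\<^sup>+w. ?Y y w \<partial>M)"
    by (rule indep_vars_nn_integral) (use iY B in auto)
  also have "\<dots> \<le> (\<Prod>y\<in>B. ennreal (exp (- p / 2)))" by (intro prod_mono_ennreal EY)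
  also have "\<dots> = ennreal (exp (- p * card B / 2))"
    by (simp add: ennreal_power exp_of_nat_mult[symmetric] mult.commute)
  also have "ennreal (exp ?c) * ennreal (exp (- p * card B / 2)) = ennreal (exp (- p * card B / 4))"
    by (simp add: ennreal_mult[symmetric] exp_add[symmetric])
  finally show ?thesis by (simp add: emeasure_eq_measure mult_left_mono)
qed (use prob_le_1 in auto)

text \<open>The mean of the count is a positive power of \<open>n\<close>, so the Chernoff bound is
  stretched exponential and Borel-Cantelli works along all integers.\<close>

lemma environment_count:
  fixes z :: "int ^ 'd \<Rightarrow> 'a \<Rightarrow> real"
  assumes indep: "indep_vars (\<lambda>_. borel) z UNIV"
    and tail: "\<And>x r. prob {w\<in>space M. r < z x w} = p r"
    and lim: "((\<lambda>r. ln (p r) / ln r) \<longlongrightarrow> - \<alpha>) at_top" and \<alpha>: "0 < \<alpha>"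
    and b: "0 < \<beta>" "0 < \<epsilon>" "\<epsilon> < real CARD('d) - \<alpha> * \<beta>"
  shows "AE w in M. eventually (\<lambda>n. real n powr (real CARD('d) - \<alpha> * \<beta> - \<epsilon>)
       \<le> real (card {y\<in>cube n. real n powr \<beta> < z y w})) sequentially"
proof -
  have [measurable]: "z y \<in> borel_measurable M" for y using indep by (auto simp: indep_vars_def2)
  have p0: "0 \<le> p r" for r by (metis tail measure_nonneg)
  \<comment> \<open>One half of \<open>\<epsilon>\<close> pays for the error in the tail exponent,
    which is \<open>\<epsilon> / (2 \<beta>)\<close> because the threshold is
    \<open>n powr \<beta>\<close>; the other half absorbs the factor 1/4 of the Chernoff
    bound.\<close>
  define \<theta> where "\<theta> = real CARD('d) - \<alpha> * \<beta> - \<epsilon> / 2"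
  have \<theta>: "0 < \<theta>" using b by (simp add: \<theta>_def)
  let ?N = "\<lambda>n w. card {y\<in>cube n. real n powr \<beta> < z y w}"
  let ?B = "\<lambda>n. real (card (cube n :: (int ^ 'd) set))"
  define A where "A n = {w\<in>space M. real (?N n w) \<le> p (real n powr \<beta>) * ?B n / 4}" for n
  have A: "A n \<in> events" for n
  proof -
    have "real (?N n w) = (\<Sum>y\<in>cube n. if real n powr \<beta> < z y w then 1 else 0)" for w
      by (simp add: sum.If_cases card_cube(1) Int_def)
    then show ?thesis unfolding A_def by simp
  qed
  have lim1: "filterlim (\<lambda>n. real n powr \<beta>) at_top sequentially" using b by real_asymp
  have lower: "eventually (\<lambda>n. real n powr \<theta> \<le> p (real n powr \<beta>) * ?B n) sequentially"
  proof -
    have "0 < \<epsilon> / (2 * \<beta>)" using b by simp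
    from eventually_compose_filterlim[OF tail_bounds(2)[OF lim p0 \<alpha> this] lim1] eventually_ge_at_top[of 1]
    show ?thesis
    proof eventually_elim
      case (elim n)
      have "real n powr \<theta> = (real n powr \<beta>) powr (- \<alpha> - \<epsilon> / (2 * \<beta>)) * real n powr real CARD('d)"
        using b by (simp add: powr_powr powr_add[symmetric] \<theta>_def algebra_simps)
      also have "\<dots> \<le> p (real n powr \<beta>) * ?B n"
        using elim cube_card_bounds(1)[OF elim(2), where 'd='d] p0 by (intro mult_mono) auto
      finally show ?case .
    qed
  qed
  have "AE w in M. eventually (\<lambda>n. w \<notin> A n) sequentially"
  proof (rule borel_cantelli_eventually[OF A])
    show "summable (\<lambda>n. real n powr (-2))" by (simp add: summable_real_powr_iff)
    have "eventually (\<lambda>n. exp (- (real n powr \<theta>) / 4) \<le> real n powr (-2)) sequentially"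
      using \<theta> by real_asymp
    with lower show "eventually (\<lambda>n. prob (A n) \<le> real n powr (-2)) sequentially"
    proof eventually_elim
      case (elim n)
      have "prob (A n) \<le> exp (- p (real n powr \<beta>) * ?B n / 4)"
        unfolding A_def using count_chernoff[OF indep card_cube(1)[of n] subset_UNIV tail] by simp
      also have "\<dots> \<le> exp (- (real n powr \<theta>) / 4)" using elim by simp
      finally show ?case using elim by simp
    qed
  qed
  note AE = this
  have ev: "eventually (\<lambda>n. real n powr (real CARD('d) - \<alpha> * \<beta> - \<epsilon>) \<le> real n powr \<theta> / 4) sequentially"
  proof -
    have "eventually (\<lambda>n. real n powr (\<theta> - \<epsilon> / 2) \<le> real n powr \<theta> / 4) sequentially" using b by real_asymp
    then show ?thesis by (simp add: \<theta>_def)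
  qed
  show ?thesis using AE AE_space
  proof eventually_elim
    case (elim w)
    from elim(1) ev lower show ?case
    proof eventually_elim
      case (elim n)
      with \<open>w \<in> space M\<close> elim have "p (real n powr \<beta>) * ?B n / 4 < real (?N n w)" by (auto simp: A_def not_le)
      with elim show ?case by linarith
    qed
  qed
qed

end

section \<open>Polynomial lower bounds for the kernel\<close>

lemma translate_cube_subset:
  assumes "c \<in> cube \<rho>" "\<rho> + r \<le> R" shows "(+) c ` cube r \<subseteq> cube R"
proof (clarsimp simp: cube_iff)
  fix x :: "int ^ 'a" and i assume "\<forall>i. \<bar>x $ i\<bar> \<le> int r"
  then have "\<bar>x $ i\<bar> \<le> int r" by blast
  moreover have "\<bar>c $ i\<bar> \<le> int \<rho>" using assms(1) by (simp add: cube_iff)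
  moreover have "int \<rho> + int r \<le> int R" using assms(2) by linarith
  ultimately show "\<bar>c $ i + x $ i\<bar> \<le> int R" by linarith
qed

text \<open>Turns the bound of \<open>stay_kernel_move_ge\<close> into a pure power of
  \<open>1 / N\<close>, with one factor \<open>N\<close> absorbing the constant
  \<open>6 * 3 ^ d\<close>.\<close>

lemma move_bound:
  assumes "1 \<le> s" "0 < r" "real r \<le> N" "real n \<le> N" "6 * 3 ^ d \<le> N" "1 \<le> N"
  shows "(1 / N) ^ (d + 4) \<le> s / (2 * (real r)\<^sup>2 * (2 * real r + 1) ^ d) / (2 * real n + 1)"
proof -
  have "2 * (real r)\<^sup>2 * (2 * real r + 1) ^ d * (2 * real n + 1) \<le> 2 * N\<^sup>2 * (3 * N) ^ d * (3 * N)"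
    using assms by (intro mult_mono power_mono) auto
  also have "\<dots> = (6 * 3 ^ d) * N ^ (d + 3)"
    by (simp add: power_mult_distrib power_add power2_eq_square power3_eq_cube)
  also have "\<dots> \<le> N * N ^ (d + 3)" using assms by (intro mult_right_mono) auto
  also have "\<dots> = N ^ (d + 4)" by (simp add: eval_nat_numeral)
  finally have le: "2 * (real r)\<^sup>2 * (2 * real r + 1) ^ d * (2 * real n + 1) \<le> N ^ (d + 4)" .
  have pos: "0 < 2 * (real r)\<^sup>2 * (2 * real r + 1) ^ d * (2 * real n + 1)"
    using assms by (intro mult_pos_pos zero_less_power) auto
  have "(1 / N) ^ (d + 4) = 1 / N ^ (d + 4)" by (simp add: power_one_over)
  also have "\<dots> \<le> 1 / (2 * (real r)\<^sup>2 * (2 * real r + 1) ^ d * (2 * real n + 1))"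
    using le pos assms by (intro divide_left_mono mult_pos_pos) auto
  also have "\<dots> \<le> s / (2 * (real r)\<^sup>2 * (2 * real r + 1) ^ d * (2 * real n + 1))"
    using assms pos by (intro divide_right_mono) auto
  finally show ?thesis by simp
qed

text \<open>The middle phase produces the displacement \<open>x\<close> but may end at any point of
  \<open>R\<close>. It is bounded with killing outside \<open>R\<close>, so that the last phase only
  has to be uniform over \<open>R\<close>.\<close>

lemma lay_three_phases:
  fixes z :: "int ^ 'd \<Rightarrow> real"
  assumes z0: "\<And>a. 0 \<le> z a" and D: "admissible z L D" and sub: "R \<subseteq> D"
    and eta: "0 \<le> \<eta>0" "0 \<le> \<eta>1" "0 \<le> \<eta>2"
    and h0: "\<eta>0 \<le> stay_kernel z L D N0 0 a"
    and h1: "\<eta>1 \<le> (lay_step z L R ^^ N1) (\<lambda>k a. if k = 0 then indicator R a else 0) x a"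
    and h2: "\<And>b. b \<in> R \<Longrightarrow> \<eta>2 \<le> stay_kernel z L D N2 b y"
  shows "\<eta>0 * (\<eta>2 * \<eta>1) \<le> (lay_step z L D ^^ (N0 + (N1 + N2))) (\<lambda>k a. if k = 0 then indicator {y} a else 0) x 0"
proof -
  let ?F = "\<lambda>k a. if k = (0 :: int) then indicator {y} a else (0 :: real)"
  let ?R = "\<lambda>k a. if k = (0 :: int) then indicator R a else (0 :: real)"
  have n2: "0 \<le> (lay_step z L D ^^ N2) ?F k b" for k b by (rule lay_pow_nonneg[OF z0 D]) simp
  have "\<eta>2 * ?R k b \<le> (lay_step z L D ^^ N2) ?F k b" for k b
    using n2[of k b] h2[of b] by (auto simp: stay_kernel_def[OF z0] indicator_def)
  then have "(lay_step z L D ^^ N1) (\<lambda>k b. \<eta>2 * ?R k b) x a \<le> (lay_step z L D ^^ N1) ((lay_step z L D ^^ N2) ?F) x a"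
    by (intro lay_pow_mono[OF z0 D])
  moreover have "(lay_step z L R ^^ N1) ?R x a \<le> (lay_step z L D ^^ N1) ?R x a"
    by (rule lay_pow_dom_mono[OF z0 D sub]) simp
  then have "\<eta>2 * \<eta>1 \<le> \<eta>2 * (lay_step z L D ^^ N1) ?R x a" using h1 eta by (intro mult_left_mono) auto
  ultimately have 1: "\<eta>2 * \<eta>1 \<le> (lay_step z L D ^^ (N1 + N2)) ?F x a"
    unfolding lay_pow_cmult by (simp add: funpow_add)
  have "\<eta>0 * (\<eta>2 * \<eta>1) \<le> stay_kernel z L D N0 0 a * (lay_step z L D ^^ (N1 + N2)) ?F x a"
    using h0 1 eta by (intro mult_mono) auto
  also have "\<dots> \<le> (lay_step z L D ^^ (N0 + (N1 + N2))) ?F x 0"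
    by (rule lay_pow_compose[OF z0 D]) simp
  finally show ?thesis .
qed

text \<open>
  With \<open>k\<close> of order \<open>\<surd>t / (80 d)\<close>, the second coordinate moves by at most \<open>k\<close> along an axis during
  times slightly above \<open>2 k\<^sup>2\<close>. Chains of \<open>6 C d\<close> such moves lead from the origin to \<open>a\<close>, and, after the first coordinate has
  been displaced in \<open>N1\<close> steps, from wherever this ends to \<open>y\<close>. This takes less than half of
  the time; the walk spends the rest on a return to \<open>y\<close>.
\<close>

lemma lay_kernel_polynomial:
  fixes z :: "int ^ 'd \<Rightarrow> real" and t :: real
  defines "d \<equiv> CARD('d)"
  defines "C \<equiv> 80 * d"
  assumes z0: "\<And>a. 0 \<le> z a" and k: "0 < k" and t: "(real (C * k))\<^sup>2 \<le> t" "t \<le> (real (2 * C * k))\<^sup>2"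
    and L: "L = real N / t" and zL: "\<And>a. a \<in> cube (14 * d * C * k) \<Longrightarrow> 3 * z a + 11 * real d \<le> L"
    and N: "6 * 3 ^ d \<le> real N" "14 * d * C * k \<le> N" and y: "y \<in> cube (3 * C * k)"
    and a: "a \<in> cube (4 * d * k)" and N1: "0 < N1" "real N1 \<le> 2 * (real k)\<^sup>2 * L"
    and x: "(real_of_int x)\<^sup>2 + 1 \<le> second_moment z L (cube (4 * d * k)) N1 a"
  shows "(1 / real N) ^ ((d + 4) * (2 * (d * (6 * C)) + 1) + 4)
    \<le> (lay_step z L (cube (14 * d * C * k)) ^^ N) (\<lambda>k a. if k = 0 then indicator {y} a else 0) x 0"
proof -
  let ?D = "cube (14 * d * C * k) :: (int ^ 'd) set" and ?R = "cube (4 * d * k) :: (int ^ 'd) set"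
  \<comment> \<open>Around points of \<open>cube (3 C k)\<close>, short moves use a box of radius
    \<open>10 d k\<close> and the final wait one of radius \<open>11 d C k\<close>; both must fit
    into the domain.\<close>
  have fit: "3 * C * k + 10 * d * k \<le> 14 * d * C * k" "3 * C * k + 11 * d * C * k \<le> 14 * d * C * k"
  proof -
    have "d * k \<le> d * (d * k)" by (simp add: d_def)
    moreover have "3 * C * k + 10 * d * k = 250 * (d * k)" "14 * d * C * k = 1120 * (d * (d * k))"
      "3 * C * k + 11 * d * C * k = 240 * (d * k) + 880 * (d * (d * k))" by (simp_all add: C_def)
    ultimately show "3 * C * k + 10 * d * k \<le> 14 * d * C * k" "3 * C * k + 11 * d * C * k \<le> 14 * d * C * k"
      by linarith+
  qed
  have d1: "1 \<le> real d" by (simp add: d_def)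
  have k1: "1 \<le> real k" using k by simp
  have Ck: "1 \<le> real (C * k)" using d1 k1 by (simp add: C_def mult_ge1_I)
  have t1: "1 \<le> t" using t(1) Ck one_le_power[OF Ck, of 2] by linarith
  have L11: "11 * real d \<le> L" using zL[of 0] z0[of 0] by simp
  then have L1: "1 \<le> L" using d1 by linarith
  have D: "admissible z L ?D" unfolding admissible_def[OF z0] using zL L11 by (force simp: d_def)
  have NL: "real N = t * L" using L t1 by simp
  have Npos: "1 \<le> real N" using NL t1 L1 by (simp add: mult_ge1_I)
  have RD: "?R \<subseteq> ?D" by (rule cube_mono) (simp add: C_def d_def)
  \<comment> \<open>\<open>n0\<close> steps last for a time between \<open>2 k^2\<close> and
    \<open>3 k^2\<close>; the lower value is what a move by \<open>k\<close> requires.\<close>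
  define n0 where "n0 = nat \<lceil>2 * (real k)\<^sup>2 * L\<rceil>"
  have kk: "1 \<le> (real k)\<^sup>2" using one_le_power[OF k1] .
  have n0: "2 * (real k)\<^sup>2 * L \<le> real n0" "real n0 \<le> 3 * (real k)\<^sup>2 * L"
  proof -
    have "0 \<le> 2 * (real k)\<^sup>2 * L" using L1 by simp
    then have "2 * (real k)\<^sup>2 * L \<le> real n0" "real n0 \<le> 2 * (real k)\<^sup>2 * L + 1" unfolding n0_def by linarith+
    moreover have "1 \<le> (real k)\<^sup>2 * L" using kk L1 by (simp add: mult_ge1_I)
    ultimately show "2 * (real k)\<^sup>2 * L \<le> real n0" "real n0 \<le> 3 * (real k)\<^sup>2 * L" by linarith+
  qed
  \<comment> \<open>\<open>J\<close> moves of length \<open>k\<close> cross the width of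
    \<open>cube (3 C k)\<close>.\<close>
  define J where "J = 6 * C"
  define N0 where "N0 = d * J * n0"
  have tk: "6400 * (real d)\<^sup>2 * (real k)\<^sup>2 \<le> t" using t(1) by (simp add: C_def power_mult_distrib)
  have N0L: "real N0 \<le> 1440 * (real d)\<^sup>2 * (real k)\<^sup>2 * L"
  proof -
    have "real N0 = 480 * (real d)\<^sup>2 * real n0" by (simp add: N0_def J_def C_def power2_eq_square)
    also have "\<dots> \<le> 480 * (real d)\<^sup>2 * (3 * (real k)\<^sup>2 * L)" by (intro mult_left_mono n0) auto
    finally show ?thesis by (simp add: mult_ac)
  qed
  have dk: "1 \<le> (real d)\<^sup>2 * (real k)\<^sup>2" using one_le_power[OF d1, of 2] kk by (simp add: mult_ge1_I)
  have kd: "(real k)\<^sup>2 \<le> (real d)\<^sup>2 * (real k)\<^sup>2" using one_le_power[OF d1, of 2] by (simp add: mult_le_cancel_right1)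
  \<comment> \<open>In units of \<open>d^2 k^2 L\<close> the budget is
    \<open>1440 + 2 + 1440 + 1 <= 6400\<close>. The summand \<open>L\<close> leaves at least unit
    time for the final wait.\<close>
  have sumN: "real (N0 + N1 + N0) + L \<le> real N"
  proof -
    have "real N1 \<le> 2 * ((real d)\<^sup>2 * (real k)\<^sup>2) * L"
      using N1(2) kd L1 by (smt (verit) mult_right_mono)
    moreover have "1 * L \<le> (real d)\<^sup>2 * (real k)\<^sup>2 * L" using dk L1 by (intro mult_right_mono) auto
    moreover have "6400 * (real d)\<^sup>2 * (real k)\<^sup>2 * L \<le> real N" unfolding NL using tk L1 by (intro mult_right_mono) auto
    ultimately show ?thesis using N0L by (simp only: of_nat_add mult.assoc)
  qed
  define N3 where "N3 = N - (N0 + N1 + N0)"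
  have N3: "N0 + (N1 + (N0 + N3)) = N" "L \<le> real N3" using sumN L1 by (auto simp: N3_def)
  let ?\<eta> = "(1 / real N) ^ (d + 4)"
  have move: "?\<eta> \<le> stay_kernel z L ?D n0 c (c + axis i m)" if c: "c \<in> cube (3 * C * k)" and m: "\<bar>m\<bar> \<le> int k" for c i m
  proof -
    have s: "2 * (real k)\<^sup>2 \<le> real n0 / L" "real n0 / L \<le> 3 * (real k)\<^sup>2"
      using n0 L1 by (auto simp: pos_le_divide_eq pos_divide_le_eq)
    \<comment> \<open>The radius \<open>10 d k\<close> comes from
      \<open>28 * 3 <= 10^2\<close>.\<close>
    have "28 * real d * (real n0 / L) \<le> 28 * real d * (3 * (real k)\<^sup>2)" by (intro mult_left_mono s) auto
    also have "\<dots> \<le> 100 * (real d * real d) * (real k)\<^sup>2"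
      using d1 kk mult_right_mono[OF d1, of "real d * (real k)\<^sup>2"] by (simp add: mult.assoc)
    also have "\<dots> = (real (10 * d * k))\<^sup>2" by (simp add: power2_eq_square)
    finally have s3: "28 * real CARD('d) * (real n0 / L) \<le> (real (10 * d * k))\<^sup>2" by (simp add: d_def)
    have "?\<eta> \<le> real n0 / L / (2 * (real (10 * d * k))\<^sup>2 * (2 * real (10 * d * k) + 1) ^ d) / (2 * real n0 + 1)"
    proof (rule move_bound)
      show "1 \<le> real n0 / L" using s(1) kk by linarith
      show "0 < 10 * d * k" using k by (simp add: d_def)
      have "10 * d * k \<le> 14 * d * C * k" by (simp add: C_def d_def)
      then have "10 * d * k \<le> N" using N(2) by linarith
      then show "real (10 * d * k) \<le> real N" by (simp only: of_nat_le_iff)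
      have "1 \<le> d * J" by (simp add: d_def J_def C_def)
      then have "n0 \<le> N0" unfolding N0_def by (metis mult.commute mult_le_mono2 mult_1_right)
      then show "real n0 \<le> real N" using sumN L1 by simp
    qed (use N Npos in auto)
    also have "\<dots> \<le> stay_kernel z L ?D n0 c (c + axis i m)"
      unfolding d_def
    proof (rule stay_kernel_move_ge[OF z0, where K=k, OF _ _ _ refl])
      show "admissible z L (cube (14 * CARD('d) * C * k))" using D by (simp add: d_def)
      show "(+) c ` cube (10 * CARD('d) * k) \<subseteq> cube (14 * CARD('d) * C * k)"
        by (rule translate_cube_subset[OF c]) (use fit(1) in \<open>simp only: d_def\<close>)
      show "1 \<le> real n0 / L" using s(1) kk by linarith
    qed (use s s3 m k in \<open>auto simp: d_def\<close>)
    finally show ?thesis .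
  qed
  have eta0: "0 \<le> ?\<eta>" by simp
  have J: "2 * (3 * C * k) \<le> J * k" by (simp add: J_def)
  have chain: "?\<eta> ^ (d * J) \<le> stay_kernel z L ?D N0 b c" if "b \<in> cube (3 * C * k)" "c \<in> cube (3 * C * k)" for b c
    using stay_kernel_chain_ge[OF z0 D eta0 move that J] by (simp add: d_def N0_def)
  have Rsub: "?R \<subseteq> cube (3 * C * k)" by (rule cube_mono) (simp add: C_def d_def)
  have wait: "?\<eta> \<le> stay_kernel z L ?D N3 y y"
  proof -
    have s1: "1 \<le> real N3 / L" using N3(2) L1 by simp
    have "real N3 \<le> t * L" using NL N3(1) by (metis le_add2 add.assoc of_nat_mono)
    then have "real N3 / L \<le> t" using L1 by (simp add: pos_divide_le_eq)
    also have "t \<le> 4 * (real (C * k))\<^sup>2" using t(2) by (simp add: power_mult_distrib)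
    finally have s2: "real N3 / L \<le> 4 * (real (C * k))\<^sup>2" .
    \<comment> \<open>The radius \<open>11 d C k\<close> comes from
      \<open>28 * 4 <= 11^2\<close>.\<close>
    have "28 * real d * (real N3 / L) \<le> 28 * real d * (4 * (real (C * k))\<^sup>2)" by (intro mult_left_mono s2) auto
    also have "\<dots> \<le> 121 * (real d * real d) * (real (C * k))\<^sup>2"
    proof -
      have "1 * (real d * (real (C * k))\<^sup>2) \<le> real d * (real d * (real (C * k))\<^sup>2)"
        by (rule mult_right_mono[OF d1]) simp
      moreover have "0 \<le> real d * (real d * (real (C * k))\<^sup>2)" by simp
      ultimately show ?thesis by (simp only: mult.assoc mult_1)
    qed
    also have "\<dots> = (real (11 * d * C * k))\<^sup>2" by (simp add: power2_eq_square)
    finally have s3: "28 * real CARD('d) * (real N3 / L) \<le> (real (11 * d * C * k))\<^sup>2" by (simp add: d_def)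
    have "?\<eta> \<le> real N3 / L / (2 * (real (11 * d * C * k))\<^sup>2 * (2 * real (11 * d * C * k) + 1) ^ d) / (2 * real N3 + 1)"
    proof (rule move_bound[OF s1])
      show "0 < 11 * d * C * k" using k by (simp add: d_def C_def)
      have "11 * d * C * k \<le> 14 * d * C * k" by simp
      then show "real (11 * d * C * k) \<le> real N" using N(2) by (metis of_nat_le_iff order_trans)
      show "real N3 \<le> real N" using N3(1) by linarith
    qed (use N Npos in auto)
    \<comment> \<open>Waiting is a move by 0; its axis is arbitrary.\<close>
    also have "\<dots> \<le> stay_kernel z L ?D N3 y (y + axis undefined 0)"
      unfolding d_def
    proof (rule stay_kernel_move_ge[OF z0, where K=0, OF _ _ _ refl])
      show "admissible z L (cube (14 * CARD('d) * C * k))" using D by (simp add: d_def)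
      show "(+) y ` cube (11 * CARD('d) * C * k) \<subseteq> cube (14 * CARD('d) * C * k)"
        by (rule translate_cube_subset[OF y]) (use fit(2) in \<open>simp only: d_def\<close>)
    qed (use s1 s3 k in \<open>auto simp: d_def C_def\<close>)
    also have "y + axis undefined 0 = y" by (simp add: vec_eq_iff axis_component)
    finally show ?thesis .
  qed
  have h2: "?\<eta> ^ (d * J) * ?\<eta> \<le> stay_kernel z L ?D (N0 + N3) b y" if "b \<in> ?R" for b
  proof -
    have "?\<eta> ^ (d * J) * ?\<eta> \<le> stay_kernel z L ?D N0 b y * stay_kernel z L ?D N3 y y"
      using chain[of b y] that Rsub y wait by (intro mult_mono stay_kernel_nonneg[OF z0 D]) auto
    also have "\<dots> \<le> stay_kernel z L ?D (N0 + N3) b y" by (rule stay_kernel_compose[OF z0 D])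
    finally show ?thesis .
  qed
  have h1: "(1 / real N) ^ 4 \<le> (lay_step z L ?R ^^ N1) (\<lambda>k a. if k = 0 then indicator ?R a else 0) x a"
  proof -
    have N1N: "real N1 \<le> real N" using N3(1) by linarith
    have "(2 * real N1 + 1) * (real N1)\<^sup>2 \<le> (3 * real N) * (real N)\<^sup>2"
      using N1N Npos by (intro mult_mono power_mono) auto
    also have "\<dots> \<le> real N * (real N) ^ 3"
    proof -
      have "(3 :: real) \<le> 6 * 3 ^ d"
      proof -
        have "(1 :: real) \<le> 3 ^ d" by simp
        then show ?thesis by linarith
      qed
      then have "3 \<le> real N" using N(1) by linarith
      then have "3 * real N ^ 3 \<le> real N * real N ^ 3" by (intro mult_right_mono) auto
      then show ?thesis by (simp add: power2_eq_square power3_eq_cube)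
    qed
    finally have le: "(2 * real N1 + 1) * (real N1)\<^sup>2 \<le> real N ^ 4" by (simp add: power4_eq_xxxx power3_eq_cube)
    have "(1 / real N) ^ 4 = 1 / real N ^ 4" by (simp add: power_one_over)
    also have "\<dots> \<le> 1 / ((2 * real N1 + 1) * (real N1)\<^sup>2)"
      using le N1(1) Npos by (intro divide_left_mono mult_pos_pos) auto
    also have "\<dots> \<le> (lay_step z L ?R ^^ N1) (\<lambda>k a. if k = 0 then indicator ?R a else 0) x a"
      by (rule lay_pow_displacement_ge[OF z0 admissible_subset[OF z0 D RD] N1(1) x])
    finally show ?thesis .
  qed
  have z3: "0 \<in> cube (3 * C * k)" "a \<in> cube (3 * C * k)" using a Rsub by auto
  have "?\<eta> ^ (d * J) * ((?\<eta> ^ (d * J) * ?\<eta>) * (1 / real N) ^ 4)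
     \<le> (lay_step z L ?D ^^ (N0 + (N1 + (N0 + N3)))) (\<lambda>k a. if k = 0 then indicator {y} a else 0) x 0"
    by (rule lay_three_phases[OF z0 D RD _ _ _ chain[OF z3] h1 h2]) auto
  moreover have "?\<eta> ^ (d * J) * ((?\<eta> ^ (d * J) * ?\<eta>) * (1 / real N) ^ 4) = (1 / real N) ^ ((d + 4) * (2 * (d * (6 * C)) + 1) + 4)"
    unfolding J_def power_mult[symmetric] power_add[symmetric] by (rule arg_cong) (simp add: algebra_simps)
  ultimately show ?thesis unfolding N3(1) by simp
qed

text \<open>In time about \<open>k^2\<close> the Green function of the box is bounded below by the
  same amount at all sites of \<open>cube K\<close>, so only the sum of \<open>z\<close> matters.
  \<open>6 d K <= k\<close> gives \<open>36 d^2 K^2 <= k^2\<close>, enough for the 32 in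
  \<open>green_ge\<close>.\<close>

lemma second_moment_ge_sites:
  fixes z :: "int ^ 'd \<Rightarrow> real"
  defines "d \<equiv> CARD('d)"
  assumes z0: "\<And>a. 0 \<le> z a" and D: "admissible z L (cube (4 * d * k))" and k: "0 < k"
    and K: "6 * d * K \<le> k"
  defines "n \<equiv> nat \<lceil>(real k)\<^sup>2 * L\<rceil>"
  shows "0 < n" "real n \<le> 2 * (real k)\<^sup>2 * L"
    "(real k)\<^sup>2 * (\<Sum>a\<in>cube K. z a) / (4 * (9 * real d * real k) ^ d) \<le> second_moment z L (cube (4 * d * k)) n 0"
proof -
  let ?R = "4 * d * k"
  have L: "3 * real CARD('d) \<le> L" using D by (auto simp: admissible_def[OF z0])
  have d1: "1 \<le> real d" by (simp add: d_def)
  then have L1: "1 \<le> L" using L unfolding d_def by linarith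
  have k1: "1 \<le> real k" using k by simp
  have kk: "1 \<le> (real k)\<^sup>2" using one_le_power[OF k1] .
  have kL: "1 \<le> (real k)\<^sup>2 * L" using kk L1 by (simp add: mult_ge1_I)
  have n: "(real k)\<^sup>2 * L \<le> real n" "real n \<le> 2 * (real k)\<^sup>2 * L"
    unfolding n_def using kL by linarith+
  show n0: "0 < n" using n(1) kL by simp
  show "real n \<le> 2 * (real k)\<^sup>2 * L" by (rule n)
  have R0: "0 < ?R" using k by (simp add: d_def)
  have dd: "1 * (real d * (real k)\<^sup>2) \<le> real d * (real d * (real k)\<^sup>2)" by (rule mult_right_mono[OF d1]) simp
  have dd0: "0 \<le> real d * (real d * (real k)\<^sup>2)" by simp
  have R2: "(real ?R)\<^sup>2 = 16 * (real d * (real d * (real k)\<^sup>2))" by (simp add: power2_eq_square)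
  have K2: "36 * (real d)\<^sup>2 * (real K)\<^sup>2 \<le> (real k)\<^sup>2"
  proof -
    have "real (6 * d * K) \<le> real k" using K by (simp only: of_nat_le_iff)
    then have "(real (6 * d * K))\<^sup>2 \<le> (real k)\<^sup>2" by (rule power_mono) simp
    then show ?thesis by (simp add: power_mult_distrib)
  qed
  have KR: "K \<le> ?R"
  proof -
    have "K \<le> 6 * d * K" by (simp add: d_def)
    moreover have "k \<le> ?R" by (simp add: d_def)
    ultimately show ?thesis using K by linarith
  qed
  \<comment> \<open>With radius \<open>4 d k\<close> the starting offset costs at most 1/16 and the
    elapsed time at most 1/4.\<close>
  have surv: "1 / 2 \<le> (srw_step L (cube ?R) ^^ v) (indicator (cube ?R)) a" if v: "v < n" and a: "a \<in> cube K" for v and a :: "int ^ 'd"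
  proof -
    have "sqnorm a \<le> (\<Sum>j\<in>(UNIV :: 'd set). (real K)\<^sup>2)"
      unfolding sqnorm_def
    proof (rule sum_mono)
      fix j
      have "\<bar>a $ j\<bar> \<le> int K" using a by (simp add: cube_iff)
      then have "\<bar>real_of_int (a $ j)\<bar> \<le> \<bar>real K\<bar>" by linarith
      then show "(real_of_int (a $ j))\<^sup>2 \<le> (real K)\<^sup>2" by (simp only: abs_le_square_iff)
    qed
    then have "sqnorm a \<le> real d * (real K)\<^sup>2" by (simp add: d_def)
    also have "\<dots> \<le> real d * (real d * (real K)\<^sup>2) * 36"
    proof -
      have "1 * (real d * (real K)\<^sup>2) \<le> real d * (real d * (real K)\<^sup>2)" by (rule mult_right_mono[OF d1]) simp
      moreover have "0 \<le> real d * (real d * (real K)\<^sup>2)" by simp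
      ultimately show ?thesis by linarith
    qed
    also have "\<dots> \<le> (real k)\<^sup>2" using K2 by (simp add: power2_eq_square mult_ac)
    also have "\<dots> \<le> real d * (real d * (real k)\<^sup>2)"
      using dd mult_right_mono[OF d1, of "(real k)\<^sup>2"] by simp
    finally have "sqnorm a / (real ?R)\<^sup>2 \<le> 1 / 16"
      unfolding R2 using k d1 by (simp add: pos_divide_le_eq)
    moreover have "2 * real CARD('d) * real v / (L * (real ?R)\<^sup>2) \<le> 1 / 4"
    proof -
      have "2 * real d * real v \<le> 2 * real d * (2 * (real k)\<^sup>2 * L)" using v n(2) by (intro mult_left_mono) auto
      also have "\<dots> = L * (4 * (1 * (real d * (real k)\<^sup>2)))" by simp
      also have "\<dots> \<le> L * (4 * (real d * (real d * (real k)\<^sup>2)))" using dd L1 by (intro mult_left_mono) auto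
      finally have "2 * real d * real v \<le> 1 / 4 * (L * (real ?R)\<^sup>2)" unfolding R2 by (simp add: mult_ac)
      moreover have "0 < L * (real ?R)\<^sup>2" using L1 R0 by simp
      ultimately show ?thesis by (simp only: pos_divide_le_eq d_def)
    qed
    moreover have "2 * real CARD('d) \<le> L" using L by linarith
    ultimately show ?thesis using survival_ge[where L=L and r="?R" and a=a and n=v] R0 by linarith
  qed
  let ?C = "(2 * real ?R + 1) ^ d"
  have green: "real n / (4 * ?C) \<le> (\<Sum>v<n. (srw_step L (cube ?R) ^^ v) (indicator {0}) a)" if a: "a \<in> cube K" for a :: "int ^ 'd"
    unfolding d_def
  proof (rule green_ge[OF L n0 _ _ _ a])
    show "0 < 4 * CARD('d) * k" using R0 by (simp add: d_def)
    have "4 * real d * real n \<le> 4 * real d * (2 * (real k)\<^sup>2 * L)" using n(2) by (intro mult_left_mono) auto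
    also have "\<dots> = L * (8 * (1 * (real d * (real k)\<^sup>2)))" by simp
    also have "\<dots> \<le> L * (16 * (real d * (real d * (real k)\<^sup>2)))" using dd dd0 L1 by (intro mult_left_mono) linarith+
    finally show "4 * real CARD('d) * real n \<le> L * (real (4 * CARD('d) * k))\<^sup>2" using R2 by (simp only: d_def)
    have "32 * (real d)\<^sup>2 * (real K)\<^sup>2 \<le> (real k)\<^sup>2"
    proof -
      have "32 * (real d)\<^sup>2 * (real K)\<^sup>2 \<le> 36 * (real d)\<^sup>2 * (real K)\<^sup>2" by (intro mult_right_mono) auto
      then show ?thesis using K2 by linarith
    qed
    then have "32 * (real d)\<^sup>2 * (real K)\<^sup>2 * L \<le> (real k)\<^sup>2 * L" using L1 by (intro mult_right_mono) auto
    then show "32 * (real CARD('d))\<^sup>2 * L * (real K)\<^sup>2 \<le> real n" using n(1) by (simp add: d_def mult_ac)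
  qed
  have C: "?C \<le> (9 * real d * real k) ^ d"
  proof (rule power_mono)
    have "1 * 1 \<le> real d * real k" using d1 k1 by (intro mult_mono) auto
    then show "2 * real ?R + 1 \<le> 9 * real d * real k" by simp
  qed simp
  have C0: "0 < ?C" by (rule zero_less_power) (use of_nat_0_le_iff[of ?R, where 'a=real] in linarith)
  have sz: "0 \<le> (\<Sum>a\<in>cube K. z a)" by (intro sum_nonneg z0)
  have "(real k)\<^sup>2 * (\<Sum>a\<in>cube K. z a) / (4 * (9 * real d * real k) ^ d) \<le> (real k)\<^sup>2 * (\<Sum>a\<in>cube K. z a) / (4 * ?C)"
    using C C0 sz by (intro divide_left_mono mult_pos_pos mult_nonneg_nonneg) auto
  also have "\<dots> \<le> real n / L * (\<Sum>a\<in>cube K. z a) / (4 * ?C)"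
    using n(1) L1 sz C0 by (intro divide_right_mono mult_right_mono) (auto simp: pos_le_divide_eq)
  also have "\<dots> = (\<Sum>a\<in>cube K. z a * (real n / (4 * ?C))) / L"
    by (simp only: sum_distrib_right[symmetric]) (simp add: mult_ac)
  also have "\<dots> \<le> (\<Sum>a\<in>cube K. z a * (\<Sum>v<n. (srw_step L (cube ?R) ^^ v) (indicator {0}) a)) / L"
    using L1 green z0 by (intro divide_right_mono sum_mono mult_left_mono) auto
  also have "\<dots> \<le> second_moment z L (cube ?R) n 0"
    by (rule second_moment_ge_green[OF z0 D KR surv])
  finally show "(real k)\<^sup>2 * (\<Sum>a\<in>cube K. z a) / (4 * (9 * real d * real k) ^ d) \<le> second_moment z L (cube (4 * d * k)) n 0" .
qed

text \<open>During \<open>n\<close>, about \<open>L / (4 d)\<close>, steps the second coordinate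
  stays put with probability at least 1/4 by Bernoulli's inequality:
  \<open>n * 2 d / L <= 1/2 + 1/4\<close>, the second term being the rounding of \<open>n\<close>
  under \<open>8 d <= L\<close>.\<close>

lemma second_moment_ge_one_site:
  fixes z :: "int ^ 'd \<Rightarrow> real"
  defines "d \<equiv> CARD('d)"
  assumes z0: "\<And>a. 0 \<le> z a" and D: "admissible z L D" and L: "8 * real d \<le> L" and a: "a \<in> D" and k: "0 < k"
  defines "n \<equiv> nat \<lceil>L / (4 * real d)\<rceil>"
  shows "0 < n" "real n \<le> 2 * (real k)\<^sup>2 * L" "z a / (8 * real d) \<le> second_moment z L D n a"
proof -
  have d1: "1 \<le> real d" by (simp add: d_def)
  have L1: "8 \<le> L" using L d1 by linarith
  have L4: "2 \<le> L / (4 * real d)" using L d1 by (simp add: pos_le_divide_eq)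
  have n: "L / (4 * real d) \<le> real n" "real n \<le> L / (4 * real d) + 1"
    unfolding n_def using L4 by linarith+
  show "0 < n" using n(1) L4 by simp
  have "1 \<le> (real k)\<^sup>2" using one_le_power[of "real k" 2] k by simp
  then have "L \<le> 2 * (real k)\<^sup>2 * L" using L1 by (simp add: mult_le_cancel_right1)
  moreover have "L / (4 * real d) \<le> L / 4" using d1 L1 by (intro divide_left_mono) auto
  ultimately show "real n \<le> 2 * (real k)\<^sup>2 * L" using n(2) L1 by linarith
  have "1 / 4 \<le> 1 - real n * (2 * real d / L)"
  proof -
    have "real n * (2 * real d / L) \<le> (L / (4 * real d) + 1) * (2 * real d / L)"
      using n(2) L1 by (intro mult_right_mono) auto
    also have "\<dots> = 1 / 2 + 2 * real d / L" using L1 d1 by (simp add: field_simps)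
    also have "2 * real d / L \<le> 1 / 4" using L L1 by (simp add: pos_divide_le_eq)
    finally show ?thesis by linarith
  qed
  also have "\<dots> \<le> (1 - 2 * real d / L) ^ n"
  proof -
    have "- 1 \<le> - (2 * real d / L)" using L L1 by (simp add: pos_divide_le_eq)
    from Bernoulli_inequality[OF this, of n] show ?thesis by simp
  qed
  finally have p: "1 / 4 \<le> (1 - 2 * real d / L) ^ n" .
  have nz: "z a / (2 * real d) \<le> real n * (2 * z a / L)"
  proof -
    have "L / (4 * real d) * (2 * z a / L) \<le> real n * (2 * z a / L)" using n(1) z0[of a] L1 by (intro mult_right_mono) auto
    then show ?thesis using L1 d1 by (simp add: field_simps)
  qed
  have "z a / (2 * real d) * (1 / 4) \<le> real n * (2 * z a / L) * (1 - 2 * real d / L) ^ n"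
    using nz p z0[of a] L1 by (intro mult_mono) auto
  also have "\<dots> \<le> second_moment z L D n a"
    using second_moment_ge_site[OF z0 D a, of n] by (simp only: d_def)
  finally show "z a / (8 * real d) \<le> second_moment z L D n a" by simp
qed

lemma div_nat_ge:
  assumes "0 < m" "2 * m \<le> k" shows "real k / (2 * real m) \<le> real (k div m)"
proof -
  have "1 \<le> k div m" using assms by (simp add: Suc_le_eq div_greater_zero_iff)
  then have "1 * m \<le> k div m * m" by (rule mult_le_mono1)
  moreover have "k = k div m * m + k mod m" by simp
  moreover have "k mod m < m" using assms by simp
  ultimately have "real k \<le> real (2 * (k div m * m))" by (simp only: of_nat_le_iff)
  then show ?thesis using assms by (simp add: pos_divide_le_eq mult_ac)
qed

text \<open>For \<open>k\<close> of order \<open>sqrt t\<close> the target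
  \<open>t^(2 \<delta>)\<close> is \<open>k^(4 \<delta>)\<close>, whence the comparison of
  \<open>b\<close> with \<open>4 \<delta>\<close>. The two alternatives of \<open>cond\<close> are
  the exponents for many sites and for a single site. The threshold for \<open>k\<close> is uniform
  in \<open>L\<close>, because the clock rate will depend on \<open>t\<close> itself.\<close>

lemma second_moment_asymptotics:
  fixes z :: "int ^ 'd \<Rightarrow> real"
  defines "d \<equiv> CARD('d)"
  assumes z0: "\<And>a. 0 \<le> z a"
    and count: "eventually (\<lambda>n. real n powr (real d - \<alpha> * \<beta> - \<epsilon>) \<le> real (card {y\<in>cube n. real n powr \<beta> < z y})) sequentially"
    and b: "0 < \<beta>" "\<epsilon> < real d - \<alpha> * \<beta>" and \<delta>: "0 \<le> \<delta>"
    and cond: "4 * \<delta> < 2 + \<beta> - \<alpha> * \<beta> - \<epsilon> \<or> 4 * \<delta> < \<beta>"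
  shows "\<exists>c>0. \<exists>b>4*\<delta>. eventually (\<lambda>k. \<forall>L. 8 * real d \<le> L \<longrightarrow> admissible z L (cube (4 * d * k)) \<longrightarrow>
     (\<exists>a\<in>cube (4 * d * k). \<exists>n. 0 < n \<and> real n \<le> 2 * (real k)\<^sup>2 * L \<and>
        c * real k powr b \<le> second_moment z L (cube (4 * d * k)) n a)) sequentially"
proof -
  have d0: "0 < d" by (simp add: d_def)
  then have d1: "1 \<le> real d" by simp
  define K where "K k = k div (6 * d)" for k
  have Klim: "filterlim K sequentially sequentially"
    unfolding filterlim_at_top
  proof
    fix m
    show "eventually (\<lambda>k. m \<le> K k) sequentially"
      using eventually_ge_at_top[of "m * (6 * d)"]
      by eventually_elim (use d0 in \<open>simp add: K_def less_eq_div_iff_mult_less_eq\<close>)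
  qed
  have Kge: "real k / (12 * real d) \<le> real (K k)" if "12 * d \<le> k" for k
    using div_nat_ge[of "6 * d" k] that d0 by (simp add: K_def)
  have count': "eventually (\<lambda>k. real (K k) powr (real d - \<alpha> * \<beta> - \<epsilon>) \<le> real (card {y\<in>cube (K k). real (K k) powr \<beta> < z y})) sequentially"
    by (rule eventually_compose_filterlim[OF count Klim])
  show ?thesis
  proof (cases "4 * \<delta> < \<beta>")
    case True
    define c where "c = (1 / (12 * real d)) powr \<beta> / (8 * real d)"
    have "eventually (\<lambda>k. \<forall>L. 8 * real d \<le> L \<longrightarrow> admissible z L (cube (4 * d * k)) \<longrightarrow>
     (\<exists>a\<in>cube (4 * d * k). \<exists>n. 0 < n \<and> real n \<le> 2 * (real k)\<^sup>2 * L \<and>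
        c * real k powr \<beta> \<le> second_moment z L (cube (4 * d * k)) n a)) sequentially"
      using count' eventually_ge_at_top[of "12 * d"]
    proof eventually_elim
      case (elim k)
      have k: "0 < k" using elim(2) d0 by linarith
      have "0 < real k / (12 * real d)" using k d0 by simp
      then have K0: "0 < real (K k)" using Kge[OF elim(2)] by linarith
      then have "0 < real (K k) powr (real d - \<alpha> * \<beta> - \<epsilon>)" by simp
      with elim(1) have "0 < card {y\<in>cube (K k). real (K k) powr \<beta> < z y}" by linarith
      then obtain a where a: "a \<in> cube (K k)" "real (K k) powr \<beta> < z a" by (auto simp: card_gt_0_iff)
      have "K k \<le> k" by (simp add: K_def)
      also have "k \<le> 4 * d * k" using d0 by simp
      finally have sub: "cube (K k) \<subseteq> (cube (4 * d * k) :: (int ^ 'd) set)" by (rule cube_mono)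
      have "c * real k powr \<beta> = (real k / (12 * real d)) powr \<beta> / (8 * real d)"
        by (simp add: c_def powr_mult[symmetric] powr_divide)
      also have "\<dots> \<le> real (K k) powr \<beta> / (8 * real d)"
        using Kge[OF elim(2)] b d0 by (intro divide_right_mono powr_mono2) auto
      also have "\<dots> \<le> z a / (8 * real d)" using a d0 by (intro divide_right_mono) auto
      finally have c: "c * real k powr \<beta> \<le> z a / (8 * real d)" .
      show ?case
      proof (intro allI impI)
        fix L assume L: "8 * real d \<le> L" "admissible z L (cube (4 * d * k))"
        have a': "a \<in> cube (4 * d * k)" using a sub by blast
        note S = second_moment_ge_one_site[OF z0 L(2) L(1)[unfolded d_def] a' k, folded d_def]
        show "\<exists>a\<in>cube (4 * d * k). \<exists>n. 0 < n \<and> real n \<le> 2 * (real k)\<^sup>2 * L \<and>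
          c * real k powr \<beta> \<le> second_moment z L (cube (4 * d * k)) n a"
          using a' S c by (intro bexI[of _ a] exI[of _ "nat \<lceil>L / (4 * real d)\<rceil>"]) auto
      qed
    qed
    moreover have "0 < c" using d0 by (simp add: c_def)
    ultimately show ?thesis using True by blast
  next
    case False
    with cond have cond: "4 * \<delta> < 2 + \<beta> - \<alpha> * \<beta> - \<epsilon>" by blast
    \<comment> \<open>The growth exponent of the sum of \<open>z\<close>: that of the number of high
      sites plus \<open>\<beta>\<close>. The Green function contributes the remaining
      \<open>2 - d\<close>.\<close>
    define \<theta> where "\<theta> = real d - \<alpha> * \<beta> - \<epsilon> + \<beta>"
    have \<theta>: "0 \<le> \<theta>" using b by (simp add: \<theta>_def)
    define c where "c = (1 / (12 * real d)) powr \<theta> / (4 * (9 * real d) ^ d)"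
    have "eventually (\<lambda>k. \<forall>L. 8 * real d \<le> L \<longrightarrow> admissible z L (cube (4 * d * k)) \<longrightarrow>
     (\<exists>a\<in>cube (4 * d * k). \<exists>n. 0 < n \<and> real n \<le> 2 * (real k)\<^sup>2 * L \<and>
        c * real k powr (2 + \<beta> - \<alpha> * \<beta> - \<epsilon>) \<le> second_moment z L (cube (4 * d * k)) n a)) sequentially"
      using count' eventually_ge_at_top[of "12 * d"]
    proof eventually_elim
      case (elim k)
      have k: "0 < k" using elim(2) d0 by linarith
      have K: "6 * d * K k \<le> k" by (simp add: K_def)
      let ?N = "{y\<in>cube (K k). real (K k) powr \<beta> < z y}"
      have "(real k / (12 * real d)) powr \<theta> \<le> real (K k) powr \<theta>"
        using Kge[OF elim(2)] \<theta> by (intro powr_mono2) auto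
      also have "\<dots> = real (K k) powr (real d - \<alpha> * \<beta> - \<epsilon>) * real (K k) powr \<beta>"
        by (simp add: \<theta>_def powr_add)
      also have "\<dots> \<le> real (card ?N) * real (K k) powr \<beta>" using elim(1) by (intro mult_right_mono) auto
      also have "\<dots> = (\<Sum>y\<in>?N. real (K k) powr \<beta>)" by simp
      also have "\<dots> \<le> (\<Sum>y\<in>?N. z y)" by (intro sum_mono) auto
      also have "\<dots> \<le> (\<Sum>y\<in>cube (K k). z y)" by (rule sum_mono2) (auto simp: card_cube(1) z0)
      finally have S: "(real k / (12 * real d)) powr \<theta> \<le> (\<Sum>y\<in>cube (K k). z y)" .
      have "c * real k powr (2 + \<beta> - \<alpha> * \<beta> - \<epsilon>) = (real k)\<^sup>2 * (real k / (12 * real d)) powr \<theta> / (4 * (9 * real d * real k) ^ d)"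
      proof -
        have e: "2 + \<beta> - \<alpha> * \<beta> - \<epsilon> = 2 + \<theta> - real d" by (simp add: \<theta>_def)
        have "real k powr (2 + \<theta> - real d) = (real k)\<^sup>2 * real k powr \<theta> / real k ^ d"
          using k by (simp add: powr_diff powr_add powr_realpow)
        moreover have "(real k / (12 * real d)) powr \<theta> = (1 / (12 * real d)) powr \<theta> * real k powr \<theta>"
          by (simp add: powr_mult[symmetric])
        ultimately show ?thesis unfolding e c_def by (simp add: power_mult_distrib mult_ac)
      qed
      also have "\<dots> \<le> (real k)\<^sup>2 * (\<Sum>y\<in>cube (K k). z y) / (4 * (9 * real d * real k) ^ d)"
        using S by (intro divide_right_mono mult_left_mono) auto
      finally have c: "c * real k powr (2 + \<beta> - \<alpha> * \<beta> - \<epsilon>) \<le> (real k)\<^sup>2 * (\<Sum>y\<in>cube (K k). z y) / (4 * (9 * real d * real k) ^ d)" .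
      show ?case
      proof (intro allI impI)
        fix L assume L: "8 * real d \<le> L" "admissible z L (cube (4 * d * k))"
        note S = second_moment_ge_sites[OF z0 L(2)[unfolded d_def] k K[unfolded d_def], folded d_def]
        show "\<exists>a\<in>cube (4 * d * k). \<exists>n. 0 < n \<and> real n \<le> 2 * (real k)\<^sup>2 * L \<and>
          c * real k powr (2 + \<beta> - \<alpha> * \<beta> - \<epsilon>) \<le> second_moment z L (cube (4 * d * k)) n a"
          using S c by (intro bexI[of _ 0] exI[of _ "nat \<lceil>(real k)\<^sup>2 * L\<rceil>"]) auto
      qed
    qed
    moreover have "0 < c" using d0 by (simp add: c_def)
    ultimately show ?thesis using cond by blast
  qed
qed

text \<open>The exponent \<open>A\<close> is fixed before \<open>t\<close>, since
  \<open>lay_kernel_polynomial\<close> gives a power of \<open>1 / N\<close> depending on the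
  dimension alone. \<open>Q\<close> leaves room for rounding to lattice points.\<close>

lemma kernel_asymptotics:
  fixes z :: "int ^ 'd \<Rightarrow> real"
  defines "d \<equiv> CARD('d)"
  assumes z0: "\<And>a. 0 \<le> z a"
    and upper: "eventually (\<lambda>n. \<forall>y\<in>cube n. z y \<le> real n powr \<kappa>) sequentially" and \<kappa>: "0 < \<kappa>"
    and count: "eventually (\<lambda>n. real n powr (real d - \<alpha> * \<beta> - \<epsilon>) \<le> real (card {y\<in>cube n. real n powr \<beta> < z y})) sequentially"
    and b: "0 < \<beta>" "\<epsilon> < real d - \<alpha> * \<beta>" and \<delta>: "0 \<le> \<delta>"
    and cond: "4 * \<delta> < 2 + \<beta> - \<alpha> * \<beta> - \<epsilon> \<or> 4 * \<delta> < \<beta>" and Q: "0 \<le> Q"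
  shows "\<exists>A. eventually (\<lambda>t. \<exists>N D. 0 < N \<and> real N \<le> 2 * t powr (\<kappa> / 2 + 2) \<and> admissible z (real N / t) D \<and>
     (\<forall>x y. \<bar>real_of_int x\<bar> \<le> Q * t powr \<delta> \<longrightarrow> (\<forall>i. \<bar>real_of_int (y $ i)\<bar> \<le> sqrt t + Q) \<longrightarrow>
        y \<in> D \<and> (1 / real N) ^ A \<le> (lay_step z (real N / t) D ^^ N) (\<lambda>k a. if k = 0 then indicator {y} a else 0) x 0)) at_top"
proof -
  have d0: "0 < d" by (simp add: d_def)
  then have d1: "1 \<le> real d" by simp
  define C where "C = 80 * d"
  have C0: "0 < C" using d0 by (simp add: C_def)
  \<comment> \<open>Then \<open>C k <= sqrt t <= 2 C k\<close> as soon as \<open>k\<close> is at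
    least 1.\<close>
  define k where "k t = nat \<lfloor>sqrt t / real C\<rfloor>" for t
  from second_moment_asymptotics[OF z0 count[unfolded d_def] b(1) b(2)[unfolded d_def] \<delta> cond, folded d_def]
  obtain c b where c: "0 < c" and b4: "4 * \<delta> < b" and ev: "eventually (\<lambda>k. \<forall>L. 8 * real d \<le> L \<longrightarrow> admissible z L (cube (4 * d * k)) \<longrightarrow>
     (\<exists>a\<in>cube (4 * d * k). \<exists>n. 0 < n \<and> real n \<le> 2 * (real k)\<^sup>2 * L \<and>
        c * real k powr b \<le> second_moment z L (cube (4 * d * k)) n a)) sequentially" by blast
  have klim: "filterlim k sequentially at_top"
    unfolding filterlim_at_top
  proof
    fix m :: nat
    have "filterlim (\<lambda>t. sqrt t / real C) at_top at_top" using C0 by real_asymp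
    then have "eventually (\<lambda>t. real m \<le> sqrt t / real C) at_top" by (simp add: filterlim_at_top)
    then show "eventually (\<lambda>t. m \<le> k t) at_top"
      by eventually_elim (simp add: k_def le_nat_floor)
  qed
  have b'lim: "filterlim (\<lambda>k. 14 * d * C * k) sequentially sequentially"
    unfolding filterlim_at_top
  proof
    fix m
    show "eventually (\<lambda>k. m \<le> 14 * d * C * k) sequentially"
      using eventually_ge_at_top[of m]
    proof eventually_elim
      case (elim k)
      have "1 * k \<le> 14 * d * C * k" using d0 C0 by (intro mult_right_mono) auto
      with elim show ?case by linarith
    qed
  qed
  define A where "A = Q\<^sup>2 * (2 * real C) powr (4 * \<delta>)"
  have growth: "eventually (\<lambda>k. A * real k powr (4 * \<delta>) + 1 \<le> c * real k powr b) sequentially"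
  proof -
    have "0 < b" using b4 \<delta> by linarith
    have "((\<lambda>k. A * real k powr (4 * \<delta> - b) + real k powr (- b)) \<longlongrightarrow> A * 0 + 0) sequentially"
      by (intro tendsto_intros tendsto_neg_powr filterlim_real_sequentially) (use b4 \<open>0 < b\<close> in auto)
    then have "eventually (\<lambda>k. A * real k powr (4 * \<delta> - b) + real k powr (- b) < c) sequentially"
      using c by (intro order_tendstoD) auto
    then show ?thesis
      using eventually_gt_at_top[of 0]
    proof eventually_elim
      case (elim k)
      then have "(A * real k powr (4 * \<delta> - b) + real k powr (- b)) * real k powr b \<le> c * real k powr b"
        by (intro mult_right_mono) auto
      moreover have "(A * real k powr (4 * \<delta> - b) + real k powr (- b)) * real k powr b = A * real k powr (4 * \<delta>) + 1"
        using elim by (simp add: distrib_right mult.assoc powr_add[symmetric])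
      ultimately show ?case by simp
    qed
  qed
  \<comment> \<open>In a box of side of order \<open>sqrt t\<close> the rates are at most of order
    \<open>t^(\<kappa> / 2)\<close>; this \<open>N\<close> makes the clock rate \<open>N / t\<close>
    at least \<open>t^(\<kappa> / 2 + 1)\<close>.\<close>
  let ?N = "\<lambda>t. nat \<lceil>t powr (\<kappa> / 2 + 2)\<rceil>"
  have rate: "eventually (\<lambda>t. 3 * (14 * real d * sqrt t) powr \<kappa> + 11 * real d \<le> t powr (\<kappa> / 2 + 1)) at_top"
    using d0 \<kappa> by real_asymp
  have size: "eventually (\<lambda>t. 6 * 3 ^ d + 14 * real d * sqrt t \<le> t powr (\<kappa> / 2 + 2)) at_top"
    using d0 \<kappa> by real_asymp
  define P where "P = (d + 4) * (2 * (d * (6 * C)) + 1) + 4"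
  show ?thesis
  proof (intro exI[of _ P], use eventually_compose_filterlim[OF ev klim]
      eventually_compose_filterlim[OF eventually_compose_filterlim[OF upper b'lim] klim]
      eventually_compose_filterlim[OF growth klim]
      eventually_compose_filterlim[OF eventually_ge_at_top[of 1] klim]
      eventually_compose_filterlim[OF eventually_ge_at_top[of "nat \<lceil>Q\<rceil>"] klim]
      rate size eventually_ge_at_top[of 1] in eventually_elim)
    case (elim t)
    let ?k = "k t" and ?n = "?N t"
    let ?L = "real ?n / t" and ?D = "cube (14 * d * C * ?k) :: (int ^ 'd) set"
    have t1: "1 \<le> t" by (rule elim(8))
    have k1: "1 \<le> ?k" by (rule elim(4))
    have kk: "real (C * ?k) \<le> sqrt t" "sqrt t \<le> real (2 * C * ?k)"
    proof -
      have nn: "0 \<le> sqrt t / real C" using t1 by simp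
      have "real ?k \<le> sqrt t / real C" unfolding k_def using nn by linarith
      then show "real (C * ?k) \<le> sqrt t" using C0 by (simp add: pos_le_divide_eq mult.commute)
      have "sqrt t / real C \<le> real ?k + 1" unfolding k_def using nn by linarith
      also have "\<dots> \<le> 2 * real ?k" using k1 by simp
      finally show "sqrt t \<le> real (2 * C * ?k)" using C0 by (simp add: pos_divide_le_eq mult_ac)
    qed
    have sq: "(sqrt t)\<^sup>2 = t" using t1 by simp
    have kt: "(real (C * ?k))\<^sup>2 \<le> t" "t \<le> (real (2 * C * ?k))\<^sup>2"
      using power_mono[OF kk(1), of 2] power_mono[OF kk(2), of 2] t1 unfolding sq by auto
    have pw: "1 \<le> t powr (\<kappa> / 2 + 2)" using t1 \<kappa> by (simp add: ge_one_powr_ge_zero)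
    have n: "t powr (\<kappa> / 2 + 2) \<le> real ?n" "real ?n \<le> 2 * t powr (\<kappa> / 2 + 2)" using pw by linarith+
    have Lge: "t powr (\<kappa> / 2 + 1) \<le> ?L"
    proof -
      have "t powr (\<kappa> / 2 + 1) * t = t powr (\<kappa> / 2 + 2)"
        using t1 powr_add[of t "\<kappa> / 2 + 1" 1] by (simp add: add.assoc)
      then show ?thesis using n(1) t1 by (simp add: pos_le_divide_eq)
    qed
    have zL: "3 * z a + 11 * real d \<le> ?L" if "a \<in> ?D" for a
    proof -
      have "z a \<le> real (14 * d * C * ?k) powr \<kappa>" using elim(2) that by blast
      also have "\<dots> \<le> (14 * real d * sqrt t) powr \<kappa>"
      proof (rule powr_mono2)
        have "14 * real d * real (C * ?k) \<le> 14 * real d * sqrt t" using kk(1) by (intro mult_left_mono) auto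
        then show "real (14 * d * C * ?k) \<le> 14 * real d * sqrt t" by (simp add: mult.assoc)
      qed (use \<kappa> in auto)
      finally have "3 * z a + 11 * real d \<le> 3 * (14 * real d * sqrt t) powr \<kappa> + 11 * real d" by simp
      also have "\<dots> \<le> t powr (\<kappa> / 2 + 1)" by (rule elim(6))
      finally show ?thesis using Lge by linarith
    qed
    have L11: "11 * real d \<le> ?L" using zL[of 0] z0[of 0] by simp
    have D: "admissible z ?L ?D" unfolding admissible_def[OF z0] using zL L11 by (force simp: d_def)
    have RD: "cube (4 * d * ?k) \<subseteq> ?D" by (rule cube_mono) (use C0 in \<open>simp add: d_def\<close>)
    have N6: "6 * 3 ^ d \<le> real ?n"
    proof -
      have "0 \<le> 14 * real d * sqrt t" using t1 by simp
      then show ?thesis using elim(7) n(1) by linarith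
    qed
    have N14: "14 * d * C * ?k \<le> ?n"
    proof -
      have "14 * real d * real (C * ?k) \<le> 14 * real d * sqrt t" using kk(1) by (intro mult_left_mono) auto
      moreover have "(0 :: real) \<le> 6 * 3 ^ d" by simp
      ultimately have "14 * real d * real (C * ?k) \<le> real ?n" using elim(7) n(1) by linarith
      then have "real (14 * d * C * ?k) \<le> real ?n" by (simp add: mult.assoc)
      then show ?thesis by (simp only: of_nat_le_iff)
    qed
    from elim(1)[rule_format, of ?L] L11 d1 admissible_subset[OF z0 D RD]
    obtain a N1 where a: "a \<in> cube (4 * d * ?k)" and N1: "0 < N1" "real N1 \<le> 2 * (real ?k)\<^sup>2 * ?L"
      and S: "c * real ?k powr b \<le> second_moment z ?L (cube (4 * d * ?k)) N1 a" by auto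
    have main: "y \<in> ?D \<and> (1 / real ?n) ^ P \<le> (lay_step z ?L ?D ^^ ?n) (\<lambda>k a. if k = 0 then indicator {y} a else 0) x 0"
      if x: "\<bar>real_of_int x\<bar> \<le> Q * t powr \<delta>" and y: "\<forall>i. \<bar>real_of_int (y $ i)\<bar> \<le> sqrt t + Q" for x and y :: "int ^ 'd"
    proof -
      have Qk: "Q \<le> real (C * ?k)"
      proof -
        have "Q \<le> real ?k" using elim(5) by linarith
        also have "\<dots> \<le> real (C * ?k)" using C0 by (simp add: mult_le_cancel_right1)
        finally show ?thesis .
      qed
      have y3: "y \<in> cube (3 * C * ?k)"
        unfolding cube_iff
      proof
        fix i
        have "\<bar>real_of_int (y $ i)\<bar> \<le> real (2 * C * ?k) + real (C * ?k)" using y[rule_format, of i] kk(2) Qk by linarith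
        also have "\<dots> = real (3 * C * ?k)" by simp
        finally show "\<bar>y $ i\<bar> \<le> int (3 * C * ?k)" by linarith
      qed
      have "cube (3 * C * ?k) \<subseteq> ?D" by (rule cube_mono) (use d0 in simp)
      with y3 have yD: "y \<in> ?D" by blast
      have w: "0 < real (2 * C * ?k)" using k1 C0 by simp
      have "t powr (2 * \<delta>) \<le> ((real (2 * C * ?k))\<^sup>2) powr (2 * \<delta>)"
        using kt(2) t1 \<delta> by (intro powr_mono2) auto
      also have "(real (2 * C * ?k))\<^sup>2 = real (2 * C * ?k) powr 2" using w by simp
      also have "(real (2 * C * ?k) powr 2) powr (2 * \<delta>) = real (2 * C * ?k) powr (4 * \<delta>)"
        by (simp only: powr_powr) simp
      also have "\<dots> = (2 * real C) powr (4 * \<delta>) * real ?k powr (4 * \<delta>)" by (simp add: powr_mult)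
      finally have T: "t powr (2 * \<delta>) \<le> (2 * real C) powr (4 * \<delta>) * real ?k powr (4 * \<delta>)" .
      have "(real_of_int x)\<^sup>2 \<le> (Q * t powr \<delta>)\<^sup>2" using power_mono[OF x, of 2] by simp
      also have "\<dots> = Q\<^sup>2 * t powr (2 * \<delta>)"
      proof -
        have "(t powr \<delta>)\<^sup>2 = t powr (2 * \<delta>)" by (simp add: power2_eq_square powr_add[symmetric])
        then show ?thesis by (simp add: power_mult_distrib)
      qed
      also have "\<dots> \<le> Q\<^sup>2 * ((2 * real C) powr (4 * \<delta>) * real ?k powr (4 * \<delta>))"
        using T by (rule mult_left_mono) simp
      finally have "(real_of_int x)\<^sup>2 \<le> A * real ?k powr (4 * \<delta>)" by (simp add: A_def mult.assoc)
      then have xS: "(real_of_int x)\<^sup>2 + 1 \<le> second_moment z ?L (cube (4 * d * ?k)) N1 a"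
        using elim(3) S by linarith
      have "(1 / real ?n) ^ P \<le> (lay_step z ?L ?D ^^ ?n) (\<lambda>k a. if k = 0 then indicator {y} a else 0) x 0"
        using lay_kernel_polynomial[OF z0 _ kt[unfolded C_def d_def] refl zL[unfolded C_def d_def]
            N6[unfolded d_def] N14[unfolded C_def d_def] y3[unfolded C_def d_def] a[unfolded d_def] N1 xS[unfolded d_def]] k1
        unfolding P_def C_def d_def by simp
      with yD show ?thesis by blast
    qed
    show ?case
      using main D n pw by (intro exI[of _ ?n] exI[of _ ?D]) auto
  qed
qed

section \<open>Return to continuous time\<close>

lemma gen_step_layered:
  fixes z :: "int ^ 'd \<Rightarrow> real" and f :: "'d site \<Rightarrow> real"
  assumes z0: "\<And>a. 0 \<le> z a"
  shows "gen_step (layered_rate z) (exit_rate (layered_rate z)) L {x. snd x \<in> D} f (k, a)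
    = lay_step z L D (\<lambda>k a. f (k, a)) k a"
proof -
  let ?x = "(k, a) :: 'd site"
  let ?c = "layered_rate z ?x"
  let ?D1 = "{?x + (1, 0), ?x - (1, 0)}"
  let ?D2 = "range (\<lambda>i. ?x + (0, axis i 1))" and ?D3 = "range (\<lambda>i. ?x - (0, axis i 1))"
  have sub: "{y. ?c y \<noteq> 0} \<subseteq> ?D1 \<union> (?D2 \<union> ?D3)"
    by (auto simp: layered_rate_def split: if_splits)
  have d1: "?D1 \<inter> (?D2 \<union> ?D3) = {}" by auto
  have ax: "axis i (1::int) \<noteq> - axis j 1" for i j :: 'd
    by (auto simp: vec_eq_iff axis_def dest!: spec[of _ i])
  have d2: "?D2 \<inter> ?D3 = {}"
  proof -
    have "?x + (0, axis i 1) \<noteq> ?x - (0, axis j 1)" for i j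
      using ax[of i j] by (simp add: diff_conv_add_uminus del: add_uminus_conv_diff)
    then show ?thesis by blast
  qed
  have inj: "inj (\<lambda>i. ?x + (0, axis i 1))" "inj (\<lambda>i. ?x - (0, axis i 1))"
    by (auto simp: inj_on_def axis_eq_axis)
  have c1: "?c y = z a" if "y \<in> ?D1" for y using that by (auto simp: layered_rate_def)
  have c2: "?c y = 1" if "y \<in> ?D2 \<union> ?D3" for y
  proof -
    have "y \<notin> ?D1" using that d1 by blast
    then have "\<not> (y = ?x + (1, 0) \<or> y = ?x - (1, 0))" by simp
    moreover have "\<exists>i. y = ?x + (0, axis i 1) \<or> y = ?x - (0, axis i 1)" using that by blast
    ultimately show ?thesis unfolding layered_rate_def by simp
  qed
  have "(\<Sum>y | ?c y \<noteq> 0. ?c y * f y) = (\<Sum>y\<in>?D1 \<union> (?D2 \<union> ?D3). ?c y * f y)"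
    using sub by (intro sum.mono_neutral_left) auto
  also have "\<dots> = (\<Sum>y\<in>?D1. ?c y * f y) + ((\<Sum>y\<in>?D2. ?c y * f y) + (\<Sum>y\<in>?D3. ?c y * f y))"
    using d1 d2 by (subst sum.union_disjoint; simp?)+
  also have "(\<Sum>y\<in>?D1. ?c y * f y) = (\<Sum>y\<in>?D1. z a * f y)" by (intro sum.cong refl) (simp only: c1)
  also have "\<dots> = z a * (f (k + 1, a) + f (k - 1, a))" by (simp add: distrib_left)
  also have "(\<Sum>y\<in>?D2. ?c y * f y) = (\<Sum>y\<in>?D2. f y)" by (intro sum.cong refl) (simp add: c2)
  also have "\<dots> = (\<Sum>i\<in>UNIV. f (k, a + axis i 1))" using inj(1) by (subst sum.reindex) auto
  also have "(\<Sum>y\<in>?D3. ?c y * f y) = (\<Sum>y\<in>?D3. f y)" by (intro sum.cong refl) (simp add: c2)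
  also have "\<dots> = (\<Sum>i\<in>UNIV. f (k, a - axis i 1))" using inj(2) by (subst sum.reindex) auto
  finally have "(\<Sum>y | ?c y \<noteq> 0. ?c y * f y) = z a * (f (k + 1, a) + f (k - 1, a)) +
     (\<Sum>i\<in>UNIV. f (k, a + axis i 1) + f (k, a - axis i 1))" by (simp add: sum.distrib)
  then show ?thesis
    by (simp add: gen_step_def lay_step_def layered_rate_properties(3)[OF z0] add_divide_distrib)
qed

lemma gen_pow_layered:
  fixes z :: "int ^ 'd \<Rightarrow> real" and f :: "'d site \<Rightarrow> real"
  assumes z0: "\<And>a. 0 \<le> z a"
  shows "(\<lambda>k a. (gen_step (layered_rate z) (exit_rate (layered_rate z)) L {x. snd x \<in> D} ^^ n) f (k, a))
    = (lay_step z L D ^^ n) (\<lambda>k a. f (k, a))"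
proof (induction n)
  case (Suc n)
  show ?case by (simp add: gen_step_layered[OF z0] Suc)
qed simp

lemma layered_walk_prob_ge:
  fixes z :: "int ^ 'd \<Rightarrow> real" and X :: "real \<Rightarrow> 'b \<Rightarrow> 'd site"
  assumes chain: "markov_chain_with_rates Pr X (layered_rate z) 0" and z0: "\<And>a. 0 \<le> z a"
    and t: "0 < t" and N: "0 < N" and D: "admissible z (real N / t) D" and y: "y \<in> D"
  shows "1 / (exp 1 * real N) * (lay_step z (real N / t) D ^^ N) (\<lambda>k a. if k = 0 then indicator {y} a else 0) (- x) 0
    \<le> measure Pr {w \<in> space Pr. X t w = (x, y)}"
proof -
  let ?L = "real N / t" and ?D = "{u :: 'd site. snd u \<in> D}"
  let ?G = "gen_step (layered_rate z) (exit_rate (layered_rate z)) ?L ?D"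
  let ?F = "\<lambda>k a. if k = (0 :: int) then indicator {y} a else (0 :: real)"
  have L: "0 < ?L" using t N by simp
  have d0: "0 < real CARD('d)" by simp
  have q: "exit_rate (layered_rate z) u = 2 * z (snd u) + 2 * real CARD('d)" for u :: "'d site"
    by (simp add: layered_rate_properties(3)[OF z0])
  have "exp (- ?L * t) * ((?L * t) ^ N / fact N * (?G ^^ N) (indicator {(x, y)}) 0)
    \<le> measure Pr {w \<in> space Pr. X t w = (x, y)}"
  proof (rule markov_chain_prob_ge[OF chain])
    show "0 \<le> layered_rate z u v" for u v by (rule layered_rate_properties(1)[OF z0])
    show "finite {v. layered_rate z u v \<noteq> 0}" for u by (rule layered_rate_properties(2)[OF z0])
    show "0 < exit_rate (layered_rate z) u" for u unfolding q using z0[of "snd u"] d0 by linarith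
    show "exit_rate (layered_rate z) u \<le> ?L" if "u \<in> ?D" for u
    proof -
      have "3 * z (snd u) + 3 * real CARD('d) \<le> ?L" using D that by (simp add: admissible_def[OF z0])
      then show ?thesis unfolding q using z0[of "snd u"] d0 by linarith
    qed
  qed (use L t y in auto)
  \<comment> \<open>By translation in the first coordinate, going from 0 to \<open>(x, y)\<close> is
    the same as going from \<open>(- x, 0)\<close> to \<open>(0, y)\<close>.\<close>
  moreover have "(?G ^^ N) (indicator {(x, y)}) 0 = (lay_step z ?L D ^^ N) ?F (- x) 0"
  proof -
    have "(\<lambda>k a. indicator {(x, y)} (k, a)) = (\<lambda>k. ?F (k + - x))"
      by (auto simp: fun_eq_iff indicator_def)
    then have "(lay_step z ?L D ^^ N) (\<lambda>k a. indicator {(x, y)} (k, a)) 0 0 = (lay_step z ?L D ^^ N) (\<lambda>k. ?F (k + - x)) 0 0"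
      by (simp only:)
    also have "\<dots> = (lay_step z ?L D ^^ N) ?F (0 + - x) 0" by (rule fun_cong[OF fun_cong[OF lay_pow_shift]])
    finally have "(lay_step z ?L D ^^ N) (\<lambda>k a. indicator {(x, y)} (k, a)) 0 0 = (lay_step z ?L D ^^ N) ?F (- x) 0"
      by simp
    moreover have "(?G ^^ N) (indicator {(x, y)}) (0, 0) = (lay_step z ?L D ^^ N) (\<lambda>k a. indicator {(x, y)} (k, a)) 0 0"
      by (rule fun_cong[OF fun_cong[OF gen_pow_layered[where z=z and f="indicator {(x, y)}", OF z0]]])
    ultimately show ?thesis by (simp add: zero_prod_def)
  qed
  moreover have "?L * t = real N" using t by simp
  ultimately have le: "exp (- real N) * (real N ^ N / fact N) * (lay_step z ?L D ^^ N) ?F (- x) 0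
    \<le> measure Pr {w \<in> space Pr. X t w = (x, y)}" by (simp add: mult.assoc)
  have "0 \<le> (lay_step z ?L D ^^ N) ?F (- x) 0" by (rule lay_pow_nonneg[OF z0 D]) simp
  then have "1 / (exp 1 * real N) * (lay_step z ?L D ^^ N) ?F (- x) 0
    \<le> exp (- real N) * (real N ^ N / fact N) * (lay_step z ?L D ^^ N) ?F (- x) 0"
    by (intro mult_right_mono poisson_mode_ge N)
  with le show ?thesis by linarith
qed

section \<open>Lattice rounding and choice of exponents\<close>

lemma closest_site_bounds:
  fixes p :: "real \<times> (real ^ 'd)"
  assumes "closest_site p x"
  shows "\<bar>real_of_int (fst x) - fst p\<bar> \<le> 1 + real CARD('d)"
    and "\<bar>real_of_int (snd x $ i) - snd p $ i\<bar> \<le> 1 + real CARD('d)"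
proof -
  define x' :: "'d site" where "x' = (\<lfloor>fst p\<rfloor>, \<chi> i. \<lfloor>snd p $ i\<rfloor>)"
  have "dist (real_site x') p \<le> dist (fst (real_site x')) (fst p) + dist (snd (real_site x')) (snd p)"
    unfolding dist_prod_def by (rule sqrt_sum_squares_le_sum) auto
  also have "dist (fst (real_site x')) (fst p) \<le> 1"
    by (simp add: real_site_def x'_def dist_real_def) linarith
  also have "dist (snd (real_site x')) (snd p) \<le> (\<Sum>i\<in>UNIV. \<bar>(snd (real_site x') - snd p) $ i\<bar>)"
    unfolding dist_norm by (rule norm_le_l1_cart)
  also have "\<dots> \<le> (\<Sum>i\<in>(UNIV :: 'd set). 1)"
  proof (rule sum_mono)
    fix i show "\<bar>(snd (real_site x') - snd p) $ i\<bar> \<le> 1" by (simp add: real_site_def x'_def) linarith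
  qed
  finally have "dist (real_site x') p \<le> 1 + real CARD('d)" by simp
  with assms have d: "dist (real_site x) p \<le> 1 + real CARD('d)"
    unfolding closest_site_def by (metis order_trans)
  have "dist (fst (real_site x)) (fst p) \<le> dist (real_site x) p" by (rule dist_fst_le)
  with d show "\<bar>real_of_int (fst x) - fst p\<bar> \<le> 1 + real CARD('d)" by (simp add: real_site_def dist_real_def)
  have "dist (snd (real_site x) $ i) (snd p $ i) \<le> dist (snd (real_site x)) (snd p)" by (rule dist_vec_nth_le)
  also have "\<dots> \<le> dist (real_site x) p" by (rule dist_snd_le)
  finally show "\<bar>real_of_int (snd x $ i) - snd p $ i\<bar> \<le> 1 + real CARD('d)"
    using d by (simp add: real_site_def dist_real_def)
qed

text \<open>The three cases take \<open>\<beta>\<close> near 0, near \<open>1 / \<alpha>\<close>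
  with many sites, and below \<open>d / \<alpha>\<close> with a single site. High sites exist only
  for \<open>\<alpha> \<beta> < d\<close>. At \<open>\<beta> = d / \<alpha>\<close> many sites give
  \<open>2 - d + d / \<alpha>\<close>, which beats the single-site value \<open>d / \<alpha>\<close>
  only if \<open>d = 1\<close>.\<close>

lemma admissible_exponents:
  fixes \<alpha> \<delta> :: real
  assumes \<alpha>: "0 < \<alpha>" and d: "1 \<le> d"
    and \<delta>: "d = 1 \<and> \<delta> < max (1 / 2) ((\<alpha> + 1) / (4 * \<alpha>)) \<or> \<delta> < max (1 / 2) (d / (4 * \<alpha>)) \<and> 2 \<le> d"
  shows "\<exists>\<beta> \<epsilon>. 0 < \<beta> \<and> 0 < \<epsilon> \<and> \<epsilon> < d - \<alpha> * \<beta> \<and>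
    (4 * max \<delta> 0 < 2 + \<beta> - \<alpha> * \<beta> - \<epsilon> \<or> 4 * max \<delta> 0 < \<beta>)"
proof -
  let ?\<delta> = "max \<delta> 0"
  consider "4 * ?\<delta> < 2" | "d = 1" "4 * ?\<delta> < 1 + 1 / \<alpha>" | "4 * ?\<delta> < d / \<alpha>"
  proof -
    have eq: "(\<alpha> + 1) / (4 * \<alpha>) = (1 + 1 / \<alpha>) / 4" "d / (4 * \<alpha>) = d / \<alpha> / 4"
      using \<alpha> by (auto simp: field_simps)
    have pos: "0 < 1 / \<alpha>" "0 < d / \<alpha>" using \<alpha> d by auto
    have "4 * ?\<delta> < b" if "\<delta> < b / 4" "0 < b" for b using that by auto
    from this[of 2] this[of "1 + 1 / \<alpha>"] this[of "d / \<alpha>"] show ?thesis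
      using \<delta> that pos unfolding eq less_max_iff_disj by linarith
  qed
  then show ?thesis
  proof cases
    case 1
    define s where "s = 2 - 4 * ?\<delta>"
    have s: "0 < s" using 1 by (simp add: s_def)
    define \<beta> where "\<beta> = min (1 / 2) (s / 4) / \<alpha>"
    have \<beta>: "0 < \<beta>" "\<alpha> * \<beta> \<le> 1 / 2" "\<alpha> * \<beta> \<le> s / 4" using s \<alpha> by (auto simp: \<beta>_def)
    define \<epsilon> where "\<epsilon> = min (1 / 4) (s / 4)"
    have "0 < \<epsilon>" "\<epsilon> \<le> 1 / 4" "\<epsilon> \<le> s / 4" using s by (auto simp: \<epsilon>_def)
    moreover from this have "\<epsilon> < d - \<alpha> * \<beta>" using \<beta> d by linarith
    moreover have "2 - s < 2 + \<beta> - \<alpha> * \<beta> - \<epsilon>" using \<beta> s \<open>\<epsilon> \<le> s / 4\<close> by linarith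
    then have "4 * ?\<delta> < 2 + \<beta> - \<alpha> * \<beta> - \<epsilon>" by (simp only: s_def diff_diff_eq2 add_diff_cancel_left')
    ultimately show ?thesis using \<beta>(1) by blast
  next
    case 2
    define s where "s = 1 + 1 / \<alpha> - 4 * ?\<delta>"
    have s: "0 < s" using 2 by (simp add: s_def)
    \<comment> \<open>\<open>\<eta> = 1 - \<alpha> \<beta>\<close> is the distance from the critical
      value. It lowers \<open>\<beta>\<close> by \<open>\<eta> / \<alpha> <= s / 4\<close> and
      leaves room for \<open>\<epsilon>\<close> below \<open>\<eta>\<close>.\<close>
    define \<eta> where "\<eta> = min (1 / 2) (s * \<alpha> / 4)"
    have \<eta>: "0 < \<eta>" "\<eta> \<le> 1 / 2" "\<eta> / \<alpha> \<le> s / 4"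
    proof -
      show "0 < \<eta>" "\<eta> \<le> 1 / 2" using s \<alpha> by (auto simp: \<eta>_def)
      have "\<eta> \<le> s / 4 * \<alpha>" by (simp add: \<eta>_def)
      then show "\<eta> / \<alpha> \<le> s / 4" using \<alpha> by (simp only: pos_divide_le_eq)
    qed
    define \<beta> where "\<beta> = (1 - \<eta>) / \<alpha>"
    have \<beta>: "0 < \<beta>" "\<alpha> * \<beta> = 1 - \<eta>" "\<beta> = 1 / \<alpha> - \<eta> / \<alpha>"
    proof -
      show "0 < \<beta>" using \<eta> \<alpha> unfolding \<beta>_def by (intro divide_pos_pos) linarith+
      show "\<alpha> * \<beta> = 1 - \<eta>" using \<alpha> by (simp add: \<beta>_def)
      show "\<beta> = 1 / \<alpha> - \<eta> / \<alpha>" unfolding \<beta>_def by (rule diff_divide_distrib)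
    qed
    define \<epsilon> where "\<epsilon> = min (\<eta> / 2) (s / 4)"
    have e: "0 < \<epsilon>" "\<epsilon> \<le> \<eta> / 2" "\<epsilon> \<le> s / 4" using s \<eta> by (auto simp: \<epsilon>_def)
    have "\<epsilon> < d - \<alpha> * \<beta>" using e \<eta> \<beta>(2) 2(1) by linarith
    moreover have "1 + 1 / \<alpha> - s < 2 + \<beta> - \<alpha> * \<beta> - \<epsilon>" using \<beta>(2,3) \<eta> e s by linarith
    then have "4 * ?\<delta> < 2 + \<beta> - \<alpha> * \<beta> - \<epsilon>" by (simp only: s_def diff_diff_eq2 add_diff_cancel_left')
    ultimately show ?thesis using \<beta>(1) e(1) by blast
  next
    case 3
    define \<beta> where "\<beta> = (4 * ?\<delta> + d / \<alpha>) / 2"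
    have \<beta>: "0 < \<beta>" "4 * ?\<delta> < \<beta>" "\<beta> < d / \<alpha>"
    proof -
      have "0 < (4 * u + v) / 2 \<and> 4 * u < (4 * u + v) / 2 \<and> (4 * u + v) / 2 < v" if "0 \<le> u" "4 * u < v" for u v :: real
        using that by (simp add: field_simps)
      from this[OF _ 3] show "0 < \<beta>" "4 * ?\<delta> < \<beta>" "\<beta> < d / \<alpha>" unfolding \<beta>_def by auto
    qed
    have "\<alpha> * \<beta> < d" using \<beta>(3) \<alpha> by (simp add: pos_less_divide_eq mult.commute)
    then have "0 < (d - \<alpha> * \<beta>) / 2" "(d - \<alpha> * \<beta>) / 2 < d - \<alpha> * \<beta>" by auto
    with \<beta> show ?thesis by blast
  qed
qed

theorem theorem4:
  fixes M :: "'a measure"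
    and z :: "int ^ 'd \<Rightarrow> 'a \<Rightarrow> real"
    and P :: "'a \<Rightarrow> 'd site \<Rightarrow> 'b measure"
    and X :: "real \<Rightarrow> 'b \<Rightarrow> 'd site"
    and \<alpha> \<gamma> \<delta> :: real
    and e :: "real \<times> (real ^ 'd)"
  assumes "prob_space M"
    and "0 < \<alpha>"
    and "\<And>x \<omega>. \<omega> \<in> space M \<Longrightarrow> 0 \<le> z x \<omega>"
    and "prob_space.indep_vars M (\<lambda>_. borel) z UNIV"
    and "\<And>x y. distr M borel (z x) = distr M borel (z y)"
    and "\<And>x. ((\<lambda>r. ln (measure M {\<omega> \<in> space M. r < z x \<omega>}) / ln r) \<longlongrightarrow> - \<alpha>) at_top"
    and "\<And>\<omega> x. \<omega> \<in> space M \<Longrightarrow>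
           markov_chain_with_rates (P \<omega> x) X (layered_rate (\<lambda>y. z y \<omega>)) x"
    and "\<gamma> \<le> 1 / 2"
    and "norm e = 1" and "e \<bullet> (1, 0) = 0"
    and "CARD('d) = 1 \<and> \<delta> < max (1 / 2) ((\<alpha> + 1) / (4 * \<alpha>)) \<or>
         CARD('d) \<ge> 2 \<and> \<delta> < max (1 / 2) (real CARD('d) / (4 * \<alpha>))"
  shows "AE \<omega> in M. \<exists>m>0. \<forall>\<^sub>F t in at_top. \<forall>x.
           closest_site (t powr \<delta> *\<^sub>R (1, 0) + t powr \<gamma> *\<^sub>R e) x \<longrightarrow>
           t powr (- m) \<le> measure (P \<omega> 0) {w \<in> space (P \<omega> 0). X t w = x}"
proof -
  interpret prob_space M by fact
  let ?d = "real CARD('d)"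
  have meas: "z x \<in> borel_measurable M" for x using assms(4) by (auto simp: indep_vars_def2)
  define p where "p r = measure M {\<omega> \<in> space M. r < z 0 \<omega>}" for r
  have tail: "prob {\<omega>\<in>space M. r < z x \<omega>} = p r" for x r
  proof -
    have "prob {\<omega>\<in>space M. r < z x \<omega>} = measure (distr M borel (z x)) {r<..}" for x
      using meas[of x] by (subst measure_distr) (auto intro!: arg_cong[where f=prob])
    then show ?thesis unfolding p_def using assms(5)[of x 0] by metis
  qed
  have lim: "((\<lambda>r. ln (p r) / ln r) \<longlongrightarrow> - \<alpha>) at_top"
    unfolding p_def by (rule assms(6))
  \<comment> \<open>For negative \<open>\<delta>\<close> the first coordinate of the target stays
    bounded, which the exponent 0 covers together with the rounding.\<close>
  define \<delta>' where "\<delta>' = max \<delta> 0"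
  have d1: "1 \<le> ?d" by simp
  obtain \<beta> \<epsilon> where b: "0 < \<beta>" "0 < \<epsilon>" "\<epsilon> < ?d - \<alpha> * \<beta>"
    and cond: "4 * \<delta>' < 2 + \<beta> - \<alpha> * \<beta> - \<epsilon> \<or> 4 * \<delta>' < \<beta>"
    using admissible_exponents[OF assms(2) d1, of \<delta>] assms(11) unfolding \<delta>'_def by auto
  define \<kappa> where "\<kappa> = 2 * (?d + 2) / \<alpha>"
  have \<kappa>: "0 < \<kappa>" using assms(2) by (simp add: \<kappa>_def add_pos_pos)
  have e1: "fst e = 0" using assms(10) by (simp add: inner_prod_def)
  have e2: "\<bar>snd e $ i\<bar> \<le> 1" for i
  proof -
    have "\<bar>snd e $ i\<bar> \<le> norm (snd e)" by (rule component_le_norm_cart)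
    also have "\<dots> \<le> norm e" by (metis norm_snd_le prod.collapse)
    finally show ?thesis using assms(9) by simp
  qed
  have upper: "AE \<omega> in M. eventually (\<lambda>n. \<forall>y\<in>cube n. z y \<omega> \<le> real n powr \<kappa>) sequentially"
    unfolding \<kappa>_def by (rule environment_upper[OF meas tail lim assms(2)])
  have count: "AE \<omega> in M. eventually (\<lambda>n. real n powr (?d - \<alpha> * \<beta> - \<epsilon>)
       \<le> real (card {y\<in>cube n. real n powr \<beta> < z y \<omega>})) sequentially"
    by (rule environment_count[OF assms(4) tail lim assms(2) b])
  show ?thesis
    using upper count AE_space
  proof eventually_elim
    case (elim \<omega>)
    have z0: "0 \<le> z a \<omega>" for a using assms(3) elim(3) by blast
    \<comment> \<open>The rounding error is at most \<open>1 + d\<close>; one more unit is for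
      \<open>t powr \<delta>\<close> itself.\<close>
    have \<delta>0: "0 \<le> \<delta>'" and Q: "0 \<le> 2 + ?d" by (auto simp: \<delta>'_def)
    from kernel_asymptotics[OF z0 elim(1) \<kappa> elim(2) b(1) b(3) \<delta>0 cond Q]
    obtain A where ev: "eventually (\<lambda>t. \<exists>N D. 0 < N \<and> real N \<le> 2 * t powr (\<kappa> / 2 + 2) \<and>
      admissible (\<lambda>y. z y \<omega>) (real N / t) D \<and>
      (\<forall>x y. \<bar>real_of_int x\<bar> \<le> (2 + ?d) * t powr \<delta>' \<longrightarrow> (\<forall>i. \<bar>real_of_int (y $ i)\<bar> \<le> sqrt t + (2 + ?d)) \<longrightarrow>
        y \<in> D \<and> (1 / real N) ^ A \<le> (lay_step (\<lambda>y. z y \<omega>) (real N / t) D ^^ N) (\<lambda>k a. if k = 0 then indicator {y} a else 0) x 0)) at_top"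
      by blast
    \<comment> \<open>There are \<open>A + 1\<close> factors
      \<open>N <= t powr (\<kappa> / 2 + 3)\<close>, \<open>A\<close> from the kernel and one from
      the Poisson weight. The constant \<open>e <= 3 <= t\<close> takes one more power, and one is
      to spare.\<close>
    define m where "m = (\<kappa> / 2 + 3) * real (A + 1) + 2"
    have m: "0 < m" using \<kappa> by (simp add: m_def add_nonneg_pos)
    from ev eventually_ge_at_top[of 3]
    have "\<forall>\<^sub>F t in at_top. \<forall>x. closest_site (t powr \<delta> *\<^sub>R (1, 0) + t powr \<gamma> *\<^sub>R e) x \<longrightarrow>
           t powr (- m) \<le> measure (P \<omega> 0) {w \<in> space (P \<omega> 0). X t w = x}"
    proof eventually_elim
      case (elim t)
      then have t3: "3 \<le> t" by simp
      from elim(1) obtain N D where N: "0 < N" "real N \<le> 2 * t powr (\<kappa> / 2 + 2)"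
        and D: "admissible (\<lambda>y. z y \<omega>) (real N / t) D"
        and K: "\<And>x y. \<bar>real_of_int x\<bar> \<le> (2 + ?d) * t powr \<delta>' \<Longrightarrow> (\<And>i. \<bar>real_of_int (y $ i)\<bar> \<le> sqrt t + (2 + ?d)) \<Longrightarrow>
          y \<in> D \<and> (1 / real N) ^ A \<le> (lay_step (\<lambda>y. z y \<omega>) (real N / t) D ^^ N) (\<lambda>k a. if k = 0 then indicator {y} a else 0) x 0"
        by blast
      show ?case
      proof (intro allI impI)
        fix x :: "'d site"
        let ?p = "t powr \<delta> *\<^sub>R (1, 0) + t powr \<gamma> *\<^sub>R e"
        assume x: "closest_site ?p x"
        have "t powr \<delta> \<le> t powr \<delta>'" using t3 by (intro powr_mono) (auto simp: \<delta>'_def)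
        moreover have "1 \<le> t powr \<delta>'" using t3 \<delta>0 by (simp add: ge_one_powr_ge_zero)
        then have "1 + ?d \<le> (1 + ?d) * t powr \<delta>'" by (simp add: mult_le_cancel_left1)
        moreover have "\<bar>real_of_int (fst x)\<bar> \<le> t powr \<delta> + (1 + ?d)"
        proof -
          have "fst ?p = t powr \<delta>" by (simp add: e1)
          moreover have "0 \<le> t powr \<delta>" by simp
          ultimately show ?thesis using closest_site_bounds(1)[OF x] by linarith
        qed
        ultimately have x1: "\<bar>real_of_int (- fst x)\<bar> \<le> (2 + ?d) * t powr \<delta>'"
          by (simp add: distrib_right)
        have x2: "\<bar>real_of_int (snd x $ i)\<bar> \<le> sqrt t + (2 + ?d)" for i
        proof -
          have "t powr \<gamma> \<le> t powr (1 / 2)" using t3 assms(8) by (intro powr_mono) auto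
          then have g: "t powr \<gamma> \<le> sqrt t" using t3 by (simp add: powr_half_sqrt)
          have "\<bar>snd ?p $ i\<bar> = t powr \<gamma> * \<bar>snd e $ i\<bar>" by (simp add: abs_mult)
          also have "\<dots> \<le> t powr \<gamma> * 1" by (intro mult_left_mono e2) simp
          finally show ?thesis using closest_site_bounds(2)[OF x, of i] g by linarith
        qed
        note Kx = K[OF x1 x2]
        have "1 / (exp 1 * real N) * (1 / real N) ^ A \<le> 1 / (exp 1 * real N) *
           (lay_step (\<lambda>y. z y \<omega>) (real N / t) D ^^ N) (\<lambda>k a. if k = 0 then indicator {snd x} a else 0) (- fst x) 0"
          using Kx by (intro mult_left_mono) auto
        also have "\<dots> \<le> measure (P \<omega> 0) {w \<in> space (P \<omega> 0). X t w = (fst x, snd x)}"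
          by (rule layered_walk_prob_ge[OF assms(7)]) (use \<open>\<omega> \<in> space M\<close> z0 t3 N D Kx in auto)
        finally have main: "1 / (exp 1 * real N) * (1 / real N) ^ A \<le> measure (P \<omega> 0) {w \<in> space (P \<omega> 0). X t w = x}"
          by simp
        have Nt: "real N \<le> t powr (\<kappa> / 2 + 3)"
        proof -
          have "2 * t powr (\<kappa> / 2 + 2) \<le> t * t powr (\<kappa> / 2 + 2)" using t3 by (intro mult_right_mono) auto
          also have "\<dots> = t powr (\<kappa> / 2 + 3)" using t3 powr_add[of t 1 "\<kappa> / 2 + 2"] by (simp add: add.commute)
          finally show ?thesis using N(2) by linarith
        qed
        have "exp 1 * real N * real N ^ A \<le> t * t powr (\<kappa> / 2 + 3) * (t powr (\<kappa> / 2 + 3)) ^ A"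
          using Nt t3 exp_le by (intro mult_mono power_mono) auto
        also have "\<dots> = t powr (m - 1)"
        proof -
          have "(t powr (\<kappa> / 2 + 3)) ^ A = t powr ((\<kappa> / 2 + 3) * real A)"
            using t3 by (simp add: powr_realpow[symmetric] powr_powr)
          then have "t * t powr (\<kappa> / 2 + 3) * (t powr (\<kappa> / 2 + 3)) ^ A
              = t powr 1 * t powr (\<kappa> / 2 + 3) * t powr ((\<kappa> / 2 + 3) * real A)" using t3 by simp
          also have "\<dots> = t powr (1 + (\<kappa> / 2 + 3) + (\<kappa> / 2 + 3) * real A)" by (simp only: powr_add)
          also have "1 + (\<kappa> / 2 + 3) + (\<kappa> / 2 + 3) * real A = m - 1" by (simp add: m_def algebra_simps)
          finally show ?thesis .
        qed
        also have "\<dots> \<le> t powr m" using t3 by (intro powr_mono) auto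
        finally have le: "exp 1 * real N * real N ^ A \<le> t powr m" .
        have "t powr (- m) = 1 / t powr m" by (simp add: powr_minus_divide)
        also have "\<dots> \<le> 1 / (exp 1 * real N * real N ^ A)"
          using le N(1) t3 by (intro divide_left_mono mult_pos_pos) auto
        also have "\<dots> = 1 / (exp 1 * real N) * (1 / real N) ^ A" by (simp add: power_one_over)
        finally show "t powr (- m) \<le> measure (P \<omega> 0) {w \<in> space (P \<omega> 0). X t w = x}" using main by linarith
      qed
    qed
    with m show ?case by blast
  qed
qed

end
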